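(* Let $\operatorname{char}K\ne2,3$, let $C$ be a $C_{3,4}$ curve in the normal form of the context, and let $\tilde D=D_1+D_2$ be the semi-typical degree $6$ divisor produced by the first stage of the algorithm (addition: $D_1\neq D_2$; doubling: $D_1=D_2$), given by $s\in W^9_{\tilde D}$, $t\in W^{10}_{\tilde D}$ as in the context. Then the second stage of the algorithm, namely producing from $(s,t)$ the coefficients of $F,G$ (and the inverse of the coefficient of $y$ in $F$) describing the degree $3$ divisor $A$ with $[A-3P_\infty]=[D_1-3P_\infty]+[D_2-3P_\infty]$, can be carried out by the explicit procedure in the context at a total cost of $19M,1I$, replacing what took $38M,1I$ previously. Consequently the cost of Jacobian operations on a $C_{3,4}$ curve can be reduced by $19M$, so that addition of typical elements can be carried out using $98M,2I$ and doubling using $110M,2I$. The results are certified to be correct and typical, provided all inverses can be computed.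
   Context: $K$ is a field and $C$ is a smooth projective (geometrically irreducible) curve of genus $g$ over $K$ with a $K$-rational point $P_\infty$; $R$ is the coordinate ring of the affine curve $C-\{P_\infty\}$; for nonzero $f\in R$, $\deg f$ is the order of the pole of $f$ at $P_\infty$ ($\deg 0=-\infty$). $W^N=\{f\in R:\deg f\le N\}$. A good divisor is an effective $K$-rational divisor whose support does not contain $P_\infty$. For $f\in R$ nonzero, $\operatorname{div} f$ denotes only the affine part of the divisor of $f$ (the component at $P_\infty$ is ignored). For a good divisor $D$, $I_D=\{f\in R: f=0 \text{ or } \operatorname{div} f\ge D\}$ and $W^N_D=W^N\cap I_D$. A divisor $D$ is typical if it is good of degree $d\ge g$ and there exist $s\in W^{d+g}_D$, $t\in W^{d+g+1}_D$ with $sW^{2g}+tW^{2g-1}+W^{d+g-1}=W^{d+3g}$; it is semi-typical if it is good of degree $d\ge g$ and $W^{d+g-1}_D=0$. Here $C$ is a $C_{3,4}$ curve: $g=3$, $\operatorname{char}K\neq2,3$, and the affine part $C-\{P_\infty\}$ has equation $x^4=y^3+(p_2x^2+p_1x+p_0)y+q_2x^2+q_1x+q_0$ with $p_i,q_i\in K$, $\deg x=3$, $\deg y=4$. A typical degree $3$ divisor $D$ is represented by $F=x^2+ay+bx+c\in W^6_D$ with $a\ne0$ and $G=xy+dy+ex+f\in W^7_D$, by storing $a,\dots,f$ and $a^{-1}$. Cost model: $M$ and $I$ count multiplications and inversions in $K$; additions, subtractions, and multiplications and divisions by $2$ are free. Two-stage algorithm for adding or doubling typical classes represented by $D_1,D_2$.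 The first stage uses one inversion and computes, when that inversion can be carried out (which certifies that $\tilde D=D_1+D_2$ is semi-typical and, in the case of addition, that $D_1,D_2$ are disjoint), the elements $s=x^3+s_1y^2+s_2xy+s_3x^2+s_4y+s_5x+s_6\in W^9_{\tilde D}$ and $t=x^2y+t_1y^2+t_2xy+t_3x^2+t_4y+t_5x+t_6\in W^{10}_{\tilde D}$. The second stage computes the divisor $A$ as follows: if $\operatorname{div}s=\tilde D+D$, then $A$ is given by $\operatorname{div}F=D+A$, with $F\in W^6_D$. In the previous algorithms (Abu Salem and Khuri-Makdisi) the total cost is $117M,2I$ for addition and $129M,2I$ for doubling, of which the second stage accounts for $38M,1I$. New second-stage procedure: compute $\ell_1=t_1-s_2+s_1^2$, $\ell_2=t_2-s_3+s_1(s_2+p_2)$, $\ell_3=t_3+s_1s_3$, $m_0=\ell_3-\ell_1t_1$, $m_1=-s_4-(\ell_1t_2+\ell_2t_1)-m_0s_1$, $m_2=t_4-s_5+s_1(s_4+p_1)+p_2\ell_3-(\ell_1t_3+\ell_2t_2)-m_0(s_2+p_2)$, $m_3=t_5+s_1(s_5+q_2)-\ell_2t_3-m_0s_3$, then invert $\ell_1$, put $\mu=m_1/\ell_1$, and compute $F=x^2-\ell_1y-(\mu+\ell_2)x+\mu\ell_2-m_2$, $G_0=-xy+s_1x^2+\mu y-(m_0+\mu s_1)x+\mu\ell_3-m_3$, $G=-G_0+s_1F$. (Only the coefficients of $F$ and $G$, and $\ell_1^{-1}$, are required as output.) *)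

theory Defs
  imports
    "HOL-Algebra.Algebraic_Closure_Type"
    "HOL-Algebra.Ideal_Product"
    "HOL-Algebra.Embedded_Algebras"
    "HOL-Library.Function_Algebras"
begin

section \<open>Plane affine curves\<close>

text \<open>
  An element of \<open>K[x,y]\<close> is a polynomial in \<open>y\<close> (outer variable) whose coefficients
  are polynomials in \<open>x\<close> (inner variable).
\<close>

definition Cst :: "'a::field \<Rightarrow> 'a poly poly" where "Cst c = [:[:c:]:]"
definition vx :: "'a::field poly poly" where "vx = [:[:0, 1:]:]"
definition vy :: "'a::field poly poly" where "vy = [:0, 1:]"

definition coeff2 :: "'a::field poly poly \<Rightarrow> nat \<Rightarrow> nat \<Rightarrow> 'a" where
  "coeff2 P i j = coeff (coeff P j) i"

definition total_degree :: "'a::field poly poly \<Rightarrow> nat" where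
  "total_degree P = Max {i + j | i j. coeff2 P i j \<noteq> 0}"

abbreviation bivariate :: "'a::field poly poly ring" where
  "bivariate \<equiv> ring_of_type_algebra"

definition residue_class :: "'a::field poly poly \<Rightarrow> 'a poly poly \<Rightarrow> 'a poly poly set" where
  "residue_class E P = (PIdl\<^bsub>bivariate\<^esub> E) +>\<^bsub>bivariate\<^esub> P"

definition coordinate_ring :: "'a::field poly poly \<Rightarrow> 'a poly poly set ring" where
  "coordinate_ring E = bivariate Quot (PIdl\<^bsub>bivariate\<^esub> E)"

text \<open>
  Order of vanishing at the closed point given by a maximal ideal \<open>m\<close> of \<open>S\<close>.
  Since \<open>m\<close> is maximal, \<open>m\<^sup>n\<close> is the contraction of the \<open>n\<close>-th power of the maximal ideal of
  the local ring at \<open>m\<close>, so at a regular point of a curve this is the valuation of that local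
  ring. It is only meaningful for \<open>f\<close> nonzero at the generic point.
\<close>
definition vanishing_order :: "'b ring \<Rightarrow> 'b set \<Rightarrow> 'b \<Rightarrow> nat" where
  "vanishing_order S m f = (GREATEST n. f \<in> m [^]\<^bsub>ideals_set S\<^esub> n)"

definition eval2 :: "'a::field poly poly \<Rightarrow> 'a alg_closure \<Rightarrow> 'a alg_closure \<Rightarrow> 'a alg_closure" where
  "eval2 P u v = poly (map_poly (\<lambda>a. poly (map_poly to_ac a) u) P) v"

definition smooth_plane_curve :: "'a::field poly poly \<Rightarrow> bool" where
  "smooth_plane_curve E \<longleftrightarrow>
     \<not> (\<exists>u v. eval2 E u v = 0 \<and> eval2 (map_poly pderiv E) u v = 0 \<and> eval2 (pderiv E) u v = 0)"


section \<open>\<open>C\<^bsub>3,4\<^esub>\<close> curves\<close>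

record 'a c34 =
  p0 :: 'a
  p1 :: 'a
  p2 :: 'a
  q0 :: 'a
  q1 :: 'a
  q2 :: 'a

definition curve_poly :: "'a::field c34 \<Rightarrow> 'a poly poly" where
  "curve_poly C = vy ^ 3 + (Cst (p2 C) * vx ^ 2 + Cst (p1 C) * vx + Cst (p0 C)) * vy
     + Cst (q2 C) * vx ^ 2 + Cst (q1 C) * vx + Cst (q0 C) - vx ^ 4"

text \<open>
  The projective closure is a plane quartic with the single point \<open>P\<^sub>\<infinity> = (0:1:0)\<close> at infinity,
  at which it is always smooth. So smoothness of the affine part makes \<open>C\<close> smooth, hence
  geometrically irreducible and of genus 3.
\<close>
definition c34_curve :: "'a::field c34 \<Rightarrow> bool" where
  "c34_curve C \<longleftrightarrow> smooth_plane_curve (curve_poly C)"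

definition genus :: int where "genus = 3"

abbreviation R :: "'a::field c34 \<Rightarrow> 'a poly poly set ring" where
  "R C \<equiv> coordinate_ring (curve_poly C)"

abbreviation cls :: "'a::field c34 \<Rightarrow> 'a poly poly \<Rightarrow> 'a poly poly set" where
  "cls C \<equiv> residue_class (curve_poly C)"

text \<open>
  The chart at infinity has the coordinates \<open>u = x / y\<close> and \<open>w = 1 / y\<close>, for which the inner
  and outer variables of a bivariate polynomial are reused, and \<open>P\<^sub>\<infinity>\<close> is its origin.
  For \<open>n\<close> at least the total degree of \<open>P\<close>, the following is \<open>w\<^sup>n P(u/w, 1/w)\<close>.
\<close>
definition chart_at_infinity :: "nat \<Rightarrow> 'a::field poly poly \<Rightarrow> 'a poly poly" where
  "chart_at_infinity n P =
     (\<Sum>j\<le>degree P. \<Sum>i\<le>degree (coeff P j). Cst (coeff2 P i j) * vx ^ i * vy ^ (n - i - j))"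

definition curve_poly_at_infinity :: "'a::field c34 \<Rightarrow> 'a poly poly" where
  "curve_poly_at_infinity C = chart_at_infinity 4 (curve_poly C)"

definition vanishing_order_at_infinity :: "'a::field c34 \<Rightarrow> 'a poly poly \<Rightarrow> nat" where
  "vanishing_order_at_infinity C P =
     (let E = curve_poly_at_infinity C; S = coordinate_ring E;
          m = Idl\<^bsub>S\<^esub> {residue_class E vx, residue_class E vy}
      in vanishing_order S m (residue_class E P))"

text \<open>
  The order of the pole of \<open>f = P(x,y) = P(u/w, 1/w)\<close> at \<open>P\<^sub>\<infinity>\<close>, for nonzero \<open>f\<close>. It does not
  depend on the polynomial \<open>P\<close> chosen to represent \<open>f\<close>.
\<close>
definition pole_order :: "'a::field c34 \<Rightarrow> 'a poly poly set \<Rightarrow> int" where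
  "pole_order C f =
     (let P = (SOME P. P \<in> f); n = total_degree P
      in int (n * vanishing_order_at_infinity C vy)
           - int (vanishing_order_at_infinity C (chart_at_infinity n P)))"


section \<open>Divisors\<close>

text \<open>Closed points of the projective curve; the affine ones are the maximal ideals of \<open>R\<close>.\<close>
datatype 'm pt = At_Infinity | Affine 'm
type_synonym 'a point = "'a poly poly set set pt"

definition points :: "'a::field c34 \<Rightarrow> 'a point set" where
  "points C = insert At_Infinity (Affine ` {m. maximalideal m (R C)})"

fun point_degree :: "'a::field c34 \<Rightarrow> 'a point \<Rightarrow> nat" where
  "point_degree C At_Infinity = 1"
| "point_degree C (Affine m) =
     ring.dim (R C Quot m) (range (\<lambda>c. m +>\<^bsub>R C\<^esub> cls C (Cst c))) (carrier (R C Quot m))"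

fun ord_at :: "'a::field c34 \<Rightarrow> 'a point \<Rightarrow> 'a poly poly set \<Rightarrow> int" where
  "ord_at C At_Infinity f = - pole_order C f"
| "ord_at C (Affine m) f = int (vanishing_order (R C) m f)"

type_synonym 'a divisor = "'a point \<Rightarrow> int"

definition is_divisor :: "'a::field c34 \<Rightarrow> 'a divisor \<Rightarrow> bool" where
  "is_divisor C D \<longleftrightarrow> finite {P. D P \<noteq> 0} \<and> {P. D P \<noteq> 0} \<subseteq> points C"

definition divisor_degree :: "'a::field c34 \<Rightarrow> 'a divisor \<Rightarrow> int" where
  "divisor_degree C D = (\<Sum>P | D P \<noteq> 0. D P * int (point_degree C P))"

definition P_inf :: "'a divisor" where
  "P_inf P = (if P = At_Infinity then 1 else 0)"

definition good :: "'a::field c34 \<Rightarrow> 'a divisor \<Rightarrow> bool" where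
  "good C D \<longleftrightarrow> is_divisor C D \<and> 0 \<le> D \<and> D At_Infinity = 0"

definition disjoint_divisors :: "'a divisor \<Rightarrow> 'a divisor \<Rightarrow> bool" where
  "disjoint_divisors D1 D2 \<longleftrightarrow> {P. D1 P \<noteq> 0} \<inter> {P. D2 P \<noteq> 0} = {}"

text \<open>The affine part of the divisor of a nonzero \<open>f \<in> R\<close>.\<close>
definition affine_div :: "'a::field c34 \<Rightarrow> 'a poly poly set \<Rightarrow> 'a divisor" where
  "affine_div C f P = (if P \<in> points C - {At_Infinity} then ord_at C P f else 0)"

text \<open>
  Linear equivalence on the complete curve: the difference is the divisor of a rational
  function \<open>f / g\<close>, every rational function being a quotient of elements of \<open>R\<close>.
\<close>
definition lin_equiv :: "'a::field c34 \<Rightarrow> 'a divisor \<Rightarrow> 'a divisor \<Rightarrow> bool" where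
  "lin_equiv C D D' \<longleftrightarrow> is_divisor C D \<and> is_divisor C D' \<and>
     (\<exists>f \<in> carrier (R C) - {\<zero>\<^bsub>R C\<^esub>}. \<exists>g \<in> carrier (R C) - {\<zero>\<^bsub>R C\<^esub>}.
        \<forall>P \<in> points C. D P - D' P = ord_at C P f - ord_at C P g)"

definition W :: "'a::field c34 \<Rightarrow> int \<Rightarrow> 'a poly poly set set" where
  "W C N = {f \<in> carrier (R C). f = \<zero>\<^bsub>R C\<^esub> \<or> pole_order C f \<le> N}"

definition I_div :: "'a::field c34 \<Rightarrow> 'a divisor \<Rightarrow> 'a poly poly set set" where
  "I_div C D = {f \<in> carrier (R C). f = \<zero>\<^bsub>R C\<^esub> \<or> D \<le> affine_div C f}"

definition W_div :: "'a::field c34 \<Rightarrow> 'a divisor \<Rightarrow> int \<Rightarrow> 'a poly poly set set" where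
  "W_div C D N = W C N \<inter> I_div C D"

definition typical :: "'a::field c34 \<Rightarrow> 'a divisor \<Rightarrow> bool" where
  "typical C D \<longleftrightarrow> good C D \<and> divisor_degree C D \<ge> genus \<and>
     (let d = divisor_degree C D; g = genus in
      \<exists>s \<in> W_div C D (d + g). \<exists>t \<in> W_div C D (d + g + 1).
        {s \<otimes>\<^bsub>R C\<^esub> a \<oplus>\<^bsub>R C\<^esub> t \<otimes>\<^bsub>R C\<^esub> b \<oplus>\<^bsub>R C\<^esub> c | a b c.
           a \<in> W C (2 * g) \<and> b \<in> W C (2 * g - 1) \<and> c \<in> W C (d + g - 1)} = W C (d + 3 * g))"

definition semi_typical :: "'a::field c34 \<Rightarrow> 'a divisor \<Rightarrow> bool" where
  "semi_typical C D \<longleftrightarrow> good C D \<and> divisor_degree C D \<ge> genus \<and>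
     W_div C D (divisor_degree C D + genus - 1) = {\<zero>\<^bsub>R C\<^esub>}"


section \<open>Representation of divisors\<close>

definition F_poly :: "'a::field \<Rightarrow> 'a \<Rightarrow> 'a \<Rightarrow> 'a poly poly" where
  "F_poly a b c = vx ^ 2 + Cst a * vy + Cst b * vx + Cst c"

definition G_poly :: "'a::field \<Rightarrow> 'a \<Rightarrow> 'a \<Rightarrow> 'a poly poly" where
  "G_poly d e f = vx * vy + Cst d * vy + Cst e * vx + Cst f"

definition represents :: "'a::field c34 \<Rightarrow> 'a divisor \<Rightarrow> 'a list \<Rightarrow> bool" where
  "represents C D r \<longleftrightarrow> typical C D \<and> divisor_degree C D = 3 \<and>
     (\<exists>a b c d e f. r = [a, b, c, d, e, f, inverse a] \<and> a \<noteq> 0 \<and>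
        cls C (F_poly a b c) \<in> W_div C D 6 \<and> cls C (G_poly d e f) \<in> W_div C D 7)"

definition s_poly :: "'a::field \<Rightarrow> 'a \<Rightarrow> 'a \<Rightarrow> 'a \<Rightarrow> 'a \<Rightarrow> 'a \<Rightarrow> 'a poly poly" where
  "s_poly s1 s2 s3 s4 s5 s6 =
     vx ^ 3 + Cst s1 * vy ^ 2 + Cst s2 * vx * vy + Cst s3 * vx ^ 2 + Cst s4 * vy + Cst s5 * vx + Cst s6"

definition t_poly :: "'a::field \<Rightarrow> 'a \<Rightarrow> 'a \<Rightarrow> 'a \<Rightarrow> 'a \<Rightarrow> 'a \<Rightarrow> 'a poly poly" where
  "t_poly t1 t2 t3 t4 t5 t6 =
     vx ^ 2 * vy + Cst t1 * vy ^ 2 + Cst t2 * vx * vy + Cst t3 * vx ^ 2 + Cst t4 * vy + Cst t5 * vx + Cst t6"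


section \<open>Straight-line programs and their cost\<close>

text \<open>
  Operands are positions in the list of the inputs followed by the results obtained so far.
  Inverting zero makes the program fail. Only \<open>Mul\<close> and \<open>Inv\<close> cost anything; multiplication
  by 2 is \<open>Add i i\<close>.
\<close>
datatype instr = One | Add nat nat | Sub nat nat | Half nat | Mul nat nat | Inv nat

definition fetch :: "'a list \<Rightarrow> nat \<Rightarrow> 'a option" where
  "fetch vs i = (if i < length vs then Some (vs ! i) else None)"

definition lift2 :: "('a \<Rightarrow> 'a \<Rightarrow> 'a) \<Rightarrow> 'a option \<Rightarrow> 'a option \<Rightarrow> 'a option" where
  "lift2 h u v = Option.bind u (\<lambda>a. Option.bind v (\<lambda>b. Some (h a b)))"

fun step :: "instr \<Rightarrow> 'a::field list \<Rightarrow> 'a option" where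
  "step One vs = Some 1"
| "step (Add i j) vs = lift2 (+) (fetch vs i) (fetch vs j)"
| "step (Sub i j) vs = lift2 (-) (fetch vs i) (fetch vs j)"
| "step (Half i) vs = map_option (\<lambda>a. a / 2) (fetch vs i)"
| "step (Mul i j) vs = lift2 (*) (fetch vs i) (fetch vs j)"
| "step (Inv i) vs = Option.bind (fetch vs i) (\<lambda>a. if a = 0 then None else Some (inverse a))"

fun exec :: "instr list \<Rightarrow> 'a::field list \<Rightarrow> 'a list option" where
  "exec [] vs = Some vs"
| "exec (c # cs) vs = Option.bind (step c vs) (\<lambda>v. exec cs (vs @ [v]))"

datatype slp = SLP (code: "instr list") (outputs: "nat list")

definition run :: "slp \<Rightarrow> 'a::field list \<Rightarrow> 'a list option" where
  "run P xs = Option.bind (exec (code P) xs) (\<lambda>vs. those (map (fetch vs) (outputs P)))"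

definition cost_M :: "slp \<Rightarrow> nat" where
  "cost_M P = length (filter (\<lambda>c. case c of Mul _ _ \<Rightarrow> True | _ \<Rightarrow> False) (code P))"

definition cost_I :: "slp \<Rightarrow> nat" where
  "cost_I P = length (filter (\<lambda>c. case c of Inv _ \<Rightarrow> True | _ \<Rightarrow> False) (code P))"

definition curve_coeffs :: "'a c34 \<Rightarrow> 'a list" where
  "curve_coeffs C = [p0 C, p1 C, p2 C, q0 C, q1 C, q2 C]"


section \<open>Two-stage addition and doubling\<close>

text \<open>The first stage produces the list \<open>[s1, \<dots>, s6, t1, \<dots>, t6]\<close>.\<close>
definition first_stage_result :: "'a::field c34 \<Rightarrow> 'a divisor \<Rightarrow> 'a list \<Rightarrow> bool" where
  "first_stage_result C Dt st \<longleftrightarrow>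
     (\<exists>s1 s2 s3 s4 s5 s6 t1 t2 t3 t4 t5 t6.
        st = [s1, s2, s3, s4, s5, s6, t1, t2, t3, t4, t5, t6] \<and>
        cls C (s_poly s1 s2 s3 s4 s5 s6) \<in> W_div C Dt 9 \<and>
        cls C (t_poly t1 t2 t3 t4 t5 t6) \<in> W_div C Dt 10)"

definition addition_first_stage :: "'a::field c34 \<Rightarrow> slp \<Rightarrow> bool" where
  "addition_first_stage C P \<longleftrightarrow>
     (\<forall>D1 D2 r1 r2 st. represents C D1 r1 \<and> represents C D2 r2 \<and> D1 \<noteq> D2 \<and>
        run P (curve_coeffs C @ r1 @ r2) = Some st \<longrightarrow>
        semi_typical C (D1 + D2) \<and> disjoint_divisors D1 D2 \<and> first_stage_result C (D1 + D2) st)"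

definition doubling_first_stage :: "'a::field c34 \<Rightarrow> slp \<Rightarrow> bool" where
  "doubling_first_stage C P \<longleftrightarrow>
     (\<forall>D1 r1 st. represents C D1 r1 \<and> run P (curve_coeffs C @ r1) = Some st \<longrightarrow>
        semi_typical C (D1 + D1) \<and> first_stage_result C (D1 + D1) st)"

text \<open>\<open>A\<close> represents the sum, in the Jacobian, of the classes of \<open>D1\<close> and \<open>D2\<close>.\<close>
definition sum_class :: "'a::field c34 \<Rightarrow> 'a divisor \<Rightarrow> 'a divisor \<Rightarrow> 'a divisor \<Rightarrow> bool" where
  "sum_class C D1 D2 A \<longleftrightarrow>
     lin_equiv C (A - 3 * P_inf) ((D1 - 3 * P_inf) + (D2 - 3 * P_inf))"

text \<open>Both the addition (\<open>D1 \<noteq> D2\<close>) and the doubling (\<open>D1 = D2\<close>) case are covered here.\<close>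
definition correct_second_stage :: "'a::field c34 \<Rightarrow> slp \<Rightarrow> bool" where
  "correct_second_stage C P \<longleftrightarrow>
     (\<forall>D1 D2 s1 s2 s3 s4 s5 s6 t1 t2 t3 t4 t5 t6 out.
        typical C D1 \<and> divisor_degree C D1 = 3 \<and> typical C D2 \<and> divisor_degree C D2 = 3 \<and>
        semi_typical C (D1 + D2) \<and>
        cls C (s_poly s1 s2 s3 s4 s5 s6) \<in> W_div C (D1 + D2) 9 \<and>
        cls C (t_poly t1 t2 t3 t4 t5 t6) \<in> W_div C (D1 + D2) 10 \<and>
        run P (curve_coeffs C @ [s1, s2, s3, s4, s5, s6, t1, t2, t3, t4, t5, t6]) = Some out \<longrightarrow>
        (\<exists>D A a b c d e f.
           good C D \<and> good C A \<and> out = [a, b, c, d, e, f, inverse a] \<and>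
           affine_div C (cls C (s_poly s1 s2 s3 s4 s5 s6)) = (D1 + D2) + D \<and>
           cls C (F_poly a b c) \<in> W_div C D 6 \<and>
           affine_div C (cls C (F_poly a b c)) = D + A \<and>
           represents C A out \<and> sum_class C D1 D2 A))"

definition run_two_stage :: "'a::field c34 \<Rightarrow> slp \<Rightarrow> slp \<Rightarrow> 'a list \<Rightarrow> 'a list option" where
  "run_two_stage C P Q r =
     Option.bind (run P (curve_coeffs C @ r)) (\<lambda>st. run Q (curve_coeffs C @ st))"

definition two_stage_cost_M :: "slp \<Rightarrow> slp \<Rightarrow> nat" where
  "two_stage_cost_M P Q = cost_M P + cost_M Q"

definition two_stage_cost_I :: "slp \<Rightarrow> slp \<Rightarrow> nat" where
  "two_stage_cost_I P Q = cost_I P + cost_I Q"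

definition correct_addition :: "'a::field c34 \<Rightarrow> slp \<Rightarrow> slp \<Rightarrow> bool" where
  "correct_addition C P Q \<longleftrightarrow>
     (\<forall>D1 D2 r1 r2 out. represents C D1 r1 \<and> represents C D2 r2 \<and> D1 \<noteq> D2 \<and>
        run_two_stage C P Q (r1 @ r2) = Some out \<longrightarrow>
        (\<exists>A. represents C A out \<and> sum_class C D1 D2 A))"

definition correct_doubling :: "'a::field c34 \<Rightarrow> slp \<Rightarrow> slp \<Rightarrow> bool" where
  "correct_doubling C P Q \<longleftrightarrow>
     (\<forall>D1 r1 out. represents C D1 r1 \<and> run_two_stage C P Q r1 = Some out \<longrightarrow>
        (\<exists>A. represents C A out \<and> sum_class C D1 D1 A))"


section \<open>The new second stage\<close>

definition new_procedure :: "'a::field c34 \<Rightarrow>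
    'a \<Rightarrow> 'a \<Rightarrow> 'a \<Rightarrow> 'a \<Rightarrow> 'a \<Rightarrow> 'a \<Rightarrow> 'a \<Rightarrow> 'a \<Rightarrow> 'a \<Rightarrow> 'a \<Rightarrow> 'a \<Rightarrow> 'a \<Rightarrow> 'a list option" where
  "new_procedure C s1 s2 s3 s4 s5 s6 t1 t2 t3 t4 t5 t6 =
    (let l1 = t1 - s2 + s1 ^ 2;
         l2 = t2 - s3 + s1 * (s2 + p2 C);
         l3 = t3 + s1 * s3;
         m0 = l3 - l1 * t1;
         m1 = - s4 - (l1 * t2 + l2 * t1) - m0 * s1;
         m2 = t4 - s5 + s1 * (s4 + p1 C) + p2 C * l3 - (l1 * t3 + l2 * t2) - m0 * (s2 + p2 C);
         m3 = t5 + s1 * (s5 + q2 C) - l2 * t3 - m0 * s3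
     in if l1 = 0 then None else
       (let \<mu> = m1 / l1;
            F = vx ^ 2 - Cst l1 * vy - Cst (\<mu> + l2) * vx + Cst (\<mu> * l2 - m2);
            G0 = - (vx * vy) + Cst s1 * vx ^ 2 + Cst \<mu> * vy - Cst (m0 + \<mu> * s1) * vx + Cst (\<mu> * l3 - m3);
            G = - G0 + Cst s1 * F
        in Some [coeff2 F 0 1, coeff2 F 1 0, coeff2 F 0 0,
                 coeff2 G 0 1, coeff2 G 1 0, coeff2 G 0 0, inverse (coeff2 F 0 1)]))"

end

theory Submission
  imports Defs
begin

text \<open>
  Write \<open>I\<^sub>D\<close> for the functions that vanish on \<open>D\<close> and \<open>Dt = D1 + D2\<close>. The formulas of the second
  stage solve for functions \<open>F\<close> of pole order 6 and \<open>G\<^sub>0\<close> of pole order 7 such that \<open>F t + G\<^sub>0 s\<close> has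
  pole order at most 8 (\<open>second_stage_relation\<close>). This function vanishes on \<open>Dt\<close>, and \<open>Dt\<close> is
  semi-typical, so it is zero: \<open>F t = - G\<^sub>0 s\<close>.

  The inverted quantity \<open>l1\<close> is, up to sign, the leading coefficient of \<open>(y - s1 x) s - x t\<close> at
  pole order 11. If it is nonzero, then \<open>s\<close> and \<open>t\<close> generate an ideal with elements of all pole orders
  from 9 on. No function in \<open>I\<^sub>D\<^sub>t\<close> has a smaller one, and hence \<open>I\<^sub>D\<^sub>t = (s, t)\<close>
  (\<open>order_ideal_generated\<close>). So at each point the multiplicity of \<open>Dt\<close> is the smaller of the orders
  of \<open>s\<close> and \<open>t\<close>. Comparing orders in \<open>F t = - G\<^sub>0 s\<close> now gives \<open>div F \<ge> D\<close> for \<open>div s = Dt + D\<close>, and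
  \<open>div G\<^sub>0 \<ge> A\<close> for \<open>div F = D + A\<close> (\<open>second_stage\<close>). If \<open>h\<close> vanishes on \<open>A\<close> and has pole order at
  most 5, then \<open>h s / F\<close> is regular, vanishes on \<open>Dt\<close> and has pole order at most 8, so that \<open>h = 0\<close>.
  On the other hand \<open>F\<close>, \<open>G\<close> and \<open>y F - x G\<close> have pole orders 6, 7 and 8. Both facts together make \<open>A\<close>
  a typical divisor of degree 3 that is represented by \<open>F\<close> and \<open>G\<close> (\<open>represents_if_generators\<close>), and
  \<open>F / s\<close> is the function that shows \<open>A\<close> to have the right class (\<open>sum_class_if\<close>).

  Behind this is some theory of the curve, in an elementary form. Laurent expansion at \<open>P\<^sub>\<infinity>\<close> embeds
  the coordinate ring \<open>R\<close> into a field and computes pole orders (\<open>pole_order_eq\<close>). The pole orders are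
  those of the monomials \<open>x\<^sup>i y\<^sup>j\<close>, and dimensions of quotients of subspaces of \<open>R\<close> are numbers of pole
  orders (\<open>extends_pole_ords\<close>). By smoothness, all maximal ideals of \<open>R\<close> are locally principal
  (\<open>maximal_ideal_locally_principal\<close>), which makes the orders of vanishing additive. From this
  follow the equality of the degree of a divisor with the codimension of its ideal
  (\<open>extends_divisor_degree\<close>) and the local nature of divisibility (\<open>divides_if_val_le\<close>).

  As to the cost, the procedure as it is written takes 22 multiplications. Two of them are saved
  by getting the products of the \<open>l\<^sub>i\<close> with the \<open>t\<^sub>j\<close> as the coefficients of a product of polynomials, by
  interpolation, and one by a cancellation in \<open>G\<close> (\<open>run_second_stage_code\<close>).
\<close>

section \<open>A straight-line program with 19 multiplications\<close>

text \<open>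
  The memory of the program: \<open>p0, \<dots>, q2\<close> at 0 to 5, \<open>s1, \<dots>, s6\<close> at 6 to 11, \<open>t1, \<dots>, t6\<close> at 12 to
  17, and results from 18 on. This block leaves \<open>l1, l2, l3\<close> at 20, 24, 26 and \<open>s2 + p2\<close> at 21.
\<close>
definition code_l :: "instr list" where
  "code_l = [Mul 6 6, Sub 12 7, Add 19 18, Add 7 2, Mul 6 21, Sub 13 8, Add 23 22, Mul 6 8, Add 14 25]"

text \<open>
  The products \<open>l1 t1\<close>, \<open>l1 t2 + l2 t1\<close>, \<open>l1 t3 + l2 t2\<close>, \<open>l2 t3\<close> are the coefficients of
  \<open>(l1 + l2 z) (t1 + t2 z + t3 z\<^sup>2)\<close>. Interpolation at \<open>z = 0, \<infinity>, 1, -1\<close> gets them from four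
  multiplications instead of six; the price is a halving, which excludes
  characteristic 2. They end up at 27, 41, 38 and 28.
\<close>
definition code_products :: "instr list" where
  "code_products = [Mul 20 12, Mul 24 14, Add 20 24, Add 12 14, Add 30 13, Mul 29 31, Sub 20 24,
     Sub 30 13, Mul 33 34, Add 32 35, Half 36, Sub 37 27, Sub 32 35, Half 39, Sub 40 28]"

text \<open>
  The values \<open>m0, m1, m2, m3\<close> are left at 42, 47, 56, 62, and a zero, used for negation, at 46.
\<close>
definition code_m :: "instr list" where
  "code_m = [Sub 26 27, Mul 42 6, Add 9 41, Add 44 43, Sub 6 6, Sub 46 45,
     Add 9 1, Mul 6 48, Mul 2 26, Mul 42 21, Sub 15 10, Add 52 49, Add 53 50, Sub 54 38, Sub 55 51,
     Add 10 5, Mul 6 57, Mul 42 8, Add 16 58, Sub 60 28, Sub 61 59]"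

text \<open>
  The inverse of \<open>l1\<close> is at 63 and \<open>\<mu>\<close> at 64. Computing \<open>G = - G\<^sub>0 + s1 F\<close> coefficientwise costs a
  multiplication too many; but in the coefficient of \<open>x\<close> the terms with \<open>\<mu> s1\<close> cancel and leave
  \<open>m0 - s1 l2\<close>, which needs only one.
\<close>
definition code_FG :: "instr list" where
  "code_FG = [Inv 20, Mul 47 63, Mul 64 24, Sub 65 56, Sub 46 20, Add 64 24, Sub 46 68, Mul 6 20,
     Add 64 70, Sub 46 71, Mul 6 24, Sub 42 73, Mul 64 26, Mul 6 66, Sub 62 75, Add 77 76, Sub 46 63]"

definition second_stage_code :: slp where
  "second_stage_code = SLP (code_l @ code_products @ code_m @ code_FG) [67, 69, 66, 72, 74, 78, 79]"

lemma cost_second_stage_code: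
  "cost_M second_stage_code = 19" "cost_I second_stage_code = 1"
  by (simp_all add: cost_M_def cost_I_def second_stage_code_def code_l_def code_products_def
        code_m_def code_FG_def)

lemma exec_append: "exec (cs @ ds) vs = Option.bind (exec cs vs) (exec ds)"
proof (induction cs arbitrary: vs)
  case (Cons c cs)
  then show ?case by (cases "step c vs") simp_all
qed simp

lemma two_neq_0:
  assumes "CHAR('a::field) \<noteq> 2"
  shows "(2::'a) \<noteq> 0"
proof
  assume "(2::'a) = 0"
  then have "CHAR('a) dvd 2"
    by (metis of_nat_eq_0_iff_char_dvd of_nat_numeral)
  then have "CHAR('a) = 1"
    using assms by (metis dvd_imp_le two_is_prime_nat prime_nat_iff)
  then show False using of_nat_CHAR[where 'a = 'a] by simp
qed

text \<open>
  The blocks are evaluated on arbitrary memory contents, so that the expressions computed by one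
  block enter the next one as variables.
\<close>
lemma exec_code_l:
  "exec code_l [v0, v1, v2, v3, v4, v5, v6, v7, v8, v9, v10, v11, v12, v13, v14, v15, v16, v17] =
   Some [v0, v1, v2, v3, v4, v5, v6, v7, v8, v9, v10, v11, v12, v13, v14, v15, v16, v17,
     v6 * v6, v12 - v7, (v12 - v7) + v6 * v6, v7 + v2, v6 * (v7 + v2), v13 - v8,
     (v13 - v8) + v6 * (v7 + v2), v6 * v8, v14 + v6 * v8 :: 'a::field]"
  by (simp add: code_l_def fetch_def lift2_def)

lemma exec_code_products:
  assumes "(2 :: 'a::field) \<noteq> 0"
  shows "\<exists>v29 v30 v31 v32 v33 v34 v35 v36 v37 v39 v40. exec code_products [v0, v1, v2, v3, v4, v5, v6, v7, v8, v9, v10, v11, v12,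
     v13, v14, v15, v16, v17, v18, v19, v20, v21, v22, v23, v24, v25, v26] =
   Some [v0, v1, v2, v3, v4, v5, v6, v7, v8, v9, v10, v11, v12, v13, v14, v15, v16, v17,
     v18, v19, v20, v21, v22, v23, v24, v25, v26,
     v20 * v12, v24 * v14, v29, v30, v31, v32, v33, v34, v35, v36, v37,
     v20 * v14 + v24 * v13, v39, v40, v20 * v13 + v24 * v12 :: 'a]"
proof -
  have mid: "((v20 + v24) * (v12 + v14 + v13) + (v20 - v24) * (v12 + v14 - v13)) / 2 - v20 * v12
          = v20 * v14 + v24 * v13"
    using assms by (simp add: divide_simps) (simp add: algebra_simps)
  have low: "((v20 + v24) * (v12 + v14 + v13) - (v20 - v24) * (v12 + v14 - v13)) / 2 - v24 * v14
          = v20 * v13 + v24 * v12"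
    using assms by (simp add: divide_simps) (simp add: algebra_simps)
  show ?thesis
    using mid low by (simp add: code_products_def fetch_def lift2_def del: eq_divide_eq_numeral1 divide_eq_eq_numeral1)
qed

lemma exec_code_m:
  "\<exists>v43 v44 v45 v48 v49 v50 v51 v52 v53 v54 v55 v57 v58 v59 v60 v61.
     exec code_m [v0, v1, v2, v3, v4, v5, v6, v7, v8, v9, v10, v11, v12,
     v13, v14, v15, v16, v17, v18, v19, v20, v21, v22, v23, v24, v25, v26, v27, v28, v29, v30,
     v31, v32, v33, v34, v35, v36, v37, v38, v39, v40, v41] =
   Some [v0, v1, v2, v3, v4, v5, v6, v7, v8, v9, v10, v11, v12,
     v13, v14, v15, v16, v17, v18, v19, v20, v21, v22, v23, v24, v25, v26, v27, v28, v29, v30,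
     v31, v32, v33, v34, v35, v36, v37, v38, v39, v40, v41,
     v26 - v27, v43, v44, v45, 0, - v9 - v41 - (v26 - v27) * v6, v48, v49, v50, v51, v52, v53,
     v54, v55, v15 - v10 + v6 * (v9 + v1) + v2 * v26 - v38 - (v26 - v27) * v21,
     v57, v58, v59, v60, v61, v16 + v6 * (v10 + v5) - v28 - (v26 - v27) * v8 :: 'a::field]"
  by (simp add: code_m_def fetch_def lift2_def)

lemma exec_code_FG:
  assumes "v46 = (0 :: 'a::field)"
  shows "Option.bind (exec code_FG [v0, v1, v2, v3, v4, v5, v6, v7, v8, v9, v10, v11, v12,
     v13, v14, v15, v16, v17, v18, v19, v20, v21, v22, v23, v24, v25, v26, v27, v28, v29, v30,
     v31, v32, v33, v34, v35, v36, v37, v38, v39, v40, v41, v42, v43, v44, v45, v46, v47, v48, v49,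
     v50, v51, v52, v53, v54, v55, v56, v57, v58, v59, v60, v61, v62])
      (\<lambda>vs. those (map (fetch vs) [67, 69, 66, 72, 74, 78, 79])) =
   (if v20 = 0 then None else let \<mu> = v47 / v20 in
      Some [- v20, - (\<mu> + v24), \<mu> * v24 - v56, - \<mu> - v6 * v20, v42 - v6 * v24,
        v62 - \<mu> * v26 + v6 * (\<mu> * v24 - v56), - inverse v20])"
  using assms by (simp add: code_FG_def fetch_def lift2_def Let_def divide_inverse)

lemma coeff2_add: "coeff2 (P + Q) i j = coeff2 P i j + coeff2 Q i j"
  and coeff2_diff: "coeff2 (P - Q) i j = coeff2 P i j - coeff2 Q i j"
  and coeff2_minus: "coeff2 (- P) i j = - coeff2 P i j"
  by (simp_all add: coeff2_def)

lemma coeff2_Cst_mult: "coeff2 (Cst c * P) i j = c * coeff2 P i j"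
  by (simp add: coeff2_def Cst_def)

lemma monomial_eq_monom: "vx ^ k * vy ^ l = monom (monom (1::'a::field) k) l"
proof -
  have "vx ^ k = [:monom (1::'a) k:]"
    by (simp add: vx_def monom_altdef poly_const_pow)
  then show ?thesis
    by (simp add: vy_def monom_altdef[of "monom 1 k"])
qed

lemma coeff2_monomial:
  "coeff2 (vx ^ k * vy ^ l) i j = (if i = k \<and> j = l then 1 else (0::'a::field))"
  by (simp add: coeff2_def monomial_eq_monom)

lemma coeff2_basic:
  "coeff2 (vx ^ k) i j = (if i = k \<and> j = 0 then 1 else (0::'a::field))"
  "coeff2 (vy ^ k) i j = (if i = 0 \<and> j = k then 1 else (0::'a::field))"
  "coeff2 vx i j = (if i = 1 \<and> j = 0 then 1 else (0::'a::field))"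
  "coeff2 vy i j = (if i = 0 \<and> j = 1 then 1 else (0::'a::field))"
  "coeff2 (vx * vy) i j = (if i = 1 \<and> j = 1 then 1 else (0::'a::field))"
  using coeff2_monomial[of k 0 i j] coeff2_monomial[of 0 k i j] coeff2_monomial[of 1 0 i j]
    coeff2_monomial[of 0 1 i j] coeff2_monomial[of 1 1 i j]
  by (simp_all split: if_splits)

lemma coeff2_Cst: "coeff2 (Cst c) i j = (if i = 0 \<and> j = 0 then c else 0)"
  by (simp add: coeff2_def Cst_def coeff_pCons split: nat.splits)

lemmas coeff2_simps = coeff2_add coeff2_diff coeff2_minus coeff2_Cst_mult coeff2_basic coeff2_Cst

lemma new_procedure_eq:
  fixes C :: "'a::field c34"
  assumes "l1 = t1 - s2 + s1 ^ 2"
    and "l2 = t2 - s3 + s1 * (s2 + p2 C)"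
    and "l3 = t3 + s1 * s3"
    and "m0 = l3 - l1 * t1"
    and "m1 = - s4 - (l1 * t2 + l2 * t1) - m0 * s1"
    and "m2 = t4 - s5 + s1 * (s4 + p1 C) + p2 C * l3 - (l1 * t3 + l2 * t2) - m0 * (s2 + p2 C)"
    and "m3 = t5 + s1 * (s5 + q2 C) - l2 * t3 - m0 * s3"
    and "\<mu> = m1 / l1"
  shows "new_procedure C s1 s2 s3 s4 s5 s6 t1 t2 t3 t4 t5 t6 =
    (if l1 = 0 then None else
      Some [- l1, - (\<mu> + l2), \<mu> * l2 - m2, - \<mu> - s1 * l1, m0 - s1 * l2,
        m3 - \<mu> * l3 + s1 * (\<mu> * l2 - m2), - inverse l1])"
  unfolding new_procedure_def Let_def
  unfolding assms(1-3)[symmetric]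
  unfolding assms(4)[symmetric]
  unfolding assms(5-7)[symmetric]
  unfolding assms(8)[symmetric]
  by (simp add: coeff2_simps) (simp add: algebra_simps)

lemma run_second_stage_code:
  assumes "(2::'a::field) \<noteq> 0"
  shows "run second_stage_code (curve_coeffs C @ [s1, s2, s3, s4, s5, s6, t1, t2, t3, t4, t5, t6]) =
    new_procedure (C :: 'a c34) s1 s2 s3 s4 s5 s6 t1 t2 t3 t4 t5 t6"
proof -
  define l1 where "l1 = t1 - s2 + s1 * s1"
  define l2 where "l2 = t2 - s3 + s1 * (s2 + p2 C)"
  define l3 where "l3 = t3 + s1 * s3"
  note block_l = exec_code_l[of "p0 C" "p1 C" "p2 C" "q0 C" "q1 C" "q2 C" s1 s2 s3 s4 s5 s6
      t1 t2 t3 t4 t5 t6, folded l1_def l2_def l3_def]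
  obtain v29 v30 v31 v32 v33 v34 v35 v36 v37 v39 v40 where
    block_products: "exec code_products [p0 C, p1 C, p2 C, q0 C, q1 C, q2 C, s1, s2, s3, s4, s5, s6,
      t1, t2, t3, t4, t5, t6, s1 * s1, t1 - s2, l1, s2 + p2 C, s1 * (s2 + p2 C), t2 - s3, l2, s1 * s3, l3]
    = Some [p0 C, p1 C, p2 C, q0 C, q1 C, q2 C, s1, s2, s3, s4, s5, s6,
      t1, t2, t3, t4, t5, t6, s1 * s1, t1 - s2, l1, s2 + p2 C, s1 * (s2 + p2 C), t2 - s3, l2, s1 * s3, l3,
      l1 * t1, l2 * t3, v29, v30, v31, v32, v33, v34, v35, v36, v37, l1 * t3 + l2 * t2, v39, v40,
      l1 * t2 + l2 * t1]"
    using exec_code_products[OF assms, of "p0 C" "p1 C" "p2 C" "q0 C" "q1 C" "q2 C" s1 s2 s3 s4 s5 s6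
      t1 t2 t3 t4 t5 t6 "s1 * s1" "t1 - s2" l1 "s2 + p2 C" "s1 * (s2 + p2 C)" "t2 - s3" l2 "s1 * s3" l3]
    by (elim exE) (rule that)
  define m0 where "m0 = l3 - l1 * t1"
  define m1 where "m1 = - s4 - (l1 * t2 + l2 * t1) - m0 * s1"
  define m2 where "m2 = t4 - s5 + s1 * (s4 + p1 C) + p2 C * l3 - (l1 * t3 + l2 * t2) - m0 * (s2 + p2 C)"
  define m3 where "m3 = t5 + s1 * (s5 + q2 C) - l2 * t3 - m0 * s3"
  obtain v43 v44 v45 v48 v49 v50 v51 v52 v53 v54 v55 v57 v58 v59 v60 v61 where
    block_m: "exec code_m [p0 C, p1 C, p2 C, q0 C, q1 C, q2 C, s1, s2, s3, s4, s5, s6,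
      t1, t2, t3, t4, t5, t6, s1 * s1, t1 - s2, l1, s2 + p2 C, s1 * (s2 + p2 C), t2 - s3, l2, s1 * s3, l3,
      l1 * t1, l2 * t3, v29, v30, v31, v32, v33, v34, v35, v36, v37, l1 * t3 + l2 * t2, v39, v40,
      l1 * t2 + l2 * t1]
    = Some [p0 C, p1 C, p2 C, q0 C, q1 C, q2 C, s1, s2, s3, s4, s5, s6,
      t1, t2, t3, t4, t5, t6, s1 * s1, t1 - s2, l1, s2 + p2 C, s1 * (s2 + p2 C), t2 - s3, l2, s1 * s3, l3,
      l1 * t1, l2 * t3, v29, v30, v31, v32, v33, v34, v35, v36, v37, l1 * t3 + l2 * t2, v39, v40,
      l1 * t2 + l2 * t1, m0, v43, v44, v45, 0, m1, v48, v49, v50, v51, v52, v53, v54, v55, m2,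
      v57, v58, v59, v60, v61, m3]"
    using exec_code_m[of "p0 C" "p1 C" "p2 C" "q0 C" "q1 C" "q2 C" s1 s2 s3 s4 s5 s6
      t1 t2 t3 t4 t5 t6 "s1 * s1" "t1 - s2" l1 "s2 + p2 C" "s1 * (s2 + p2 C)" "t2 - s3" l2 "s1 * s3" l3
      "l1 * t1" "l2 * t3" v29 v30 v31 v32 v33 v34 v35 v36 v37 "l1 * t3 + l2 * t2" v39 v40
      "l1 * t2 + l2 * t1", folded m0_def, folded m1_def m2_def m3_def]
    by (elim exE) (rule that)
  have "run second_stage_code (curve_coeffs C @ [s1, s2, s3, s4, s5, s6, t1, t2, t3, t4, t5, t6]) =
    (if l1 = 0 then None else let \<mu> = m1 / l1 in
      Some [- l1, - (\<mu> + l2), \<mu> * l2 - m2, - \<mu> - s1 * l1, m0 - s1 * l2,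
        m3 - \<mu> * l3 + s1 * (\<mu> * l2 - m2), - inverse l1])"
    unfolding run_def second_stage_code_def curve_coeffs_def slp.sel append_Cons append_Nil
      exec_append block_l block_products block_m Option.bind.simps
    by (rule exec_code_FG) (rule refl)
  also have "\<dots> = new_procedure C s1 s2 s3 s4 s5 s6 t1 t2 t3 t4 t5 t6"
    by (simp add: new_procedure_eq[OF _ l2_def l3_def m0_def m1_def m2_def m3_def refl] l1_def
        power2_eq_square Let_def)
  finally show ?thesis .
qed

section \<open>Powers of locally principal ideals\<close>

lemma bivariate_simps [simp]:
  "carrier bivariate = UNIV" "x \<otimes>\<^bsub>bivariate\<^esub> y = x * y" "x \<oplus>\<^bsub>bivariate\<^esub> y = x + y"
  "\<one>\<^bsub>bivariate\<^esub> = 1" "\<zero>\<^bsub>bivariate\<^esub> = 0"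
  by (simp_all add: ring_of_type_algebra_def)

lemma cring_bivariate: "cring (bivariate :: 'a::field poly poly ring)"
  by (rule cring_from_type_algebra)

lemma PIdl_bivariate: "PIdl\<^bsub>bivariate\<^esub> E = {P. E dvd P}"
  by (auto simp: cgenideal_def dvd_def mult.commute)

lemma ideal_PIdl: "ideal (PIdl\<^bsub>bivariate\<^esub> E) bivariate"
  using cring.cgenideal_ideal[OF cring_bivariate] by simp

lemma mem_residue_class: "Q \<in> residue_class E P \<longleftrightarrow> E dvd (Q - P)"
proof -
  have "Q \<in> residue_class E P \<longleftrightarrow> (\<exists>h. E dvd h \<and> Q = h + P)"
    by (auto simp: residue_class_def a_r_coset_def r_coset_def PIdl_bivariate)
  also have "\<dots> \<longleftrightarrow> E dvd (Q - P)"
    by (metis add_diff_cancel_right' diff_add_cancel)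
  finally show ?thesis .
qed

lemma residue_class_eq_iff: "residue_class E P = residue_class E Q \<longleftrightarrow> E dvd (P - Q)"
proof
  assume "residue_class E P = residue_class E Q"
  then show "E dvd (P - Q)" using mem_residue_class[of P E P] mem_residue_class[of P E Q] by simp
next
  assume E: "E dvd (P - Q)"
  have "E dvd (H - P) \<longleftrightarrow> E dvd (H - Q)" for H
    using dvd_add_left_iff[OF E, of "H - P"] by simp
  then show "residue_class E P = residue_class E Q"
    by (auto simp: mem_residue_class)
qed

lemma ring_hom_residue_class:
  "ring_hom_ring bivariate (coordinate_ring E) (residue_class E)"
  using ideal.rcos_ring_hom_ring[OF ideal_PIdl[of E]]
  by (simp add: coordinate_ring_def residue_class_def[abs_def])

lemma cring_coordinate_ring: "cring (coordinate_ring E)"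
  unfolding coordinate_ring_def by (rule ideal.quotient_is_cring[OF ideal_PIdl cring_bivariate])

lemma carrier_coordinate_ring: "carrier (coordinate_ring E) = range (residue_class E)"
  by (auto simp: coordinate_ring_def FactRing_def A_RCOSETS_def' residue_class_def)

lemma residue_class_closed [simp]: "residue_class E P \<in> carrier (coordinate_ring E)"
  by (simp add: carrier_coordinate_ring)

lemma residue_class_hom:
  "residue_class E (P + Q) = residue_class E P \<oplus>\<^bsub>coordinate_ring E\<^esub> residue_class E Q"
  "residue_class E (P * Q) = residue_class E P \<otimes>\<^bsub>coordinate_ring E\<^esub> residue_class E Q"
  "residue_class E 1 = \<one>\<^bsub>coordinate_ring E\<^esub>"
  "residue_class E 0 = \<zero>\<^bsub>coordinate_ring E\<^esub>"
  using ring_hom_ring.homh[OF ring_hom_residue_class[of E]]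
    ring_hom_zero[OF ring_hom_ring.homh[OF ring_hom_residue_class[of E]]
      cring.axioms(1)[OF cring_bivariate] cring.axioms(1)[OF cring_coordinate_ring]]
  by (auto simp: ring_hom_def)

lemma residue_class_eq_0_iff: "residue_class E P = \<zero>\<^bsub>coordinate_ring E\<^esub> \<longleftrightarrow> E dvd P"
  using residue_class_eq_iff[of E P 0] by (simp add: residue_class_hom)

text \<open>
  Ideals of a quotient of \<open>K[x,y]\<close> are handled through their preimages in \<open>K[x,y]\<close>, where
  arithmetic is free of carriers and classes.
\<close>
definition is_ideal :: "'r::comm_ring_1 set \<Rightarrow> bool" where
  "is_ideal M \<longleftrightarrow> 0 \<in> M \<and> (\<forall>P\<in>M. \<forall>Q\<in>M. P + Q \<in> M) \<and> (\<forall>A. \<forall>P\<in>M. A * P \<in> M)"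

lemma is_idealD:
  assumes "is_ideal M"
  shows "0 \<in> M" "P \<in> M \<Longrightarrow> Q \<in> M \<Longrightarrow> P + Q \<in> M" "P \<in> M \<Longrightarrow> A * P \<in> M"
    "P \<in> M \<Longrightarrow> P * A \<in> M" "P \<in> M \<Longrightarrow> - P \<in> M" "P \<in> M \<Longrightarrow> Q \<in> M \<Longrightarrow> P - Q \<in> M"
proof -
  show *: "0 \<in> M" "P \<in> M \<Longrightarrow> Q \<in> M \<Longrightarrow> P + Q \<in> M" "P \<in> M \<Longrightarrow> A * P \<in> M" for P Q A
    using assms by (auto simp: is_ideal_def)
  show "P \<in> M \<Longrightarrow> P * A \<in> M" using *(3)[of P A] by (simp add: mult.commute)
  show "P \<in> M \<Longrightarrow> - P \<in> M" for P using *(3)[of P "-1"] by simp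
  from *(2)[OF _ this] show "P \<in> M \<Longrightarrow> Q \<in> M \<Longrightarrow> P - Q \<in> M" by fastforce
qed

lemma is_ideal_adjoin:
  assumes "is_ideal M"
  shows "is_ideal {P + r * b | P r. P \<in> M}" "M \<subseteq> {P + r * b | P r. P \<in> M}" "b \<in> {P + r * b | P r. P \<in> M}"
proof -
  note M = is_idealD[OF assms]
  define J where "J = {P + r * b | P r. P \<in> M}"
  have MJ: "M \<subseteq> J"
  proof
    fix P assume "P \<in> M"
    then have "P + 0 * b \<in> J" unfolding J_def by blast
    then show "P \<in> J" by simp
  qed
  have "0 + 1 * b \<in> J" using M(1) unfolding J_def by blast
  then have bJ: "b \<in> J" by simp
  have "is_ideal J"
    unfolding is_ideal_def
  proof (intro conjI ballI allI)
    show "0 \<in> J" using M(1) MJ by blast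
    fix A P assume "P \<in> J"
    then obtain P' r where P: "P = P' + r * b" "P' \<in> M" unfolding J_def by blast
    have "A * P = A * P' + (A * r) * b" by (simp add: P algebra_simps)
    then show "A * P \<in> J" using M(3)[OF P(2)] unfolding J_def by blast
    fix Q assume "Q \<in> J"
    then obtain Q' r' where Q: "Q = Q' + r' * b" "Q' \<in> M" unfolding J_def by blast
    have "P + Q = (P' + Q') + (r + r') * b" by (simp add: P Q algebra_simps)
    then show "P + Q \<in> J" using M(2)[OF P(2) Q(2)] unfolding J_def by blast
  qed
  from this MJ bJ show "is_ideal {P + r * b | P r. P \<in> M}" "M \<subseteq> {P + r * b | P r. P \<in> M}"
    "b \<in> {P + r * b | P r. P \<in> M}"
    unfolding J_def .
qed

definition preimage :: "'a::field poly poly \<Rightarrow> 'a poly poly set set \<Rightarrow> 'a poly poly set" where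
  "preimage E m = {P. residue_class E P \<in> m}"

text \<open>
  Preimages of the maximal ideals of \<open>K[x,y]/(E)\<close>, with maximality in the form in which it is
  applied: everything outside \<open>M\<close> is invertible modulo \<open>M\<close>.
\<close>
definition maximal_over :: "'a::field poly poly \<Rightarrow> 'a poly poly set \<Rightarrow> bool" where
  "maximal_over E M \<longleftrightarrow> is_ideal M \<and> E \<in> M \<and> 1 \<notin> M \<and> (\<forall>b. b \<notin> M \<longrightarrow> (\<exists>r. 1 - r * b \<in> M))"

lemma is_ideal_preimage:
  assumes "ideal m (coordinate_ring E)"
  shows "is_ideal (preimage E m)" "E \<in> preimage E m"
proof -
  interpret ideal m "coordinate_ring E" by fact
  show "is_ideal (preimage E m)"
    by (auto simp: is_ideal_def preimage_def residue_class_hom I_l_closed)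
  have "residue_class E E = \<zero>\<^bsub>coordinate_ring E\<^esub>" by (simp add: residue_class_eq_0_iff)
  then show "E \<in> preimage E m" by (simp add: preimage_def)
qed

lemma ideal_image_residue_class:
  assumes "is_ideal M"
  shows "ideal (residue_class E ` M) (coordinate_ring E)"
proof -
  interpret cring "coordinate_ring E" by (rule cring_coordinate_ring)
  note M = is_idealD[OF assms]
  have minus: "\<ominus>\<^bsub>coordinate_ring E\<^esub> residue_class E P = residue_class E (- P)" for P
  proof (rule minus_equality)
    show "residue_class E (- P) \<oplus>\<^bsub>coordinate_ring E\<^esub> residue_class E P = \<zero>\<^bsub>coordinate_ring E\<^esub>"
      by (simp flip: residue_class_hom)
  qed simp_all
  show ?thesis
  proof (rule idealI)
    show "ring (coordinate_ring E)" by (rule ring_axioms)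
    show "subgroup (residue_class E ` M) (add_monoid (coordinate_ring E))"
    proof (rule add.subgroupI)
      show "residue_class E ` M \<subseteq> carrier (coordinate_ring E)" by auto
      show "residue_class E ` M \<noteq> {}" using M(1) by blast
      show "\<ominus>\<^bsub>coordinate_ring E\<^esub> a \<in> residue_class E ` M" if "a \<in> residue_class E ` M" for a
        using that M(5) by (auto simp: minus)
      show "a \<oplus>\<^bsub>coordinate_ring E\<^esub> b \<in> residue_class E ` M"
        if "a \<in> residue_class E ` M" "b \<in> residue_class E ` M" for a b
        using that M(2) by (auto simp flip: residue_class_hom)
    qed
  next
    fix a x assume "a \<in> residue_class E ` M" "x \<in> carrier (coordinate_ring E)"
    then show "x \<otimes>\<^bsub>coordinate_ring E\<^esub> a \<in> residue_class E ` M" "a \<otimes>\<^bsub>coordinate_ring E\<^esub> x \<in> residue_class E ` M"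
      using M(3,4) by (auto simp: carrier_coordinate_ring simp flip: residue_class_hom)
  qed
qed

lemma preimage_image:
  assumes "is_ideal M" "E \<in> M"
  shows "preimage E (residue_class E ` M) = M"
proof -
  have "P \<in> M" if "E dvd P - Q" "Q \<in> M" for P Q
  proof -
    from that(1) obtain k where "P - Q = E * k" by (auto simp: dvd_def)
    then have "P = E * k + Q" by (simp add: algebra_simps)
    then show ?thesis using is_idealD[OF assms(1)] assms(2) that(2) by simp
  qed
  then show ?thesis by (auto simp: preimage_def residue_class_eq_iff)
qed

lemma image_preimage:
  assumes "m \<subseteq> carrier (coordinate_ring E)"
  shows "residue_class E ` preimage E m = m"
  using assms by (auto simp: preimage_def carrier_coordinate_ring)

lemma maximal_over_preimage:
  assumes "maximalideal m (coordinate_ring E)"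
  shows "maximal_over E (preimage E m)"
proof -
  interpret maximalideal m "coordinate_ring E" by fact
  interpret R: cring "coordinate_ring E" by (rule cring_coordinate_ring)
  define M where "M = preimage E m"
  note MI = is_ideal_preimage[OF is_ideal, folded M_def]
  note M = is_idealD[OF MI(1)]
  have m: "residue_class E ` M = m"
    unfolding M_def by (rule image_preimage) (rule a_subset)
  have one: "1 \<notin> M"
  proof
    assume "1 \<in> M"
    then have "\<one>\<^bsub>coordinate_ring E\<^esub> \<in> m" by (simp add: M_def preimage_def residue_class_hom)
    then show False using I_notcarr one_imp_carrier by blast
  qed
  have inv: "\<exists>r. 1 - r * b \<in> M" if b: "b \<notin> M" for b
  proof -
    define J where "J = {P + r * b | P r. P \<in> M}"
    note J = is_ideal_adjoin(1)[OF MI(1), of b, folded J_def]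
      and MJ = is_ideal_adjoin(2)[OF MI(1), of b, folded J_def]
      and bJ = is_ideal_adjoin(3)[OF MI(1), of b, folded J_def]
    have "residue_class E ` J = m \<or> residue_class E ` J = carrier (coordinate_ring E)"
    proof (rule I_maximal[OF ideal_image_residue_class[OF J]])
      show "m \<subseteq> residue_class E ` J" using MJ m by blast
      show "residue_class E ` J \<subseteq> carrier (coordinate_ring E)" by auto
    qed
    moreover have "residue_class E ` J \<noteq> m"
      using bJ b by (auto simp: M_def preimage_def)
    ultimately have "residue_class E ` J = range (residue_class E)" by (simp add: carrier_coordinate_ring)
    then have "1 \<in> preimage E (residue_class E ` J)" by (simp add: preimage_def)
    then have "1 \<in> J" using preimage_image[OF J] MI(2) MJ by blast
    then obtain P r where "1 = P + r * b" "P \<in> M" unfolding J_def by blast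
    then have "1 - r * b \<in> M" by (metis add_diff_cancel_right')
    then show ?thesis by blast
  qed
  show ?thesis using MI one inv by (simp add: maximal_over_def M_def)
qed

lemma maximalideal_image:
  assumes "maximal_over E M"
  shows "maximalideal (residue_class E ` M) (coordinate_ring E)"
proof (rule maximalidealI)
  have M: "is_ideal M" "E \<in> M" "1 \<notin> M" using assms by (auto simp: maximal_over_def)
  show "ideal (residue_class E ` M) (coordinate_ring E)" by (rule ideal_image_residue_class[OF M(1)])
  show "carrier (coordinate_ring E) \<noteq> residue_class E ` M"
    using preimage_image[OF M(1,2)] M(3) by (metis UNIV_I carrier_coordinate_ring mem_Collect_eq preimage_def rangeI)
  fix J assume J: "ideal J (coordinate_ring E)" "residue_class E ` M \<subseteq> J" "J \<subseteq> carrier (coordinate_ring E)"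
  note JI = is_ideal_preimage[OF J(1)]
  have MJ: "M \<subseteq> preimage E J" using J(2) by (auto simp: preimage_def)
  show "J = residue_class E ` M \<or> J = carrier (coordinate_ring E)"
  proof (cases "preimage E J \<subseteq> M")
    case True
    with MJ have "preimage E J = M" by blast
    then show ?thesis using image_preimage[OF J(3)] by simp
  next
    case False
    then obtain b where b: "b \<in> preimage E J" "b \<notin> M" by blast
    then obtain r where "1 - r * b \<in> M" using assms by (auto simp: maximal_over_def)
    then have "(1 - r * b) + r * b \<in> preimage E J" using MJ b(1) is_idealD[OF JI(1)] by blast
    then have "1 * P \<in> preimage E J" for P using is_idealD(4)[OF JI(1), of 1 P] by simp
    then have "residue_class E P \<in> J" for P by (simp add: preimage_def)
    then show ?thesis using J(3) by (auto simp: carrier_coordinate_ring)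
  qed
qed

lemma maximal_over_mult:
  assumes "maximal_over E M" "a \<notin> M" "b \<notin> M"
  shows "a * b \<notin> M"
proof
  assume ab: "a * b \<in> M"
  have M: "is_ideal M" using assms by (auto simp: maximal_over_def)
  obtain r where r: "1 - r * a \<in> M" using assms by (auto simp: maximal_over_def)
  have "(1 - r * a) * b + r * (a * b) \<in> M" using is_idealD[OF M] r ab by blast
  then show False using assms(3) by (simp add: algebra_simps)
qed

lemma maximal_over_power:
  assumes "maximal_over E M" "a \<notin> M"
  shows "a ^ n \<notin> M"
  using assms by (induction n) (auto simp: maximal_over_mult maximal_over_def)

text \<open>
  Divisibility of \<open>P\<close> by \<open>Q\<close> in the localization of \<open>K[x,y]/(E)\<close> at \<open>M\<close>, with the denominator cleared.
\<close>
definition locally_divisible :: "'a::field poly poly \<Rightarrow> 'a poly poly set \<Rightarrow> 'a poly poly \<Rightarrow> 'a poly poly \<Rightarrow> bool" where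
  "locally_divisible E M Q P \<longleftrightarrow> (\<exists>b c. b \<notin> M \<and> E dvd (b * P - Q * c))"

text \<open>
  If \<open>u\<close> generates \<open>m\<close> locally, then \<open>m\<^sup>n\<close> is the contraction of the ideal generated by \<open>u\<^sup>n\<close>
  in the local ring. One inclusion multiplies local equations; for the other, a denominator
  \<open>b \<notin> m\<close> is invertible modulo \<open>m\<close>, hence also modulo \<open>m\<^sup>n\<close>. This turns the orders of
  vanishing, at infinity as well as at affine points, into statements on divisibility.
\<close>
lemma ideal_pow_iff:
  assumes m: "ideal m (coordinate_ring E)" and max: "maximal_over E (preimage E m)"
    and u: "u \<in> preimage E m" and loc: "\<And>a. a \<in> preimage E m \<Longrightarrow> locally_divisible E (preimage E m) u a"
  shows "residue_class E P \<in> m [^]\<^bsub>ideals_set (coordinate_ring E)\<^esub> n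
    \<longleftrightarrow> locally_divisible E (preimage E m) (u ^ n) P"
proof -
  define R where "R = coordinate_ring E"
  define S where "S = ideals_set R"
  define M where "M = preimage E m"
  interpret R: cring R unfolding R_def by (rule cring_coordinate_ring)
  interpret S: semiring S unfolding S_def by (rule R.ideals_set_is_semiring)
  have mS: "m \<in> carrier S" using m by (simp add: S_def ideals_set_def R_def)
  have pow_ideal: "ideal (m [^]\<^bsub>S\<^esub> n) R" for n :: nat
    using S.nat_pow_closed[OF mS, of n] by (simp add: S_def ideals_set_def)
  have pow0: "m [^]\<^bsub>S\<^esub> (0::nat) = carrier R" by (simp add: S_def ideals_set_def)
  have powSuc: "m [^]\<^bsub>S\<^esub> Suc n = ideal_prod R (m [^]\<^bsub>S\<^esub> n) m" for n
    by (simp add: S_def ideals_set_def)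
  note mult = maximal_over_mult[OF max, folded M_def]
  have loc_prod: "locally_divisible E M (Q * Q') (P * P')"
    if "locally_divisible E M Q P" "locally_divisible E M Q' P'" for Q Q' P P'
  proof -
    from that(1) obtain b c where bc: "b \<notin> M" "E dvd b * P - Q * c" by (auto simp: locally_divisible_def)
    from that(2) obtain b' c' where bc': "b' \<notin> M" "E dvd b' * P' - Q' * c'" by (auto simp: locally_divisible_def)
    have "(b * b') * (P * P') - (Q * Q') * (c * c') = (b * P - Q * c) * (b' * P') + (Q * c) * (b' * P' - Q' * c')"
      by (simp add: algebra_simps)
    then have "E dvd (b * b') * (P * P') - (Q * Q') * (c * c')"
      using bc(2) bc'(2) by simp
    then show ?thesis using mult[OF bc(1) bc'(1)] by (auto simp: locally_divisible_def)
  qed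
  have loc_sum: "locally_divisible E M Q (P + P')"
    if "locally_divisible E M Q P" "locally_divisible E M Q P'" for Q P P'
  proof -
    from that(1) obtain b c where bc: "b \<notin> M" "E dvd b * P - Q * c" by (auto simp: locally_divisible_def)
    from that(2) obtain b' c' where bc': "b' \<notin> M" "E dvd b' * P' - Q * c'" by (auto simp: locally_divisible_def)
    have "(b * b') * (P + P') - Q * (b' * c + b * c') = (b * P - Q * c) * b' + (b' * P' - Q * c') * b"
      by (simp add: algebra_simps)
    then have "E dvd (b * b') * (P + P') - Q * (b' * c + b * c')"
      using bc(2) bc'(2) by simp
    then show ?thesis using mult[OF bc(1) bc'(1)] by (auto simp: locally_divisible_def)
  qed
  have loc_cong: "locally_divisible E M Q P'"
    if "locally_divisible E M Q P" "residue_class E P = residue_class E P'" for Q P P'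
  proof -
    from that(1) obtain b c where bc: "b \<notin> M" "E dvd b * P - Q * c" by (auto simp: locally_divisible_def)
    have "E dvd P - P'" using that(2) by (simp add: residue_class_eq_iff)
    then have "E dvd (b * P - Q * c) - b * (P - P')" using bc(2) dvd_diff dvd_mult by blast
    moreover have "(b * P - Q * c) - b * (P - P') = b * P' - Q * c" by (simp add: algebra_simps)
    ultimately have "E dvd b * P' - Q * c" by metis
    then show ?thesis using bc(1) by (auto simp: locally_divisible_def)
  qed
  have only_if: "locally_divisible E M (u ^ n) P" if "residue_class E P \<in> m [^]\<^bsub>S\<^esub> n" for n P
    using that
  proof (induction n arbitrary: P)
    case 0
    have "1 \<notin> M" using max by (simp add: maximal_over_def M_def)
    then show ?case unfolding locally_divisible_def by (intro exI[of _ 1] exI[of _ P]) simp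
  next
    case (Suc n)
    have "\<forall>P. residue_class E P = f \<longrightarrow> locally_divisible E M (u ^ Suc n) P"
      if "f \<in> ideal_prod R (m [^]\<^bsub>S\<^esub> n) m" for f
      using that
    proof (induction f rule: ideal_prod.induct)
      case (prod i j)
      have "i \<in> carrier R" "j \<in> carrier R"
        using prod ideal.Icarr[OF pow_ideal] ideal.Icarr[OF m] by (auto simp: R_def)
      then obtain A B where AB: "i = residue_class E A" "j = residue_class E B"
        by (auto simp: R_def carrier_coordinate_ring)
      have "locally_divisible E M (u ^ n * u) (A * B)"
        using prod Suc.IH loc loc_prod by (simp add: AB M_def preimage_def)
      moreover have "i \<otimes>\<^bsub>R\<^esub> j = residue_class E (A * B)" by (simp add: AB R_def residue_class_hom)
      ultimately show ?case using loc_cong by (simp add: mult.commute)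
    next
      case (sum f g)
      have "f \<in> carrier R" "g \<in> carrier R"
        using sum R.ideal_prod_in_carrier[OF pow_ideal m[folded R_def]] by blast+
      then obtain A B where AB: "f = residue_class E A" "g = residue_class E B"
        by (auto simp: R_def carrier_coordinate_ring)
      have "locally_divisible E M (u ^ Suc n) (A + B)" using loc_sum AB sum by blast
      moreover have "f \<oplus>\<^bsub>R\<^esub> g = residue_class E (A + B)" by (simp add: AB R_def residue_class_hom)
      ultimately show ?case using loc_cong by simp
    qed
    then show ?case using Suc.prems powSuc by blast
  qed
  have pow_pre: "is_ideal (preimage E (m [^]\<^bsub>S\<^esub> n))" "E \<in> preimage E (m [^]\<^bsub>S\<^esub> n)" for n :: nat
    using is_ideal_preimage[OF pow_ideal[of n, unfolded R_def]] by simp_all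
  have pow_mult: "A * B \<in> preimage E (m [^]\<^bsub>S\<^esub> Suc n)" if "A \<in> preimage E (m [^]\<^bsub>S\<^esub> n)" "B \<in> M" for A B n
    using that powSuc ideal_prod.prod[of "residue_class E A" _ "residue_class E B" m R]
    by (simp add: preimage_def M_def R_def residue_class_hom)
  have u_pow: "u ^ n \<in> preimage E (m [^]\<^bsub>S\<^esub> n)" for n
  proof (induction n)
    case 0
    show ?case unfolding pow0 by (simp add: R_def preimage_def)
  next
    case (Suc n)
    then show ?case using pow_mult[OF Suc] u by (simp add: M_def mult.commute)
  qed
  have "if": "residue_class E P \<in> m [^]\<^bsub>S\<^esub> n" if "locally_divisible E M (u ^ n) P" for n P
  proof -
    from that obtain b c where bc: "b \<notin> M" "E dvd b * P - u ^ n * c" by (auto simp: locally_divisible_def)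
    note I = is_idealD[OF pow_pre(1)[of n]]
    have bP: "b * P \<in> preimage E (m [^]\<^bsub>S\<^esub> n)"
    proof -
      obtain k where "b * P - u ^ n * c = E * k" using bc(2) by (auto simp: dvd_def)
      then have "b * P = E * k + u ^ n * c" by (simp add: algebra_simps)
      then show ?thesis using I(2,4) pow_pre(2) u_pow by simp
    qed
    obtain r where r: "1 - r * b \<in> M" using bc(1) max by (auto simp: maximal_over_def M_def)
    \<comment> \<open>Raising \<open>1 - r b \<in> m\<close> to the \<open>n\<close>-th power inverts \<open>b\<close> modulo \<open>m\<^sup>n\<close>.\<close>
    have "\<exists>s. 1 - s * b \<in> preimage E (m [^]\<^bsub>S\<^esub> n)" for n :: nat
    proof (induction n)
      case 0
      show ?case unfolding pow0 by (simp add: R_def preimage_def)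
    next
      case (Suc n)
      then obtain s where "1 - s * b \<in> preimage E (m [^]\<^bsub>S\<^esub> n)" by blast
      from pow_mult[OF this r] have "1 - (s + r - s * b * r) * b \<in> preimage E (m [^]\<^bsub>S\<^esub> Suc n)"
        by (simp add: algebra_simps)
      then show ?case by blast
    qed
    then obtain s where "1 - s * b \<in> preimage E (m [^]\<^bsub>S\<^esub> n)" by blast
    then have "(1 - s * b) * P + s * (b * P) \<in> preimage E (m [^]\<^bsub>S\<^esub> n)"
      using I bP by blast
    then show ?thesis by (simp add: algebra_simps preimage_def)
  qed
  show ?thesis using only_if "if" unfolding R_def S_def M_def by blast
qed

lemma vanishing_order_eqI:
  assumes "\<And>n. f \<in> m [^]\<^bsub>ideals_set S\<^esub> n \<longleftrightarrow> n \<le> k"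
  shows "vanishing_order S m f = k"
  unfolding vanishing_order_def assms by (rule Greatest_equality) auto

section \<open>Evaluation of bivariate polynomials\<close>

definition is_ring_hom :: "('b::comm_ring_1 \<Rightarrow> 'r::comm_ring_1) \<Rightarrow> bool" where
  "is_ring_hom h \<longleftrightarrow> h 1 = 1 \<and> (\<forall>a b. h (a + b) = h a + h b) \<and> (\<forall>a b. h (a * b) = h a * h b)"

lemma is_ring_homD:
  assumes "is_ring_hom h"
  shows "h 0 = 0" "h 1 = 1" "h (a + b) = h a + h b" "h (a * b) = h a * h b" "h (- a) = - h a"
    "h (a - b) = h a - h b" "h (a ^ n) = h a ^ n" "h (sum f A) = (\<Sum>x\<in>A. h (f x))"
proof -
  show *: "h 1 = 1" "h (a + b) = h a + h b" "h (a * b) = h a * h b" for a b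
    using assms by (auto simp: is_ring_hom_def)
  show 0: "h 0 = 0" using *(2)[of 0 0] by simp
  show minus: "h (- a) = - h a" for a
    using *(2)[of a "- a"] 0 by (simp add: eq_neg_iff_add_eq_0 add.commute)
  show "h (a - b) = h a - h b" using *(2)[of a "- b"] minus by simp
  show "h (a ^ n) = h a ^ n" by (induction n) (simp_all add: *)
  show "h (sum f A) = (\<Sum>x\<in>A. h (f x))" by (induction A rule: infinite_finite_induct) (simp_all add: 0 *)
qed

lemma is_ring_hom_eval_poly:
  assumes "is_ring_hom h"
  shows "is_ring_hom (\<lambda>P. poly (map_poly h P) v)"
proof -
  note h = is_ring_homD[OF assms]
  let ?ev = "\<lambda>P. poly (map_poly h P) v"
  have pCons: "?ev (pCons a P) = h a + v * ?ev P" for a P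
    by (simp add: map_poly_pCons h)
  have add: "?ev (P + Q) = ?ev P + ?ev Q" for P Q
  proof (induction P Q rule: poly_induct2)
    case 0 then show ?case by simp
  next
    case (pCons a P b Q)
    then show ?case by (simp add: map_poly_pCons h algebra_simps)
  qed
  have smult: "?ev (smult a Q) = h a * ?ev Q" for a Q
    by (induction Q) (simp_all add: map_poly_pCons h algebra_simps)
  have mult: "?ev (P * Q) = ?ev P * ?ev Q" for P Q
    by (induction P) (simp_all add: add smult pCons h mult_pCons_left algebra_simps)
  have "?ev 1 = 1" using pCons[of 1 0] by (simp add: h flip: one_pCons)
  with add mult show ?thesis by (simp add: is_ring_hom_def)
qed

text \<open>
  One evaluation map for all purposes: it takes values in power series and Laurent series at
  infinity, and in the algebraic closure, where it agrees with \<^const>\<open>eval2\<close>.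
\<close>
definition eval_hom :: "('a::field \<Rightarrow> 'r::comm_ring_1) \<Rightarrow> 'r \<Rightarrow> 'r \<Rightarrow> 'a poly poly \<Rightarrow> 'r" where
  "eval_hom c u v P = poly (map_poly (\<lambda>a. poly (map_poly c a) u) P) v"

lemma is_ring_hom_eval_hom: "is_ring_hom c \<Longrightarrow> is_ring_hom (eval_hom c u v)"
  unfolding eval_hom_def[abs_def] by (intro is_ring_hom_eval_poly)

lemma eval_hom_generators:
  assumes "is_ring_hom c"
  shows "eval_hom c u v (Cst a) = c a" "eval_hom c u v vx = u" "eval_hom c u v vy = v"
  using is_ring_homD[OF assms]
  by (simp_all add: eval_hom_def Cst_def vx_def vy_def map_poly_pCons)

lemma Cst_simps [simp]: "Cst 0 = 0" "Cst 1 = 1"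
  by (simp_all add: Cst_def flip: one_pCons)

lemma is_ring_hom_Cst: "is_ring_hom Cst"
  by (simp add: is_ring_hom_def Cst_def flip: one_pCons)

lemma pCons_eq: "pCons a P = [:a:] + vy * P" "[:pCons c q:] = Cst c + vx * [:q:]"
  by (simp_all add: vy_def vx_def Cst_def)

lemma bivariate_induct [case_names Cst add vx vy]:
  assumes "\<And>c. P (Cst c)" "\<And>p q. P p \<Longrightarrow> P q \<Longrightarrow> P (p + q)"
    and "\<And>p. P p \<Longrightarrow> P (vx * p)" "\<And>p. P p \<Longrightarrow> P (vy * p)"
  shows "P p"
proof (induction p)
  case 0
  then show ?case using assms(1)[of 0] by simp
next
  case (pCons a p)
  have const: "P [:q:]" for q
  proof (induction q)
    case 0
    then show ?case using assms(1)[of 0] by simp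
  next
    case (pCons c q)
    then show ?case unfolding pCons_eq(2) by (intro assms)
  qed
  have "P ([:a:] + vy * p)" by (intro assms const pCons)
  then show ?case by (simp flip: pCons_eq(1))
qed

lemma bivariate_expansion:
  assumes "degree P \<le> N" "\<And>j. degree (coeff P j) \<le> N"
  shows "P = (\<Sum>j\<le>N. \<Sum>i\<le>N. Cst (coeff2 P i j) * (vx ^ i * vy ^ j))"
proof -
  have deg: "coeff2 P i j = 0" if "\<not> (i \<le> N \<and> j \<le> N)" for i j
    using that assms(1) assms(2)[of j] coeff_eq_0[of P j] coeff_eq_0[of "coeff P j" i]
    by (cases "j \<le> N") (simp_all add: coeff2_def)
  have "coeff2 (\<Sum>j\<le>N. \<Sum>i\<le>N. Cst (coeff2 P i j) * (vx ^ i * vy ^ j)) k l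
    = (\<Sum>j\<le>N. \<Sum>i\<le>N. if i = k \<and> j = l then coeff2 P i j else 0)" for k l
  proof -
    have sum: "coeff2 (sum f A) k l = (\<Sum>x\<in>A. coeff2 (f x) k l)" for f and A :: "nat set"
      by (simp add: coeff2_def coeff_sum)
    show ?thesis unfolding sum coeff2_Cst_mult coeff2_monomial by (intro sum.cong) auto
  qed
  also have "\<dots> k l = (if k \<le> N \<and> l \<le> N then coeff2 P k l else 0)" for k l
  proof -
    have "(\<Sum>i\<le>N. if i = k \<and> j = l then coeff2 P i j else 0)
      = (if j = l then if k \<le> N then coeff2 P k l else 0 else 0)" for j
      by (cases "j = l") (simp_all add: sum.delta)
    then show ?thesis by (simp add: sum.delta)
  qed
  also have "\<dots> k l = coeff2 P k l" for k l using deg[of k l] by auto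
  finally show ?thesis by (auto simp: coeff2_def intro!: poly_eqI)
qed

lemma degree_bound: "\<exists>N. degree P \<le> N \<and> (\<forall>j. degree (coeff P j) \<le> N)"
proof -
  let ?N = "Max (insert (degree P) ((\<lambda>j. degree (coeff P j)) ` {..degree P}))"
  have "degree (coeff P j) \<le> ?N" for j
  proof (cases "j \<le> degree P")
    case False
    then show ?thesis by (simp add: coeff_eq_0)
  next
    case True
    then have "degree (coeff P j) \<in> insert (degree P) ((\<lambda>j. degree (coeff P j)) ` {..degree P})" by blast
    then show ?thesis by (intro Max_ge) auto
  qed
  then show ?thesis by (intro exI[of _ ?N] conjI) auto
qed

lemma chart_at_infinity_box:
  assumes "degree P \<le> N" "\<And>j. degree (coeff P j) \<le> N"
  shows "chart_at_infinity n P = (\<Sum>j\<le>N. \<Sum>i\<le>N. Cst (coeff2 P i j) * (vx ^ i * vy ^ (n - i - j)))"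
proof -
  have "(\<Sum>i\<le>degree (coeff P j). Cst (coeff2 P i j) * (vx ^ i * vy ^ (n - i - j)))
      = (\<Sum>i\<le>N. Cst (coeff2 P i j) * (vx ^ i * vy ^ (n - i - j)))" for j
    using assms(2)[of j] by (intro sum.mono_neutral_left) (auto simp: coeff2_def coeff_eq_0)
  then have "chart_at_infinity n P = (\<Sum>j\<le>degree P. \<Sum>i\<le>N. Cst (coeff2 P i j) * (vx ^ i * vy ^ (n - i - j)))"
    by (simp add: chart_at_infinity_def mult.assoc)
  also have "\<dots> = (\<Sum>j\<le>N. \<Sum>i\<le>N. Cst (coeff2 P i j) * (vx ^ i * vy ^ (n - i - j)))"
    using assms(1) by (intro sum.mono_neutral_left) (auto simp: coeff2_def coeff_eq_0)
  finally show ?thesis .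
qed

lemma total_degree_ge:
  assumes "coeff2 P i j \<noteq> 0"
  shows "i + j \<le> total_degree P"
proof -
  obtain N where N: "degree P \<le> N" "\<And>j. degree (coeff P j) \<le> N" using degree_bound by blast
  have "i \<le> N \<and> j \<le> N" if c: "coeff2 P i j \<noteq> 0" for i j
  proof
    show "i \<le> N" using c le_degree[of "coeff P j" i] N(2)[of j] by (simp add: coeff2_def)
    have "coeff P j \<noteq> 0" using c by (auto simp: coeff2_def)
    then show "j \<le> N" using le_degree[of P j] N(1) by simp
  qed
  then have "{i + j | i j. coeff2 P i j \<noteq> 0} \<subseteq> {..N + N}" using add_mono by fastforce
  then have "finite {i + j | i j. coeff2 P i j \<noteq> 0}" by (rule finite_subset) simp
  then show ?thesis unfolding total_degree_def using assms by (intro Max_ge) auto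
qed

text \<open>
  The chart at infinity is \<open>w\<^sup>n P(u/w, 1/w)\<close>. So expanding \<open>w\<close> in powers of \<open>u\<close> gives the chart a
  power series and \<open>P\<close> itself a Laurent series, which differ by a power of \<open>w\<close>.
\<close>
lemma eval_hom_chart_at_infinity:
  fixes u w :: "'f::field"
  assumes "is_ring_hom c" "w \<noteq> 0" "total_degree P \<le> n"
  shows "eval_hom c u w (chart_at_infinity n P) = w ^ n * eval_hom c (u / w) (1 / w) P"
proof -
  obtain N where N: "degree P \<le> N" "\<And>j. degree (coeff P j) \<le> N" using degree_bound by blast
  note h = is_ring_homD[OF is_ring_hom_eval_hom[OF assms(1)]] eval_hom_generators[OF assms(1)]
  have "eval_hom c (u / w) (1 / w) P
     = (\<Sum>j\<le>N. \<Sum>i\<le>N. c (coeff2 P i j) * ((u / w) ^ i * (1 / w) ^ j))"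
    by (subst bivariate_expansion[OF N]) (simp only: h)
  then have "w ^ n * eval_hom c (u / w) (1 / w) P
     = (\<Sum>j\<le>N. \<Sum>i\<le>N. w ^ n * (c (coeff2 P i j) * ((u / w) ^ i * (1 / w) ^ j)))"
    by (simp only: sum_distrib_left)
  also have "\<dots> = (\<Sum>j\<le>N. \<Sum>i\<le>N. c (coeff2 P i j) * (u ^ i * w ^ (n - i - j)))"
  proof (intro sum.cong refl)
    fix i j
    show "w ^ n * (c (coeff2 P i j) * ((u / w) ^ i * (1 / w) ^ j)) = c (coeff2 P i j) * (u ^ i * w ^ (n - i - j))"
    proof (cases "coeff2 P i j = 0")
      case False
      then have "n = (n - i - j) + i + j" using total_degree_ge[of P i j] assms(3) by linarith
      then have "w ^ n = w ^ (n - i - j) * w ^ i * w ^ j" by (metis power_add)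
      then show ?thesis using assms(2) by (simp add: power_divide)
    qed (simp add: is_ring_homD[OF assms(1)])
  qed
  also have "\<dots> = eval_hom c u w (chart_at_infinity n P)"
    by (subst chart_at_infinity_box[OF N]) (simp only: h)
  finally show ?thesis by simp
qed

lemma curve_poly_expanded:
  "curve_poly C = Cst 1 * (vx ^ 0 * vy ^ 3) + Cst (p2 C) * (vx ^ 2 * vy ^ 1) + Cst (p1 C) * (vx ^ 1 * vy ^ 1)
    + Cst (p0 C) * (vx ^ 0 * vy ^ 1) + Cst (q2 C) * (vx ^ 2 * vy ^ 0) + Cst (q1 C) * (vx ^ 1 * vy ^ 0)
    + Cst (q0 C) * (vx ^ 0 * vy ^ 0) - Cst 1 * (vx ^ 4 * vy ^ 0)"
  by (simp add: curve_poly_def algebra_simps)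

lemma coeff2_curve_poly:
  "coeff2 (curve_poly C) i j = (if i = 0 \<and> j = 3 then 1 else if i = 2 \<and> j = 1 then p2 C
    else if i = 1 \<and> j = 1 then p1 C else if i = 0 \<and> j = 1 then p0 C else if i = 2 \<and> j = 0 then q2 C
    else if i = 1 \<and> j = 0 then q1 C else if i = 0 \<and> j = 0 then q0 C else if i = 4 \<and> j = 0 then -1 else 0)"
  unfolding curve_poly_expanded coeff2_add coeff2_diff coeff2_Cst_mult coeff2_monomial by auto

lemma curve_poly_at_infinity_eq:
  "curve_poly_at_infinity C = vy * (1 + Cst (p2 C) * vx ^ 2 + Cst (p1 C) * vx * vy + Cst (p0 C) * vy ^ 2
     + Cst (q2 C) * vx ^ 2 * vy + Cst (q1 C) * vx * vy ^ 2 + Cst (q0 C) * vy ^ 3) - vx ^ 4"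
proof -
  note c = coeff2_curve_poly
  have N1: "degree (curve_poly C) \<le> 4"
  proof (intro degree_le allI impI poly_eqI)
    fix j i :: nat assume "4 < j"
    then show "coeff (coeff (curve_poly C) j) i = coeff 0 i" using c[of C i j] by (simp add: coeff2_def)
  qed
  have N2: "degree (coeff (curve_poly C) j) \<le> 4" for j
  proof (intro degree_le allI impI)
    fix i :: nat assume "4 < i"
    then show "coeff (coeff (curve_poly C) j) i = 0" using c[of C i j] by (simp add: coeff2_def)
  qed
  have box: "{..4::nat} = {0, 1, 2, 3, 4}" by auto
  show ?thesis
    unfolding curve_poly_at_infinity_def chart_at_infinity_box[OF N1 N2] box
    by (simp add: c is_ring_homD[OF is_ring_hom_Cst])
      (simp add: algebra_simps power2_eq_square power3_eq_cube power4_eq_xxxx)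
qed

section \<open>Expansion at the point at infinity\<close>

lemma fps_X_power_dvd_iff: "fps_X ^ n dvd h \<longleftrightarrow> (\<forall>i<n. fps_nth h i = (0::'a::field))"
proof
  assume "fps_X ^ n dvd h"
  then show "\<forall>i<n. fps_nth h i = 0" by (auto simp: dvd_def fps_X_power_mult_nth)
next
  assume "\<forall>i<n. fps_nth h i = 0"
  then have "h = fps_X ^ n * fps_shift n h"
    by (auto simp: fps_eq_iff fps_X_power_mult_nth)
  then show "fps_X ^ n dvd h" by (metis dvd_triv_left)
qed

text \<open>
  A contraction for the \<open>X\<close>-adic metric: the \<open>i\<close>-th coefficient of the iterates is constant from step \<open>i + 1\<close> on.
\<close>
lemma fps_fixed_point:
  fixes \<Phi> :: "'a::field fps \<Rightarrow> 'a fps"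
  assumes closed: "\<And>f. fps_X dvd f \<Longrightarrow> fps_X dvd \<Phi> f"
    and contract: "\<And>f g n. fps_X dvd f \<Longrightarrow> fps_X dvd g \<Longrightarrow> fps_X ^ n dvd f - g \<Longrightarrow> fps_X ^ Suc n dvd \<Phi> f - \<Phi> g"
  shows "\<exists>f. fps_X dvd f \<and> \<Phi> f = f"
proof -
  define w where "w n = (\<Phi> ^^ n) 0" for n
  have w_Suc: "w (Suc n) = \<Phi> (w n)" for n by (simp add: w_def)
  have w_X: "fps_X dvd w n" for n
    by (induction n) (simp_all add: w_Suc closed, simp add: w_def)
  have w_step: "fps_X ^ n dvd w (Suc n) - w n" for n
  proof (induction n)
    case (Suc n)
    show ?case using contract[OF w_X w_X Suc] by (simp add: w_Suc)
  qed simp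
  have w_add: "fps_X ^ n dvd w (n + k) - w n" for n k
  proof (induction k)
    case (Suc k)
    have "fps_X ^ n dvd w (Suc (n + k)) - w (n + k)"
      using w_step[of "n + k"] by (rule dvd_trans[rotated]) (simp add: power_add)
    from dvd_add[OF this Suc] show ?case by simp
  qed simp
  define f where "f = Abs_fps (\<lambda>i. fps_nth (w (Suc i)) i)"
  have f_w: "fps_X ^ n dvd f - w n" for n
    unfolding fps_X_power_dvd_iff
  proof (intro allI impI)
    fix i assume "i < n"
    then have "n = Suc i + (n - Suc i)" by simp
    then have "fps_X ^ Suc i dvd w n - w (Suc i)" using w_add[of "Suc i" "n - Suc i"] by simp
    then have "fps_nth (w n - w (Suc i)) i = 0" unfolding fps_X_power_dvd_iff by blast
    then show "fps_nth (f - w n) i = 0" by (simp add: f_def)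
  qed
  have f_X: "fps_X dvd f"
    using dvd_add[OF _ w_X[of 1], of "f - w 1"] f_w[of 1] by simp
  have "fps_X ^ Suc n dvd \<Phi> f - f" for n
    using dvd_diff[OF contract[OF f_X w_X f_w[of n]] f_w[of "Suc n"]] by (simp add: w_Suc)
  then have "fps_nth (\<Phi> f - f) n = 0" for n unfolding fps_X_power_dvd_iff by blast
  then have "\<Phi> f = f" by (simp add: fps_eq_iff)
  with f_X show ?thesis by blast
qed

text \<open>
  In the chart at infinity the curve is \<open>w e = u\<^sup>4\<close>, and \<open>e\<close> has constant term 1. So \<open>e\<close> is a unit
  near the origin, \<open>u\<close> is a local parameter, and \<open>w\<close> vanishes there to order 4.
\<close>
definition infinity_unit :: "'a::field c34 \<Rightarrow> 'a poly poly" where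
  "infinity_unit C = 1 + Cst (p2 C) * vx ^ 2 + Cst (p1 C) * vx * vy + Cst (p0 C) * vy ^ 2
     + Cst (q2 C) * vx ^ 2 * vy + Cst (q1 C) * vx * vy ^ 2 + Cst (q0 C) * vy ^ 3"

lemma is_ring_hom_fps_const: "is_ring_hom (fps_const :: 'a::field \<Rightarrow> 'a fps)"
  and is_ring_hom_fls_const: "is_ring_hom (fls_const :: 'a::field \<Rightarrow> 'a fls)"
  by (simp_all add: is_ring_hom_def fls_plus_const)

lemmas eval_fps = is_ring_homD[OF is_ring_hom_eval_hom[OF is_ring_hom_fps_const]]
  eval_hom_generators[OF is_ring_hom_fps_const]
lemmas eval_fls = is_ring_homD[OF is_ring_hom_eval_hom[OF is_ring_hom_fls_const]]
  eval_hom_generators[OF is_ring_hom_fls_const]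

text \<open>
  The equation \<open>w e = u\<^sup>4\<close>, read as \<open>w = u\<^sup>4 - w (e - 1)\<close>, is a contraction in \<open>w\<close>.
\<close>
lemma ex_branch:
  "\<exists>w. fps_X dvd w \<and> w * eval_hom fps_const fps_X w (infinity_unit C) = fps_X ^ 4"
proof -
  define H where "H w = eval_hom fps_const fps_X w (infinity_unit C - 1)" for w :: "'a fps"
  define \<Phi> where "\<Phi> w = fps_X ^ 4 - w * H w" for w
  have H_X: "fps_X dvd H w" if w: "fps_X dvd w" for w
  proof -
    obtain k where k: "w = fps_X * k" using w by (auto simp: dvd_def)
    show ?thesis unfolding H_def infinity_unit_def k
      by (simp add: eval_fps power2_eq_square power3_eq_cube)
  qed
  have H_diff: "f - g dvd H f - H g" for f g
  proof -
    have p: "f - g dvd f ^ n - g ^ n" for n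
      by (induction n) (simp_all add: dvd_power_le, metis power_diff_sumr2 dvd_triv_left power_Suc)
    have "H f - H g = fps_const (p1 C) * fps_X * (f ^ 1 - g ^ 1) + fps_const (p0 C) * (f ^ 2 - g ^ 2)
       + fps_const (q2 C) * fps_X ^ 2 * (f ^ 1 - g ^ 1) + fps_const (q1 C) * fps_X * (f ^ 2 - g ^ 2)
       + fps_const (q0 C) * (f ^ 3 - g ^ 3)"
      by (simp add: H_def infinity_unit_def eval_fps algebra_simps)
    then show ?thesis by (simp only:) (intro dvd_add dvd_mult p)
  qed
  have "\<exists>w. fps_X dvd w \<and> \<Phi> w = w"
  proof (rule fps_fixed_point)
    fix f :: "'a fps" assume "fps_X dvd f"
    then show "fps_X dvd \<Phi> f" by (simp add: \<Phi>_def)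
  next
    fix f g :: "'a fps" and n assume f: "fps_X dvd f" "fps_X dvd g" "fps_X ^ n dvd f - g"
    have "\<Phi> f - \<Phi> g = - ((f - g) * H f + g * (H f - H g))" by (simp add: \<Phi>_def algebra_simps)
    moreover have "fps_X ^ Suc n dvd (f - g) * H f"
      using mult_dvd_mono[OF f(3) H_X[OF f(1)]] by (simp add: mult.commute)
    moreover have "fps_X ^ Suc n dvd g * (H f - H g)"
      using mult_dvd_mono[OF f(2) dvd_trans[OF f(3) H_diff]] by simp
    ultimately show "fps_X ^ Suc n dvd \<Phi> f - \<Phi> g" by (metis dvd_add dvd_minus_iff)
  qed
  then obtain w where w: "fps_X dvd w" "\<Phi> w = w" by blast
  have "w * eval_hom fps_const fps_X w (infinity_unit C) = w + w * H w"
    by (simp add: H_def eval_fps algebra_simps)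
  also have "\<dots> = \<Phi> w + w * H w" by (simp only: w(2))
  also have "\<dots> = fps_X ^ 4" by (simp add: \<Phi>_def)
  finally show ?thesis using w(1) by blast
qed

definition branch :: "'a::field c34 \<Rightarrow> 'a fps" where
  "branch C = (SOME w. fps_X dvd w \<and> w * eval_hom fps_const fps_X w (infinity_unit C) = fps_X ^ 4)"

abbreviation at_branch :: "'a::field c34 \<Rightarrow> 'a poly poly \<Rightarrow> 'a fps" where
  "at_branch C \<equiv> eval_hom fps_const fps_X (branch C)"

lemma branch: "fps_X dvd branch C" "branch C * at_branch C (infinity_unit C) = fps_X ^ 4"
  using someI_ex[OF ex_branch[of C]] by (simp_all add: branch_def)

lemma coeff2_vx_vy_mult_0: "coeff2 (vx * P) 0 0 = 0" "coeff2 (vy * P) 0 0 = 0"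
  by (simp_all add: coeff2_def vx_def vy_def)

lemma at_branch_nth_0: "fps_nth (at_branch C P) 0 = coeff2 P 0 0"
proof (induction P rule: bivariate_induct)
  case (vy P)
  have "fps_nth (branch C) 0 = 0" using branch(1)[of C] by (auto simp: dvd_def)
  then show ?case by (simp add: eval_fps coeff2_vx_vy_mult_0)
qed (simp_all add: eval_fps coeff2_add coeff2_Cst coeff2_vx_vy_mult_0)

lemma subdegree_branch: "branch C \<noteq> 0" "subdegree (branch C) = 4"
proof -
  have "fps_nth (at_branch C (infinity_unit C)) 0 = 1"
    unfolding at_branch_nth_0 infinity_unit_def by (simp add: coeff2_def vx_def vy_def Cst_def coeff_mult power2_eq_square power3_eq_cube)
  then have u: "at_branch C (infinity_unit C) \<noteq> 0" "subdegree (at_branch C (infinity_unit C)) = 0"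
    by (auto simp: subdegree_eq_0_iff)
  show "branch C \<noteq> 0" using branch(2)[of C] by auto
  with u show "subdegree (branch C) = 4"
    using subdegree_mult[of "branch C" "at_branch C (infinity_unit C)"] branch(2)[of C] by simp
qed

text \<open>
  The Laurent expansion at \<open>P\<^sub>\<infinity>\<close> of the function given by a polynomial in \<open>x = u / w\<close> and
  \<open>y = 1 / w\<close>. Since its kernel is generated by the curve equation, it embeds \<open>R\<close> into a field, and
  equations between elements of \<open>R\<close> are stated as equations between Laurent series.
\<close>
definition laurent :: "'a::field c34 \<Rightarrow> 'a poly poly \<Rightarrow> 'a fls" where
  "laurent C = eval_hom fls_const (fls_X / fps_to_fls (branch C)) (1 / fps_to_fls (branch C))"

definition pole_ord :: "'a::field c34 \<Rightarrow> 'a poly poly \<Rightarrow> int" where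
  "pole_ord C P = - fls_subdegree (laurent C P)"

lemma is_ring_hom_laurent: "is_ring_hom (laurent C)"
  unfolding laurent_def by (rule is_ring_hom_eval_hom[OF is_ring_hom_fls_const])

lemmas laurent_hom = is_ring_homD[OF is_ring_hom_laurent]

lemma laurent_generators:
  "laurent C (Cst c) = fls_const c" "laurent C vx = fls_X / fps_to_fls (branch C)"
  "laurent C vy = 1 / fps_to_fls (branch C)"
  by (simp_all add: laurent_def eval_fls)

lemma eval_fls_branch: "eval_hom fls_const fls_X (fps_to_fls (branch C)) P = fps_to_fls (at_branch C P)"
  by (induction P rule: bivariate_induct) (simp_all add: eval_fls eval_fps fls_times_fps_to_fls)

lemma laurent_curve_poly: "laurent C (curve_poly C) = 0"
proof -
  define W where "W = fps_to_fls (branch C)"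
  have W: "W \<noteq> 0" by (simp add: W_def subdegree_branch)
  have "W * eval_hom fls_const fls_X W (infinity_unit C) = fls_X ^ 4"
    unfolding W_def eval_fls_branch fls_times_fps_to_fls[symmetric] branch
    by (simp add: fps_to_fls_power)
  then have "fls_X ^ 4 = W * (1 + fls_const (p2 C) * fls_X ^ 2 + fls_const (p1 C) * fls_X * W + fls_const (p0 C) * W ^ 2
     + fls_const (q2 C) * fls_X ^ 2 * W + fls_const (q1 C) * fls_X * W ^ 2 + fls_const (q0 C) * W ^ 3)"
    by (simp add: infinity_unit_def eval_fls)
  then have "(fls_X / W) ^ 4 = W * (1 + fls_const (p2 C) * fls_X ^ 2 + fls_const (p1 C) * fls_X * W + fls_const (p0 C) * W ^ 2
     + fls_const (q2 C) * fls_X ^ 2 * W + fls_const (q1 C) * fls_X * W ^ 2 + fls_const (q0 C) * W ^ 3) / W ^ 4"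
    by (simp only: power_divide)
  then have X: "(fls_X / W) ^ 4 = (1 / W) ^ 3 + (fls_const (p2 C) * (fls_X / W) ^ 2 + fls_const (p1 C) * (fls_X / W)
     + fls_const (p0 C)) * (1 / W) + fls_const (q2 C) * (fls_X / W) ^ 2 + fls_const (q1 C) * (fls_X / W) + fls_const (q0 C)"
    using W by (simp add: power_divide field_simps power2_eq_square power3_eq_cube power4_eq_xxxx)
  show ?thesis
    unfolding curve_poly_def laurent_def W_def[symmetric] by (simp only: eval_fls X) simp
qed

lemma fls_subdegree_laurent_generators:
  "laurent C vx \<noteq> 0" "fls_subdegree (laurent C vx) = -3"
  "laurent C vy \<noteq> 0" "fls_subdegree (laurent C vy) = -4"
proof -
  define W where "W = fps_to_fls (branch C)"
  have W: "W \<noteq> 0" "fls_subdegree W = 4"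
    by (simp_all add: W_def subdegree_branch fls_subdegree_fls_to_fps)
  have "laurent C vy * W = 1" "laurent C vx * W = fls_X"
    using W(1) by (simp_all add: laurent_generators W_def[symmetric])
  then show v: "laurent C vx \<noteq> 0" "laurent C vy \<noteq> 0"
    and "fls_subdegree (laurent C vx) = -3" "fls_subdegree (laurent C vy) = -4"
  proof -
    assume *: "laurent C vy * W = 1" "laurent C vx * W = fls_X"
    show v: "laurent C vx \<noteq> 0" "laurent C vy \<noteq> 0" using * by auto
    show "fls_subdegree (laurent C vx) = -3" "fls_subdegree (laurent C vy) = -4"
      using fls_subdegree_mult[OF v(1) W(1)] fls_subdegree_mult[OF v(2) W(1)] W(2) by (simp_all add: *)
  qed
qed

lemma pole_ord_mult:
  assumes "laurent C P \<noteq> 0" "laurent C Q \<noteq> 0"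
  shows "pole_ord C (P * Q) = pole_ord C P + pole_ord C Q"
  using assms by (simp add: pole_ord_def laurent_hom)

lemma pole_ord_monomial:
  "laurent C (vx ^ i * vy ^ j) \<noteq> 0" "pole_ord C (vx ^ i * vy ^ j) = 3 * int i + 4 * int j"
  using fls_subdegree_laurent_generators[of C] by (simp_all add: laurent_hom pole_ord_def fls_subdegree_pow)

lemma pole_ord_add_neq:
  assumes "laurent C P \<noteq> 0" "laurent C Q \<noteq> 0" "pole_ord C P < pole_ord C Q"
  shows "laurent C (P + Q) \<noteq> 0" "pole_ord C (P + Q) = pole_ord C Q"
proof -
  have "fls_subdegree (laurent C P + laurent C Q) = fls_subdegree (laurent C Q)"
    using assms by (intro fls_subdegree_add_eq2) (auto simp: pole_ord_def)
  then show "pole_ord C (P + Q) = pole_ord C Q" by (simp add: pole_ord_def laurent_hom)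
  have "laurent C P \<noteq> - laurent C Q" using assms(3) by (auto simp: pole_ord_def)
  then show "laurent C (P + Q) \<noteq> 0" by (simp add: laurent_hom add_eq_0_iff2)
qed

lemma pole_ord_x_poly:
  assumes "a \<noteq> 0"
  shows "laurent C [:a:] \<noteq> 0 \<and> pole_ord C [:a:] = 3 * int (degree a)"
  using assms
proof (induction a)
  case (pCons c q)
  have const: "laurent C (Cst c) \<noteq> 0" "pole_ord C (Cst c) = 0" if "c \<noteq> 0"
    using that by (simp_all add: laurent_generators pole_ord_def)
  show ?case
  proof (cases "q = 0")
    case True
    then show ?thesis using const pCons.hyps by (simp add: Cst_def)
  next
    case False
    have v: "laurent C vx \<noteq> 0" "pole_ord C vx = 3" using pole_ord_monomial[of C 1 0] by simp_all
    have x: "laurent C (vx * [:q:]) \<noteq> 0" "pole_ord C (vx * [:q:]) = 3 * int (degree q) + 3"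
      using pCons.IH[OF False] v pole_ord_mult[of C vx "[:q:]"] unfolding laurent_hom(4) by auto
    have "laurent C (Cst c + vx * [:q:]) \<noteq> 0 \<and> pole_ord C (Cst c + vx * [:q:]) = 3 * int (degree q) + 3"
    proof (cases "c = 0")
      case True
      then show ?thesis using x by simp
    next
      case False
      then show ?thesis using pole_ord_add_neq[OF const(1) x(1)] const(2) x(2) by simp
    qed
    then show ?thesis using False by (simp add: pCons_eq(2))
  qed
qed simp

lemma lead_coeff_curve_poly: "lead_coeff (curve_poly C) = 1" and degree_curve_poly: "degree (curve_poly C) = 3"
proof -
  have c: "coeff (coeff (curve_poly C) j) i = (if j > 3 then 0 else if j = 3 then coeff 1 i
      else coeff (coeff (curve_poly C) j) i)" for i j
    using coeff2_curve_poly[of C i j] by (auto simp: coeff2_def)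
  have coeffs: "coeff (curve_poly C) 3 = 1" by (rule poly_eqI) (subst c, simp)
  have "coeff (curve_poly C) j = 0" if "j > 3" for j
    using that by (intro poly_eqI) (subst c, simp)
  then show deg: "degree (curve_poly C) = 3"
    using coeffs by (intro antisym degree_le le_degree) auto
  show "lead_coeff (curve_poly C) = 1" using coeffs deg by simp
qed

lemma divide_by_curve_poly:
  "\<exists>q a b c. P = curve_poly C * q + ([:a:] + vy * [:b:] + vy ^ 2 * [:c:])"
proof -
  obtain q r where qr: "pseudo_divmod P (curve_poly C) = (q, r)" by (cases "pseudo_divmod P (curve_poly C)")
  have "curve_poly C \<noteq> 0" using degree_curve_poly[of C] by auto
  from pseudo_divmod[OF this qr] have 1: "P = curve_poly C * q + r" "r = 0 \<or> degree r < 3"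
    using lead_coeff_curve_poly[of C] by (simp_all add: degree_curve_poly)
  have "r = [:coeff r 0:] + vy * [:coeff r 1:] + vy ^ 2 * [:coeff r 2:]"
  proof (rule poly_eqI)
    fix n show "coeff r n = coeff ([:coeff r 0:] + vy * [:coeff r 1:] + vy ^ 2 * [:coeff r 2:]) n"
      using 1(2) by (auto simp: vy_def power2_eq_square coeff_pCons coeff_eq_0 eval_nat_numeral split: nat.split)
  qed
  with 1(1) show ?thesis by metis
qed

text \<open>
  The orders of \<open>a(x)\<close>, \<open>b(x) y\<close> and \<open>c(x) y\<^sup>2\<close> differ modulo 3, so nothing cancels. This one
  observation yields that \<open>R\<close> is a domain and which pole orders occur.
\<close>
lemma reduced_form:
  fixes C :: "'a::field c34"
  assumes r: "r = [:a:] + vy * [:b:] + vy ^ 2 * [:c:]" "r \<noteq> 0"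
  shows "laurent C r \<noteq> 0 \<and> (\<exists>i j. pole_ord C r = 3 * int i + 4 * int j)"
proof -
  have part: "laurent C (vy ^ j * [:p:]) \<noteq> 0 \<and> pole_ord C (vy ^ j * [:p:]) = 3 * int (degree p) + 4 * int j"
    if "p \<noteq> 0" for p j
  proof -
    have "laurent C (vy ^ j) \<noteq> 0" "pole_ord C (vy ^ j) = 4 * int j"
      using pole_ord_monomial[of C 0 j] by simp_all
    then show ?thesis
      using pole_ord_x_poly[OF that, of C] pole_ord_mult[of C "vy ^ j" "[:p:]"]
      unfolding laurent_hom(4) by auto
  qed
  have sum: "P + Q = 0 \<or> laurent C (P + Q) \<noteq> 0 \<and> (pole_ord C (P + Q) = pole_ord C P \<and> P \<noteq> 0 \<or> pole_ord C (P + Q) = pole_ord C Q \<and> Q \<noteq> 0)"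
    if "P = 0 \<or> laurent C P \<noteq> 0" "Q = 0 \<or> laurent C Q \<noteq> 0"
      "P \<noteq> 0 \<Longrightarrow> Q \<noteq> 0 \<Longrightarrow> pole_ord C P \<noteq> pole_ord C Q" for P Q
  proof (cases "P = 0 \<or> Q = 0")
    case True
    then show ?thesis using that by auto
  next
    case False
    then have "pole_ord C P < pole_ord C Q \<or> pole_ord C Q < pole_ord C P" using that by auto
    then show ?thesis using False that pole_ord_add_neq[of C P Q] pole_ord_add_neq[of C Q P]
      by (auto simp: add.commute)
  qed
  define A B D where "A = vy ^ 0 * [:a:]" and "B = vy ^ 1 * [:b:]" and "D = vy ^ 2 * [:c:]"
  have part_mod: "Q = 0 \<or> laurent C Q \<noteq> 0" "Q \<noteq> 0 \<Longrightarrow> pole_ord C Q mod 3 = int j"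
    "Q \<noteq> 0 \<Longrightarrow> \<exists>i k. pole_ord C Q = 3 * int i + 4 * int k"
    if "Q = vy ^ j * [:p:]" "j < 3" for Q p j
  proof -
    show "Q = 0 \<or> laurent C Q \<noteq> 0" using part that(1) by (cases "p = 0") auto
    have "pole_ord C Q = 3 * int (degree p) + 4 * int j" if "Q \<noteq> 0"
      using part[of p j] that \<open>Q = _\<close> by (cases "p = 0") auto
    then show "\<exists>i k. pole_ord C Q = 3 * int i + 4 * int k" "pole_ord C Q mod 3 = int j" if "Q \<noteq> 0"
      using that \<open>j < 3\<close> by (blast, simp) presburger
  qed
  note A = part_mod[OF A_def] and B = part_mod[OF B_def] and D = part_mod[OF D_def]
  have AB: "A + B = 0 \<or> laurent C (A + B) \<noteq> 0 \<and> (pole_ord C (A + B) = pole_ord C A \<and> A \<noteq> 0 \<or> pole_ord C (A + B) = pole_ord C B \<and> B \<noteq> 0)"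
    using A(1,2) B(1,2) by (intro sum) auto
  have "(A + B) + D = 0 \<or> laurent C (A + B + D) \<noteq> 0 \<and> (pole_ord C (A + B + D) = pole_ord C (A + B) \<and> A + B \<noteq> 0 \<or> pole_ord C (A + B + D) = pole_ord C D \<and> D \<noteq> 0)"
    using AB A(2) B(2) D(1,2) by (intro sum) auto
  moreover have "r = A + B + D" by (simp add: r A_def B_def D_def)
  moreover have "Q \<noteq> 0 \<Longrightarrow> \<exists>i k. pole_ord C Q = 3 * int i + 4 * int k" if "Q = A \<or> Q = B \<or> Q = D" for Q
    using that A(3) B(3) D(3) by auto
  ultimately show ?thesis using r(2) AB by metis
qed

lemma laurent_eq_0_iff: "laurent C P = 0 \<longleftrightarrow> curve_poly C dvd P"
proof
  assume P: "laurent C P = 0"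
  obtain q a b c where d: "P = curve_poly C * q + ([:a:] + vy * [:b:] + vy ^ 2 * [:c:])"
    using divide_by_curve_poly by blast
  have "laurent C ([:a:] + vy * [:b:] + vy ^ 2 * [:c:]) = 0"
    using P unfolding d laurent_hom(3)[of C "curve_poly C * q"] laurent_hom(4)[of C "curve_poly C"]
    by (simp add: laurent_curve_poly)
  then have "[:a:] + vy * [:b:] + vy ^ 2 * [:c:] = 0" using reduced_form[OF refl] by blast
  then show "curve_poly C dvd P" using d by simp
qed (auto simp: dvd_def laurent_hom laurent_curve_poly)

lemma laurent_eq_iff: "laurent C P = laurent C Q \<longleftrightarrow> curve_poly C dvd P - Q"
  using laurent_eq_0_iff[of C "P - Q"] by (simp add: laurent_hom)

lemma pole_ord_cases:
  assumes "laurent C P \<noteq> 0"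
  shows "\<exists>i j. pole_ord C P = 3 * int i + 4 * int j"
proof -
  obtain q a b c where d: "P = curve_poly C * q + ([:a:] + vy * [:b:] + vy ^ 2 * [:c:])"
    using divide_by_curve_poly by blast
  have "laurent C P = laurent C ([:a:] + vy * [:b:] + vy ^ 2 * [:c:])"
    by (subst d) (simp only: laurent_hom(3,4) laurent_curve_poly, simp)
  moreover from this have "[:a:] + vy * [:b:] + vy ^ 2 * [:c:] \<noteq> 0"
    using assms laurent_hom(1)[of C] by metis
  ultimately show ?thesis using reduced_form[OF refl, of a b c C] unfolding pole_ord_def by metis
qed

text \<open>
  The residue field at \<open>P\<^sub>\<infinity>\<close> is \<open>K\<close>, so leading terms of the same order are proportional. All
  dimension counts rest on this.
\<close>
lemma pole_ord_reduce:
  assumes "laurent C P \<noteq> 0" "laurent C Q \<noteq> 0" "pole_ord C P = pole_ord C Q"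
  shows "\<exists>c. c \<noteq> 0 \<and> (laurent C (P - Cst c * Q) = 0 \<or> pole_ord C (P - Cst c * Q) < pole_ord C P)"
proof -
  define f g n where "f = laurent C P" and "g = laurent C Q" and "n = fls_subdegree f"
  define c where "c = fls_nth f n / fls_nth g n"
  have n: "fls_subdegree g = n" "fls_nth f n \<noteq> 0" "fls_nth g n \<noteq> 0"
    using assms nth_fls_subdegree_nonzero[of f] nth_fls_subdegree_nonzero[of g]
    by (simp_all add: f_def g_def n_def pole_ord_def)
  have h: "laurent C (P - Cst c * Q) = f - fls_const c * g"
    by (simp add: laurent_hom laurent_generators f_def g_def)
  have "fls_nth (f - fls_const c * g) k = 0" if "k \<le> n" for k
    using that n by (cases "k = n") (auto simp: c_def n_def)
  then have "f - fls_const c * g \<noteq> 0 \<Longrightarrow> n < fls_subdegree (f - fls_const c * g)"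
    by (intro fls_subdegree_greaterI) auto
  moreover have "c \<noteq> 0" using n by (simp add: c_def)
  ultimately show ?thesis using h by (intro exI[of _ c]) (auto simp: pole_ord_def f_def n_def)
qed

lemma coeff2_mult_0: "coeff2 (P * Q) 0 0 = coeff2 P 0 0 * coeff2 Q 0 0"
  by (simp add: coeff2_def coeff_mult_0)

lemma origin_decomposition: "\<exists>p q. P = Cst (coeff2 P 0 0) + vx * p + vy * q"
proof -
  have "\<exists>c p q. P = Cst c + vx * p + vy * q"
  proof (induction P rule: bivariate_induct)
    case (Cst c)
    have "Cst c = Cst c + vx * 0 + vy * 0" by simp
    then show ?case by blast
  next
    case (add P Q)
    then obtain c p q c' p' q' where "P = Cst c + vx * p + vy * q" "Q = Cst c' + vx * p' + vy * q'" by blast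
    then have "P + Q = Cst (c + c') + vx * (p + p') + vy * (q + q')"
      by (simp add: algebra_simps is_ring_homD(3)[OF is_ring_hom_Cst])
    then show ?case by blast
  next
    case (vx P)
    have "vx * P = Cst 0 + vx * P + vy * 0" by simp
    then show ?case by blast
  next
    case (vy P)
    have "vy * P = Cst 0 + vx * 0 + vy * P" by simp
    then show ?case by blast
  qed
  then obtain c p q where P: "P = Cst c + vx * p + vy * q" by blast
  then have "coeff2 P 0 0 = c" by (simp add: coeff2_add coeff2_Cst coeff2_vx_vy_mult_0)
  then show ?thesis using P by blast
qed

text \<open>
  The expansion of \<open>P\<close> starts in degree \<open>k\<close> exactly if \<open>P\<close> is locally divisible by \<open>u\<^sup>k\<close> and not by
  \<open>u\<^sup>k\<^sup>+\<^sup>1\<close>: a vanishing constant term puts \<open>P\<close> into the maximal ideal, which \<open>u\<close> generates locally,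
  and a factor \<open>u\<close> can be split off.
\<close>
lemma vanishing_order_at_infinity_eq:
  assumes P: "at_branch C P \<noteq> 0"
  shows "vanishing_order_at_infinity C P = subdegree (at_branch C P)"
proof -
  define E where "E = curve_poly_at_infinity C"
  define S where "S = coordinate_ring E"
  define m where "m = Idl\<^bsub>S\<^esub> {residue_class E vx, residue_class E vy}"
  define M where "M = {P :: 'a poly poly. coeff2 P 0 0 = 0}"
  interpret S: cring S unfolding S_def by (rule cring_coordinate_ring)
  have E: "E = vy * infinity_unit C - vx ^ 4"
    by (simp add: E_def infinity_unit_def curve_poly_at_infinity_eq)
  have unit: "coeff2 (infinity_unit C) 0 0 = 1"
    by (simp add: infinity_unit_def coeff2_add coeff2_mult_0 coeff2_basic power2_eq_square power3_eq_cube
        coeff2_Cst[of 1, simplified])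
  have M: "is_ideal M" "E \<in> M" "vx \<in> M" "vy \<in> M"
    by (auto simp: is_ideal_def M_def E coeff2_add coeff2_diff coeff2_mult_0 coeff2_basic power4_eq_xxxx
      coeff2_Cst[of 0, simplified])
  have max: "maximal_over E M"
    unfolding maximal_over_def
  proof (intro conjI M allI impI)
    show "1 \<notin> M" by (simp add: M_def coeff2_Cst[of 1, simplified])
    fix b assume "b \<notin> M"
    then have "1 - Cst (1 / coeff2 b 0 0) * b \<in> M"
      by (simp add: M_def coeff2_diff coeff2_Cst_mult coeff2_Cst[of 1, simplified])
    then show "\<exists>r. 1 - r * b \<in> M" by blast
  qed
  have m: "m = residue_class E ` M"
  proof
    have "ideal (residue_class E ` M) S" unfolding S_def by (rule ideal_image_residue_class[OF M(1)])
    then show "m \<subseteq> residue_class E ` M"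
      unfolding m_def using M(3,4) by (intro S.genideal_minimal) auto
    have I: "ideal m S" unfolding m_def S_def by (intro ring.genideal_ideal cring.axioms(1) cring_coordinate_ring) auto
    have "residue_class E vx \<in> m" "residue_class E vy \<in> m"
      unfolding m_def using S.genideal_self[of "{residue_class E vx, residue_class E vy}"] by (auto simp: S_def)
    then have xy: "vx \<in> preimage E m" "vy \<in> preimage E m" by (auto simp: preimage_def)
    note pre = is_idealD[OF is_ideal_preimage(1)[OF I[unfolded S_def]]]
    show "residue_class E ` M \<subseteq> m"
    proof (intro image_subsetI)
      fix Q assume "Q \<in> M"
      then obtain p q where "Q = vx * p + vy * q" using origin_decomposition[of Q] by (auto simp: M_def)
      then have "Q \<in> preimage E m" using xy pre(2,4) by simp
      then show "residue_class E Q \<in> m" by (simp add: preimage_def)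
    qed
  qed
  have pre: "preimage E m = M" unfolding m by (rule preimage_image[OF M(1,2)])
  have ideal_m: "ideal m (coordinate_ring E)" unfolding m by (rule ideal_image_residue_class[OF M(1)])
  have loc: "\<exists>b c. b \<notin> M \<and> E dvd b * Q - vx * c" if Q: "Q \<in> M" for Q
  proof -
    obtain p q where "Q = vx * p + vy * q" using origin_decomposition[of Q] Q by (auto simp: M_def)
    then have "infinity_unit C * Q - vx * (infinity_unit C * p + vx ^ 3 * q) = E * q"
      by (simp add: E algebra_simps eval_nat_numeral)
    moreover have "infinity_unit C \<notin> M" by (simp add: M_def unit)
    ultimately show ?thesis by (metis dvd_triv_left)
  qed
  have E_0: "at_branch C E = 0"
    using branch(2)[of C] by (simp add: E eval_fps)
  have eq: "at_branch C b * at_branch C Q = fps_X ^ n * at_branch C c" if "E dvd b * Q - vx ^ n * c" for b Q c n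
  proof -
    obtain k where "b * Q - vx ^ n * c = E * k" using \<open>E dvd _\<close> by (rule dvdE)
    then have "at_branch C (b * Q - vx ^ n * c) = 0" by (simp only: eval_fps(4) E_0 mult_zero_left)
    then show ?thesis by (simp add: eval_fps)
  qed
  have unit_M: "at_branch C b \<noteq> 0 \<and> subdegree (at_branch C b) = 0" if "b \<notin> M" for b
    using that at_branch_nth_0[of C b] by (auto simp: M_def)
  have reach: "locally_divisible E M (vx ^ subdegree (at_branch C Q)) Q" if "at_branch C Q \<noteq> 0" for Q
    using that
  proof (induction "subdegree (at_branch C Q)" arbitrary: Q)
    case 0
    then show ?case unfolding locally_divisible_def
      using max by (intro exI[of _ 1] exI[of _ Q]) (simp add: maximal_over_def)
  next
    case (Suc k)
    have "fps_nth (at_branch C Q) 0 = 0" using Suc.hyps(2) by (intro nth_less_subdegree_zero) simp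
    then have "Q \<in> M" by (simp add: M_def at_branch_nth_0)
    then obtain b c where bc: "b \<notin> M" "E dvd b * Q - vx * c" using loc by blast
    \<comment> \<open>Splitting off one factor \<open>u\<close> leaves \<open>c\<close>, whose expansion starts one degree earlier.\<close>
    have e: "at_branch C b * at_branch C Q = fps_X * at_branch C c" using eq[of b Q 1 c] bc(2) by simp
    have c0: "at_branch C c \<noteq> 0"
      using e unit_M[OF bc(1)] Suc.prems by (metis mult_eq_0_iff)
    have "subdegree (at_branch C c) = k"
    proof -
      have "subdegree (at_branch C b * at_branch C Q) = Suc k"
        using unit_M[OF bc(1)] Suc.prems Suc.hyps(2) by simp
      then show ?thesis unfolding e using c0 by simp
    qed
    then obtain b' c' where bc': "b' \<notin> M" "E dvd b' * c - vx ^ k * c'"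
      using Suc.hyps(1)[of c] c0 by (auto simp: locally_divisible_def)
    have "(b' * b) * Q - vx ^ Suc k * c' = b' * (b * Q - vx * c) + vx * (b' * c - vx ^ k * c')"
      by (simp add: algebra_simps)
    then have "E dvd (b' * b) * Q - vx ^ Suc k * c'" using bc(2) bc'(2) by simp
    then show ?case using maximal_over_mult[OF max bc'(1) bc(1)] Suc.hyps(2)
      unfolding locally_divisible_def by metis
  qed
  have "locally_divisible E M (vx ^ n) P \<longleftrightarrow> n \<le> subdegree (at_branch C P)" for n
  proof
    assume "locally_divisible E M (vx ^ n) P"
    then obtain b c where bc: "b \<notin> M" "E dvd b * P - vx ^ n * c" by (auto simp: locally_divisible_def)
    have e: "at_branch C b * at_branch C P = fps_X ^ n * at_branch C c" using eq bc(2) .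
    then have "at_branch C c \<noteq> 0" using unit_M[OF bc(1)] P by (metis mult_eq_0_iff)
    moreover have "subdegree (at_branch C b * at_branch C P) = subdegree (at_branch C P)"
      using unit_M[OF bc(1)] P by simp
    ultimately show "n \<le> subdegree (at_branch C P)" unfolding e by simp
  next
    assume n: "n \<le> subdegree (at_branch C P)"
    obtain b c where bc: "b \<notin> M" "E dvd b * P - vx ^ subdegree (at_branch C P) * c"
      using reach[OF P] by (auto simp: locally_divisible_def)
    moreover have "vx ^ subdegree (at_branch C P) = vx ^ n * (vx ^ (subdegree (at_branch C P) - n) :: 'a poly poly)"
      using n by (simp flip: power_add)
    ultimately have "E dvd b * P - vx ^ n * (vx ^ (subdegree (at_branch C P) - n) * c)"
      by (simp only: mult.assoc)
    then show "locally_divisible E M (vx ^ n) P" using bc(1) unfolding locally_divisible_def by blast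
  qed
  then have "vanishing_order S m (residue_class E P) = subdegree (at_branch C P)"
    unfolding S_def
    using ideal_pow_iff[OF ideal_m, unfolded pre, OF max M(3)] loc
    by (intro vanishing_order_eqI) (simp add: locally_divisible_def)
  then show ?thesis
    by (simp add: vanishing_order_at_infinity_def Let_def E_def S_def m_def)
qed

text \<open>
  With \<open>n\<close> the total degree of a representative, the chart has the expansion \<open>w\<^sup>n P\<close>, whose order is
  \<open>4 n\<close> minus the pole order; and the representative does not matter for the expansion.
\<close>
lemma pole_order_eq:
  assumes P: "laurent C P \<noteq> 0"
  shows "pole_order C (cls C P) = pole_ord C P"
proof -
  define W where "W = fps_to_fls (branch C)"
  have W: "W \<noteq> 0" "fls_subdegree W = 4"
    by (simp_all add: W_def subdegree_branch fls_subdegree_fls_to_fps)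
  define Q where "Q = (SOME Q. Q \<in> cls C P)"
  have "P \<in> cls C P" by (simp add: mem_residue_class)
  then have "Q \<in> cls C P" unfolding Q_def by (rule someI)
  then have Q: "laurent C Q = laurent C P" by (simp add: mem_residue_class laurent_eq_iff)
  define n where "n = total_degree Q"
  have "fps_to_fls (at_branch C (chart_at_infinity n Q)) = W ^ n * laurent C Q"
    unfolding eval_fls_branch[symmetric] W_def laurent_def
    by (rule eval_hom_chart_at_infinity[OF is_ring_hom_fls_const]) (simp_all add: subdegree_branch n_def)
  then have chart: "fps_to_fls (at_branch C (chart_at_infinity n Q)) = W ^ n * laurent C P" by (simp only: Q)
  have nz: "at_branch C (chart_at_infinity n Q) \<noteq> 0"
    using chart W(1) P by (metis fps_to_fls_eq_0_iff mult_eq_0_iff power_eq_0_iff)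
  have "int (subdegree (at_branch C (chart_at_infinity n Q))) = fls_subdegree (W ^ n * laurent C P)"
    unfolding chart[symmetric] by (simp add: fls_subdegree_fls_to_fps)
  also have "\<dots> = 4 * int n - pole_ord C P"
    using W P by (simp add: fls_subdegree_pow pole_ord_def)
  finally have 1: "int (vanishing_order_at_infinity C (chart_at_infinity n Q)) = 4 * int n - pole_ord C P"
    using nz by (simp add: vanishing_order_at_infinity_eq)
  have "at_branch C vy = branch C" by (simp add: eval_fps)
  then have 2: "vanishing_order_at_infinity C (vy :: 'a poly poly) = 4"
    using vanishing_order_at_infinity_eq[of C vy] subdegree_branch[of C] by simp
  show ?thesis
    unfolding pole_order_def Let_def Q_def[symmetric] n_def[symmetric] 2 1 by simp
qed

lemma cls_eq_0_iff: "cls C P = \<zero>\<^bsub>R C\<^esub> \<longleftrightarrow> laurent C P = 0"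
  by (simp add: residue_class_eq_0_iff laurent_eq_0_iff)

lemma cls_eq_iff: "cls C P = cls C Q \<longleftrightarrow> laurent C P = laurent C Q"
  by (simp add: residue_class_eq_iff laurent_eq_iff)

lemma cls_mem_W_iff: "cls C P \<in> W C N \<longleftrightarrow> laurent C P = 0 \<or> pole_ord C P \<le> N"
  by (cases "laurent C P = 0") (simp_all add: W_def cls_eq_0_iff pole_order_eq)

section \<open>Counting dimensions by pole orders\<close>

text \<open>
  Subspaces of \<open>R\<close>, as preimages in \<open>K[x,y]\<close>. Their dimensions are counted by the pole orders of their
  elements, which is possible because elements of distinct pole orders are independent and
  elements of the same pole order are proportional up to smaller ones.
\<close>
definition is_space :: "'a::field c34 \<Rightarrow> 'a poly poly set \<Rightarrow> bool" where
  "is_space C U \<longleftrightarrow> (\<forall>P. laurent C P = 0 \<longrightarrow> P \<in> U) \<and> (\<forall>P\<in>U. \<forall>Q\<in>U. P + Q \<in> U) \<and> (\<forall>c. \<forall>P\<in>U. Cst c * P \<in> U)"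

definition pole_ords :: "'a::field c34 \<Rightarrow> 'a poly poly set \<Rightarrow> nat set" where
  "pole_ords C U = {n. \<exists>P\<in>U. laurent C P \<noteq> 0 \<and> pole_ord C P = int n}"

lemma is_spaceD:
  assumes "is_space C U"
  shows "laurent C P = 0 \<Longrightarrow> P \<in> U" "P \<in> U \<Longrightarrow> Q \<in> U \<Longrightarrow> P + Q \<in> U" "P \<in> U \<Longrightarrow> Cst c * P \<in> U"
    "P \<in> U \<Longrightarrow> Q \<in> U \<Longrightarrow> P - Q \<in> U" "0 \<in> U"
proof -
  show *: "laurent C P = 0 \<Longrightarrow> P \<in> U" "P \<in> U \<Longrightarrow> Q \<in> U \<Longrightarrow> P + Q \<in> U" "P \<in> U \<Longrightarrow> Cst c * P \<in> U" for P Q c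
    using assms by (auto simp: is_space_def)
  show "0 \<in> U" using *(1)[of 0] by (simp add: laurent_hom)
  have "Cst (- 1) * Q = - Q" using is_ring_homD(5)[OF is_ring_hom_Cst, of "1::'a"] by simp
  then show "P \<in> U \<Longrightarrow> Q \<in> U \<Longrightarrow> P - Q \<in> U" using *(2)[of P "- Q"] *(3)[of Q "- 1"] by simp
qed

lemma laurent_cong_mem:
  assumes "is_space C U" "laurent C P = laurent C Q" "Q \<in> U"
  shows "P \<in> U"
  using is_spaceD(2)[OF assms(1) is_spaceD(1)[OF assms(1), of "P - Q"] assms(3)] assms(2)
  by (simp add: laurent_hom)

lemma pole_ord_nonneg: "0 \<le> pole_ord C P"
proof (cases "laurent C P = 0")
  case False
  then show ?thesis using pole_ord_cases[of C P] by auto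
qed (simp add: pole_ord_def)

text \<open>
  Subtracting a multiple of an element of the same pole order lowers the pole order, so an element of the larger space reduces to 0.
\<close>
lemma space_eqI:
  assumes "is_space C U" "is_space C V" "U \<subseteq> V" "pole_ords C V \<subseteq> pole_ords C U"
  shows "U = V"
proof -
  have "P \<in> U" if "P \<in> V" for P
    using that
  proof (induction "nat (pole_ord C P)" arbitrary: P rule: less_induct)
    case less
    show ?case
    proof (cases "laurent C P = 0")
      case True
      then show ?thesis using is_spaceD(1)[OF assms(1)] by blast
    next
      case False
      then have "nat (pole_ord C P) \<in> pole_ords C U"
        using assms(4) less.prems pole_ord_nonneg[of C P] by (fastforce simp: pole_ords_def)
      then obtain Q where Q: "Q \<in> U" "laurent C Q \<noteq> 0" "pole_ord C P = pole_ord C Q"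
        using pole_ord_nonneg[of C P] by (auto simp: pole_ords_def)
      obtain c where c: "laurent C (P - Cst c * Q) = 0 \<or> pole_ord C (P - Cst c * Q) < pole_ord C P"
        using pole_ord_reduce[OF False Q(2,3)] by blast
      have cQ: "Cst c * Q \<in> U" using is_spaceD(3)[OF assms(1) Q(1)] .
      have "P - Cst c * Q \<in> V" using is_spaceD(4)[OF assms(2) less.prems] cQ assms(3) by blast
      then have "P - Cst c * Q \<in> U"
        using c less.hyps[of "P - Cst c * Q"] is_spaceD(1)[OF assms(1)] pole_ord_nonneg[of C "P - Cst c * Q"] by auto
      from is_spaceD(2)[OF assms(1) this cQ] show ?thesis by simp
    qed
  qed
  then show ?thesis using assms(3) by blast
qed

definition adjoin :: "'a::field poly poly set \<Rightarrow> 'a poly poly \<Rightarrow> 'a poly poly set" where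
  "adjoin U e = {P + Cst c * e | P c. P \<in> U}"

lemma Cst_add: "Cst (a + b) = Cst a + Cst b" and Cst_mult: "Cst (a * b) = Cst a * Cst b"
  by (simp_all add: is_ring_homD[OF is_ring_hom_Cst])

lemma is_space_adjoin:
  assumes "is_space C U"
  shows "is_space C (adjoin U e)" "U \<subseteq> adjoin U e" "e \<in> adjoin U e"
proof -
  note U = is_spaceD[OF assms]
  have in1: "P \<in> adjoin U e" if "P \<in> U" for P
  proof -
    have "P = P + Cst 0 * e" by simp
    then show ?thesis using that unfolding adjoin_def by blast
  qed
  then show "U \<subseteq> adjoin U e" by blast
  have "e = 0 + Cst 1 * e" by simp
  then show "e \<in> adjoin U e" using U(5) unfolding adjoin_def by blast
  show "is_space C (adjoin U e)"
    unfolding is_space_def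
  proof (intro conjI allI ballI impI)
    fix P assume "laurent C P = 0"
    then show "P \<in> adjoin U e" using in1 U(1) by blast
  next
    fix P Q assume "P \<in> adjoin U e" "Q \<in> adjoin U e"
    then obtain P' c Q' d where "P = P' + Cst c * e" "P' \<in> U" "Q = Q' + Cst d * e" "Q' \<in> U"
      unfolding adjoin_def by blast
    moreover from this have "P + Q = (P' + Q') + Cst (c + d) * e" by (simp add: Cst_add algebra_simps)
    ultimately show "P + Q \<in> adjoin U e" using U(2) unfolding adjoin_def by blast
  next
    fix P k assume "P \<in> adjoin U e"
    then obtain P' c where "P = P' + Cst c * e" "P' \<in> U" unfolding adjoin_def by blast
    moreover from this have "Cst k * P = Cst k * P' + Cst (k * c) * e" by (simp add: Cst_mult algebra_simps)
    ultimately show "Cst k * P \<in> adjoin U e" using U(3) unfolding adjoin_def by blast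
  qed
qed

text \<open>
  Adjoining one dimension adds exactly one pole order, namely the least pole order in the coset
  \<open>e + U\<close>.
\<close>
lemma pole_ords_adjoin:
  assumes U: "is_space C U" and e: "e \<notin> U"
  shows "\<exists>n. n \<notin> pole_ords C U \<and> pole_ords C (adjoin U e) = insert n (pole_ords C U)"
proof -
  define Q where "Q k = (\<exists>u\<in>U. nat (pole_ord C (e - u)) = k)" for k
  have "Q (nat (pole_ord C (e - 0)))" unfolding Q_def using is_spaceD(5)[OF U] by blast
  then obtain n where n: "Q n" "\<And>k. k < n \<Longrightarrow> \<not> Q k" using exists_least_iff[of Q] by blast
  then obtain u where u: "u \<in> U" "pole_ord C (e - u) = int n"
    using pole_ord_nonneg[of C] by (fastforce simp: Q_def)
  define e' where "e' = e - u"
  have e'U: "e' \<notin> U" using is_spaceD(2)[OF U, of e' u] u(1) e by (auto simp: e'_def)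
  have e': "laurent C e' \<noteq> 0" "pole_ord C e' = int n"
    using e'U is_spaceD(1)[OF U] u(2) by (auto simp: e'_def)
  have notin: "n \<notin> pole_ords C U"
  proof
    assume "n \<in> pole_ords C U"
    then obtain P where P: "P \<in> U" "laurent C P \<noteq> 0" "pole_ord C e' = pole_ord C P"
      using e'(2) by (auto simp: pole_ords_def)
    obtain c where c: "laurent C (e' - Cst c * P) = 0 \<or> pole_ord C (e' - Cst c * P) < pole_ord C e'"
      using pole_ord_reduce[OF e'(1) P(2,3)] by blast
    have eq: "e' - Cst c * P = e - (u + Cst c * P)" by (simp add: e'_def)
    have mem: "u + Cst c * P \<in> U" using is_spaceD(2,3)[OF U] u(1) P(1) by blast
    have "laurent C (e' - Cst c * P) \<noteq> 0"
    proof
      assume "laurent C (e' - Cst c * P) = 0"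
      then have "e' - Cst c * P + Cst c * P \<in> U" using is_spaceD(1,2,3)[OF U] P(1) by blast
      then show False using e'U by simp
    qed
    then have "nat (pole_ord C (e - (u + Cst c * P))) < n"
      using c e'(2) pole_ord_nonneg[of C "e' - Cst c * P"] unfolding eq by linarith
    then show False using n(2) mem unfolding Q_def by blast
  qed
  have "k \<in> insert n (pole_ords C U)" if "k \<in> pole_ords C (adjoin U e)" for k
  proof -
    from that obtain P c where P: "P \<in> U" "laurent C (P + Cst c * e) \<noteq> 0" "pole_ord C (P + Cst c * e) = int k"
      by (auto simp: pole_ords_def adjoin_def)
    define P' where "P' = P + Cst c * u"
    have P': "P' \<in> U" "P + Cst c * e = P' + Cst c * e'"
      using P(1) u(1) is_spaceD(2,3)[OF U] by (auto simp: P'_def e'_def algebra_simps)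
    show ?thesis
    proof (cases "c = 0")
      case True
      then show ?thesis using P by (auto simp: pole_ords_def)
    next
      case False
      then have ce: "laurent C (Cst c * e') \<noteq> 0" "pole_ord C (Cst c * e') = int n"
        using e' by (simp_all add: laurent_hom laurent_generators pole_ord_def)
      show ?thesis
      proof (cases "laurent C P' = 0")
        case True
        then have "laurent C (P + Cst c * e) = laurent C (Cst c * e')" by (simp add: P' laurent_hom)
        then have "pole_ord C (P + Cst c * e) = int n" using ce(2) by (simp add: pole_ord_def)
        then show ?thesis using P(3) by simp
      next
        case nz: False
        have k: "nat (pole_ord C P') \<in> pole_ords C U" using P'(1) nz pole_ord_nonneg[of C P'] by (auto simp: pole_ords_def)
        then have "pole_ord C P' \<noteq> int n" using notin pole_ord_nonneg[of C P'] by auto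
        then have "pole_ord C (P' + Cst c * e') = int n \<or> pole_ord C (P' + Cst c * e') = pole_ord C P'"
          using pole_ord_add_neq[OF nz ce(1)] pole_ord_add_neq[OF ce(1) nz] ce(2)
          by (auto simp: add.commute neq_iff)
        then show ?thesis using P(3) P'(2) k by (metis insert_iff nat_int of_nat_eq_iff)
      qed
    qed
  qed
  moreover have "n \<in> pole_ords C (adjoin U e)"
  proof -
    have "e' = - u + Cst 1 * e" by (simp add: e'_def)
    moreover have "- u \<in> U" using is_spaceD(4)[OF U is_spaceD(5)[OF U] u(1)] by simp
    ultimately have "e' \<in> adjoin U e" unfolding adjoin_def by blast
    then show ?thesis using e' by (auto simp: pole_ords_def)
  qed
  moreover have "pole_ords C U \<subseteq> pole_ords C (adjoin U e)"
    using is_space_adjoin(2)[OF U, of e] by (auto simp: pole_ords_def)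
  ultimately show ?thesis using notin by blast
qed

text \<open>
  \<open>V\<close> has dimension \<open>n\<close> over \<open>U\<close>. The form is that of the inductive predicate behind
  \<^const>\<open>ring.dim\<close>, in terms of which the degree of a point is defined.
\<close>
inductive extends :: "nat \<Rightarrow> 'a::field poly poly set \<Rightarrow> 'a poly poly set \<Rightarrow> bool" where
  refl: "extends 0 U U"
| adjoin: "extends n U V \<Longrightarrow> e \<notin> V \<Longrightarrow> extends (Suc n) U (adjoin V e)"

lemma extends_trans:
  assumes "extends k V Z" "extends n U V"
  shows "extends (n + k) U Z"
  using assms
proof (induction k V Z rule: extends.induct)
  case (adjoin k V Z e)
  then show ?case using extends.adjoin by (metis add_Suc_right)
qed simp

text \<open>
  The dimension is determined by \<open>U\<close> and \<open>V\<close>, being a number of pole orders.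
\<close>
lemma extends_pole_ords:
  assumes "extends n U V" "is_space C U"
  shows "is_space C V" "U \<subseteq> V" "finite (pole_ords C V - pole_ords C U)" "card (pole_ords C V - pole_ords C U) = n"
proof -
  have "is_space C V \<and> U \<subseteq> V \<and> pole_ords C U \<subseteq> pole_ords C V \<and> finite (pole_ords C V - pole_ords C U) \<and>
    card (pole_ords C V - pole_ords C U) = n"
    using assms
  proof (induction n U V rule: extends.induct)
    case (adjoin n U V e)
    then obtain k where k: "k \<notin> pole_ords C V" "pole_ords C (adjoin V e) = insert k (pole_ords C V)"
      using pole_ords_adjoin by blast
    then have "pole_ords C (adjoin V e) - pole_ords C U = insert k (pole_ords C V - pole_ords C U)"
      using adjoin by auto
    then show ?case using adjoin k is_space_adjoin[of C V e] by auto
  qed simp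
  then show "is_space C V" "U \<subseteq> V" "finite (pole_ords C V - pole_ords C U)" "card (pole_ords C V - pole_ords C U) = n"
    by auto
qed

lemma extends_exists:
  assumes "is_space C U" "is_space C V" "U \<subseteq> V" "finite (pole_ords C V - pole_ords C U)"
  shows "\<exists>n. extends n U V"
  using assms
proof (induction "card (pole_ords C V - pole_ords C U)" arbitrary: U rule: less_induct)
  case less
  show ?case
  proof (cases "U = V")
    case True
    then show ?thesis using extends.refl by blast
  next
    case False
    then obtain e where e: "e \<in> V" "e \<notin> U" using less.prems by blast
    note ad = is_space_adjoin[OF less.prems(1), of e]
    have sub: "adjoin U e \<subseteq> V"
      using less.prems(3) e(1) is_spaceD(2,3)[OF less.prems(2)] by (auto simp: adjoin_def)
    obtain k where k: "k \<notin> pole_ords C U" "pole_ords C (adjoin U e) = insert k (pole_ords C U)"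
      using pole_ords_adjoin[OF less.prems(1) e(2)] by blast
    have "k \<in> pole_ords C V" using k(2) sub by (auto simp: pole_ords_def)
    then have "pole_ords C V - pole_ords C (adjoin U e) \<subset> pole_ords C V - pole_ords C U" using k by auto
    then have "card (pole_ords C V - pole_ords C (adjoin U e)) < card (pole_ords C V - pole_ords C U)"
      and "finite (pole_ords C V - pole_ords C (adjoin U e))"
      using less.prems(4) by (auto intro: psubset_card_mono finite_subset)
    then obtain n where "extends n (adjoin U e) V" using less.hyps ad(1) less.prems(2) sub by blast
    from extends_trans[OF this extends.adjoin[OF extends.refl e(2)]] show ?thesis by blast
  qed
qed

definition cofinite_space :: "'a::field c34 \<Rightarrow> 'a poly poly set \<Rightarrow> bool" where
  "cofinite_space C U \<longleftrightarrow> is_space C U \<and> finite (pole_ords C UNIV - pole_ords C U)"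

definition codim :: "'a::field c34 \<Rightarrow> 'a poly poly set \<Rightarrow> nat" where
  "codim C U = card (pole_ords C UNIV - pole_ords C U)"

lemma is_space_UNIV: "is_space C UNIV" by (simp add: is_space_def)

lemma cofinite_space_mono:
  assumes "cofinite_space C U" "is_space C V" "U \<subseteq> V"
  shows "cofinite_space C V"
  using assms by (auto simp: cofinite_space_def pole_ords_def intro: finite_subset[rotated])

lemma codim_strict:
  assumes "cofinite_space C U" "is_space C V" "U \<subset> V"
  shows "codim C V < codim C U"
proof -
  have U: "is_space C U" "finite (pole_ords C UNIV - pole_ords C U)" using assms(1) by (auto simp: cofinite_space_def)
  have "pole_ords C U \<subseteq> pole_ords C V" "pole_ords C V \<subseteq> pole_ords C UNIV" using assms(3) by (auto simp: pole_ords_def)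
  moreover have "\<not> pole_ords C V \<subseteq> pole_ords C U" using space_eqI[OF U(1) assms(2)] assms(3) by blast
  ultimately have "pole_ords C UNIV - pole_ords C V \<subset> pole_ords C UNIV - pole_ords C U" by blast
  then show ?thesis unfolding codim_def using U(2) by (rule psubset_card_mono[rotated])
qed

text \<open>
  Finite codimension takes the place of Noetherian arguments: applied to the multiples of a nonzero
  function, it bounds its orders of vanishing and the number of its zeros.
\<close>
lemma no_infinite_descent:
  assumes "cofinite_space C U" "\<And>k::nat. is_space C (V k)" "\<And>k. U \<subseteq> V k" "\<And>k. V (Suc k) \<subset> V k"
  shows False
proof -
  have bound: "codim C (V k) \<le> codim C U" for k
    using codim_strict[OF assms(1,2), of k] assms(3)[of k] by (cases "U = V k") (simp_all add: psubset_eq)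
  have "k \<le> codim C (V k)" for k
  proof (induction k)
    case (Suc k)
    have "cofinite_space C (V (Suc k))" using cofinite_space_mono[OF assms(1,2,3)] .
    from codim_strict[OF this assms(2,4)] Suc show ?case by simp
  qed simp
  from this[of "Suc (codim C U)"] bound[of "Suc (codim C U)"] show False by simp
qed

lemma no_infinite_ascent:
  assumes "cofinite_space C U" "\<And>k::nat. is_space C (V k)" "\<And>k. U \<subseteq> V k" "\<And>k. V k \<subset> V (Suc k)"
  shows False
proof -
  have "codim C (V k) + k \<le> codim C (V 0)" for k
  proof (induction k)
    case (Suc k)
    have "cofinite_space C (V k)" using cofinite_space_mono[OF assms(1,2,3)] .
    from codim_strict[OF this assms(2,4)] Suc show ?case by simp
  qed simp
  from this[of "Suc (codim C (V 0))"] show False by simp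
qed

lemma semigroup_3_4: "6 \<le> n \<Longrightarrow> \<exists>i j. n = 3 * i + 4 * (j::nat)"
  by presburger

definition is_ideal_on :: "'a::field c34 \<Rightarrow> 'a poly poly set \<Rightarrow> bool" where
  "is_ideal_on C J \<longleftrightarrow> is_ideal J \<and> (\<forall>P. laurent C P = 0 \<longrightarrow> P \<in> J)"

lemma is_space_ideal: "is_ideal_on C J \<Longrightarrow> is_space C J"
  by (auto simp: is_ideal_on_def is_ideal_def is_space_def)

text \<open>
  Multiples of \<open>f\<close> by monomials have all pole orders from some point on.
\<close>
lemma cofinite_ideal:
  assumes J: "is_ideal_on C J" and f: "f \<in> J" "laurent C f \<noteq> 0"
  shows "cofinite_space C J"
proof -
  have "n \<in> pole_ords C J" if "n \<ge> nat (pole_ord C f) + 6" for n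
  proof -
    have "6 \<le> n - nat (pole_ord C f)" using that by linarith
    then obtain i j where "n - nat (pole_ord C f) = 3 * i + 4 * j" using semigroup_3_4 by blast
    then have n: "int n = pole_ord C f + (3 * int i + 4 * int j)"
      using that pole_ord_nonneg[of C f] by linarith
    have "pole_ord C (f * (vx ^ i * vy ^ j)) = int n" "laurent C (f * (vx ^ i * vy ^ j)) \<noteq> 0"
      using pole_ord_mult[OF f(2) pole_ord_monomial(1)] pole_ord_monomial[of C i j] n f(2)
      by (simp_all add: laurent_hom(4))
    moreover have "f * (vx ^ i * vy ^ j) \<in> J" using J f(1) by (auto simp: is_ideal_on_def intro: is_idealD)
    ultimately show ?thesis by (auto simp: pole_ords_def)
  qed
  then have "pole_ords C UNIV - pole_ords C J \<subseteq> {..< nat (pole_ord C f) + 6}" by (meson DiffD2 lessThan_iff linorder_not_less subsetI)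
  then show ?thesis using is_space_ideal[OF J] finite_subset by (auto simp: cofinite_space_def)
qed

section \<open>Maximal ideals of the affine curve\<close>

definition maximal_ideals :: "'a::field c34 \<Rightarrow> 'a poly poly set set" where
  "maximal_ideals C = {M. maximal_over (curve_poly C) M}"

lemma maximal_idealsD:
  assumes "M \<in> maximal_ideals C"
  shows "is_ideal M" "is_ideal_on C M" "is_space C M" "1 \<notin> M" "b \<notin> M \<Longrightarrow> \<exists>r. 1 - r * b \<in> M"
    "a \<notin> M \<Longrightarrow> b \<notin> M \<Longrightarrow> a * b \<notin> M" "curve_poly C \<in> M"
proof -
  have M: "maximal_over (curve_poly C) M" using assms by (simp add: maximal_ideals_def)
  show "is_ideal M" "1 \<notin> M" "b \<notin> M \<Longrightarrow> \<exists>r. 1 - r * b \<in> M" "curve_poly C \<in> M"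
    using M by (auto simp: maximal_over_def)
  then show "is_ideal_on C M" by (auto simp: is_ideal_on_def laurent_eq_0_iff dvd_def intro: is_idealD)
  then show "is_space C M" by (rule is_space_ideal)
  show "a \<notin> M \<Longrightarrow> b \<notin> M \<Longrightarrow> a * b \<notin> M" using maximal_over_mult[OF M] .
qed

text \<open>
  The ring \<open>R\<close> is not a field, because an inverse of \<open>x\<close> would have negative pole order.
\<close>
lemma maximal_ideal_nonzero:
  assumes M: "M \<in> maximal_ideals C"
  shows "\<exists>f\<in>M. laurent C f \<noteq> 0"
proof (cases "vx \<in> M")
  case True
  then show ?thesis using fls_subdegree_laurent_generators(1) by blast
next
  case False
  then obtain r where r: "1 - r * vx \<in> M" using maximal_idealsD(5)[OF M] by blast
  have x: "laurent C vx \<noteq> 0" "pole_ord C vx = 3" using pole_ord_monomial[of C 1 0] by simp_all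
  have "laurent C (1 - r * vx) \<noteq> 0"
  proof
    assume "laurent C (1 - r * vx) = 0"
    then have 1: "laurent C (r * vx) = laurent C 1" by (simp add: laurent_hom)
    then have "laurent C r \<noteq> 0" by (auto simp: laurent_hom)
    then have "pole_ord C (r * vx) = pole_ord C r + 3" using pole_ord_mult[OF _ x(1)] x(2) by simp
    moreover have "pole_ord C (r * vx) = 0" unfolding pole_ord_def 1 by (simp add: laurent_hom)
    ultimately show False using pole_ord_nonneg[of C r] by simp
  qed
  with r show ?thesis by blast
qed

lemma cofinite_maximal_ideal:
  assumes "M \<in> maximal_ideals C"
  shows "cofinite_space C M"
  using cofinite_ideal maximal_idealsD(2)[OF assms] maximal_ideal_nonzero[OF assms] by blast

lemma poly_ideal_principal:
  fixes I :: "'a::field poly set"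
  assumes I: "is_ideal I" and nz: "\<exists>b\<in>I. b \<noteq> 0"
  shows "\<exists>g\<in>I. g \<noteq> 0 \<and> (\<forall>b\<in>I. g dvd b)"
proof -
  define Q where "Q k = (\<exists>b\<in>I. b \<noteq> 0 \<and> degree b = k)" for k
  have "\<exists>k. Q k" using nz by (auto simp: Q_def)
  then obtain k where k: "Q k" "\<And>j. j < k \<Longrightarrow> \<not> Q j" using exists_least_iff[of Q] by blast
  then obtain g where g: "g \<in> I" "g \<noteq> 0" "degree g = k" by (auto simp: Q_def)
  have "g dvd b" if b: "b \<in> I" for b
  proof -
    have "b mod g = b - b div g * g" by (simp add: minus_div_mult_eq_mod)
    then have "b mod g \<in> I" using is_idealD[OF I] b g(1) by simp
    then have "b mod g = 0" using k(2)[of "degree (b mod g)"] degree_mod_less[OF g(2), of b] g(3)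
      by (auto simp: Q_def)
    then show ?thesis by (simp add: mod_eq_0_iff_dvd)
  qed
  with g show ?thesis by blast
qed

lemma x_poly_hom: "[:a + b:] = [:a:] + [:b:]" "[:a * b:] = [:a:] * [:b:]" "[:a - b:] = [:a:] - [:b:]"
  for a b :: "'b::comm_ring_1"
  by simp_all

text \<open>
  Were no nonzero polynomial in \<open>x\<close> in \<open>M\<close>, then the powers of \<open>x\<close> would be independent modulo \<open>M\<close>,
  against the finite codimension.
\<close>
lemma maximal_ideal_x_poly:
  assumes M: "M \<in> maximal_ideals C"
  shows "\<exists>p. [:p:] \<in> M \<and> p \<noteq> 0 \<and> degree p > 0 \<and> (\<forall>b. [:b:] \<in> M \<longrightarrow> p dvd b)"
proof -
  note MD = maximal_idealsD[OF M] and MI = is_idealD[OF maximal_idealsD(1)[OF M]]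
  have nz: "\<exists>b. [:b:] \<in> M \<and> b \<noteq> 0"
  proof (rule ccontr)
    assume none: "\<not> (\<exists>b. [:b:] \<in> M \<and> b \<noteq> 0)"
    define V where "V k = {P. \<exists>a. (\<forall>i\<ge>k. coeff a i = 0) \<and> P - [:a:] \<in> M}" for k :: nat
    show False
    proof (rule no_infinite_ascent[OF cofinite_maximal_ideal[OF M], of V])
      fix k
      show sub: "M \<subseteq> V k" by (auto simp: V_def intro!: exI[of _ 0])
      show "is_space C (V k)"
        unfolding is_space_def
      proof (intro conjI allI ballI impI)
        fix P assume "laurent C P = 0"
        then show "P \<in> V k" using sub is_spaceD(1)[OF MD(3)] by blast
      next
        fix P Q assume "P \<in> V k" "Q \<in> V k"
        then obtain a b where ab: "\<forall>i\<ge>k. coeff a i = 0" "P - [:a:] \<in> M" "\<forall>i\<ge>k. coeff b i = 0" "Q - [:b:] \<in> M"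
          by (auto simp: V_def)
        have "(P + Q) - [:a + b:] = (P - [:a:]) + (Q - [:b:])" by simp
        then have "(P + Q) - [:a + b:] \<in> M" using MI(2)[OF ab(2,4)] by metis
        then show "P + Q \<in> V k" using ab unfolding V_def by (intro CollectI exI[of _ "a + b"]) simp
      next
        fix c P assume "P \<in> V k"
        then obtain a where a: "\<forall>i\<ge>k. coeff a i = 0" "P - [:a:] \<in> M" by (auto simp: V_def)
        have "Cst c * P - [:smult c a:] = Cst c * (P - [:a:])" by (simp add: Cst_def smult_diff_right)
        then have "Cst c * P - [:smult c a:] \<in> M" using MI(3)[OF a(2)] by metis
        then show "Cst c * P \<in> V k" using a(1) unfolding V_def by (intro CollectI exI[of _ "smult c a"]) simp
      qed
      have "[:monom 1 k:] \<in> V (Suc k)"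
        using MI(1) by (auto simp: V_def intro!: exI[of _ "monom 1 k"])
      moreover have "[:monom 1 k:] \<notin> V k"
      proof
        assume "[:monom 1 k:] \<in> V k"
        then obtain a where a: "\<forall>i\<ge>k. coeff a i = 0" "[:monom 1 k:] - [:a:] \<in> M" by (auto simp: V_def)
        then have "monom 1 k - a = 0" using none by (metis x_poly_hom(3))
        then have "coeff (monom 1 k - a) k = 0" by simp
        then show False using a(1) by simp
      qed
      moreover have "V k \<subseteq> V (Suc k)" unfolding V_def using Suc_leD by blast
      ultimately show "V k \<subset> V (Suc k)" by blast
    qed
  qed
  have I: "is_ideal {b. [:b:] \<in> M}"
    unfolding is_ideal_def
  proof (intro conjI allI ballI)
    show "0 \<in> {b. [:b:] \<in> M}" using MI(1) by simp
    fix P Q A assume P: "P \<in> {b. [:b:] \<in> M}"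
    then show "A * P \<in> {b. [:b:] \<in> M}" using MI(3)[of "[:P:]" "[:A:]"] by (simp add: mult.commute)
    assume "Q \<in> {b. [:b:] \<in> M}"
    with P show "P + Q \<in> {b. [:b:] \<in> M}" using MI(2)[of "[:P:]" "[:Q:]"] by simp
  qed
  from poly_ideal_principal[OF I] nz obtain p where p: "[:p:] \<in> M" "p \<noteq> 0" "\<forall>b. [:b:] \<in> M \<longrightarrow> p dvd b"
    by blast
  have "degree p > 0"
  proof (rule ccontr)
    assume "\<not> 0 < degree p"
    then have "is_unit p" using p(2) by (simp add: is_unit_iff_degree)
    then obtain k where "1 = p * k" by (auto simp: dvd_def)
    then have "1 = [:k:] * [:p:]" by (metis mult.commute one_pCons x_poly_hom(2))
    then show False using MI(3)[OF p(1)] MD(4) by metis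
  qed
  with p show ?thesis by blast
qed

text \<open>
  A closed point of the plane is given by two equations \<open>p(x) = 0\<close> and \<open>q(x,y) = 0\<close> with \<open>q\<close> monic in
  \<open>y\<close>. Here \<open>p\<close> generates the part of \<open>M\<close> in \<open>K[x]\<close>, and \<open>q\<close> is monic of least degree: a remainder
  modulo \<open>q\<close> whose leading coefficient is prime to \<open>p\<close> could be made monic modulo \<open>p\<close>.
\<close>
lemma maximal_ideal_generators:
  assumes M: "M \<in> maximal_ideals C"
  shows "\<exists>p q. [:p:] \<in> M \<and> q \<in> M \<and> degree p > 0 \<and> lead_coeff q = 1 \<and> degree q > 0 \<and>
    (\<forall>P\<in>M. \<exists>A B. P = A * [:p:] + B * q)"
proof -
  note MD = maximal_idealsD[OF M] and MI = is_idealD[OF maximal_idealsD(1)[OF M]]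
  obtain p where p: "[:p:] \<in> M" "p \<noteq> 0" "degree p > 0" "\<And>b. [:b:] \<in> M \<Longrightarrow> p dvd b"
    using maximal_ideal_x_poly[OF M] by blast
  define Q where "Q k = (\<exists>q\<in>M. lead_coeff q = 1 \<and> degree q = k)" for k
  have "\<exists>k. Q k" unfolding Q_def using MD(7) lead_coeff_curve_poly by blast
  then obtain k where k: "Q k" "\<And>j. j < k \<Longrightarrow> \<not> Q j" using exists_least_iff[of Q] by blast
  then obtain q where q: "q \<in> M" "lead_coeff q = 1" "degree q = k" by (auto simp: Q_def)
  have k0: "k > 0"
  proof (rule ccontr)
    assume "\<not> k > 0"
    then have "q = 1" using q(2,3) by (metis degree_0_id gr0I lead_coeff_pCons(2) degree_eq_zeroE one_pCons pCons_0_0 coeff_pCons_0)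
    then show False using q(1) MD(4) by simp
  qed
  have small: "\<exists>A. r = A * [:p:]" if "r \<in> M" "r = 0 \<or> degree r < k" for r
    using that
  proof (induction "if r = 0 then 0 else Suc (degree r)" arbitrary: r rule: less_induct)
    case less
    show ?case
    proof (cases "r = 0")
      case True
      then have "r = 0 * [:p:]" by simp
      then show ?thesis by blast
    next
      case False
      define a n where "a = lead_coeff r" and "n = degree r"
      have n: "n < k" using less.prems(2) False by (simp add: n_def)
      show ?thesis
      proof (cases "p dvd a")
        case True
        then obtain d where d: "a = p * d" by (auto simp: dvd_def)
        define r' where "r' = r - monom d n * [:p:]"
        have r'M: "r' \<in> M" unfolding r'_def by (intro MI(6) MI(3) less.prems(1) p(1))
        have c: "coeff r' i = 0" if "i \<ge> n" for i
          using that d by (cases "i = n") (auto simp: r'_def a_def n_def coeff_eq_0)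
        have "r' = 0 \<or> degree r' < n"
        proof (cases "r' = 0")
          case r0: False
          have "lead_coeff r' \<noteq> 0" using r0 by simp
          then show ?thesis using c[of "degree r'"] by (meson linorder_not_le)
        qed simp
        then have "\<exists>A. r' = A * [:p:]"
          using less.hyps[of r'] r'M n False by (auto simp: n_def)
        then obtain A where "r' = A * [:p:]" by blast
        then have "r = (A + monom d n) * [:p:]" by (simp add: r'_def algebra_simps)
        then show ?thesis by blast
      next
        case nd: False
        define I where "I = {s * a + t * p | s t. True}"
        have I: "is_ideal I"
          unfolding is_ideal_def
        proof (intro conjI allI ballI)
          have "0 = 0 * a + 0 * p" by simp
          then show "0 \<in> I" unfolding I_def by blast
          fix P Q A assume "P \<in> I"
          then obtain s t where st: "P = s * a + t * p" by (auto simp: I_def)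
          then have "A * P = (A * s) * a + (A * t) * p" by (simp add: algebra_simps)
          then show "A * P \<in> I" unfolding I_def by blast
          assume "Q \<in> I"
          then obtain s' t' where "Q = s' * a + t' * p" by (auto simp: I_def)
          then have "P + Q = (s + s') * a + (t + t') * p" using st by (simp add: algebra_simps)
          then show "P + Q \<in> I" unfolding I_def by blast
        qed
        have "a = 1 * a + 0 * p" "p = 0 * a + 1 * p" by simp_all
        then have apI: "a \<in> I" "p \<in> I" unfolding I_def by blast+
        then obtain g where g: "g \<in> I" "g \<noteq> 0" "g dvd a" "g dvd p"
          using poly_ideal_principal[OF I] p(2) by blast
        \<comment> \<open>The common divisor \<open>g\<close> of \<open>a\<close> and \<open>p\<close> is a unit, because \<open>p\<close> is prime and does not divide \<open>a\<close>.\<close>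
        obtain h where h: "p = g * h" using g(4) by (rule dvdE)
        have "[:g:] \<notin> M"
        proof
          assume "[:g:] \<in> M"
          then have "p dvd a" using p(4) g(3) dvd_trans by blast
          then show False using nd by simp
        qed
        moreover have "[:g:] * [:h:] \<in> M" using p(1) h by (simp add: mult.commute)
        ultimately have "[:h:] \<in> M" using MD(6) by blast
        then obtain w where "h = p * w" using p(4) by (meson dvdE)
        then have "p = p * (g * w)" using h by (simp add: algebra_simps)
        then have gw: "g * w = 1" using p(2) by simp
        then have "1 \<in> I" using is_idealD(4)[OF I g(1), of w] by simp
        then obtain s t where st: "1 = s * a + t * p" by (auto simp: I_def)
        define r' where "r' = [:s:] * r + monom t n * [:p:]"
        have r'M: "r' \<in> M" unfolding r'_def by (intro MI(2) MI(3) less.prems(1) p(1))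
        have c: "coeff r' i = (if i = n then 1 else 0)" if "i \<ge> n" for i
          using that st by (auto simp: r'_def a_def n_def coeff_eq_0 mult.commute)
        have "degree r' \<le> n" using c by (intro degree_le) auto
        moreover have "n \<le> degree r'" using c[of n] by (intro le_degree) simp
        ultimately have "degree r' = n" by simp
        then have "Q n" using r'M c[of n] by (auto simp: Q_def)
        then show ?thesis using k(2)[OF n] by simp
      qed
    qed
  qed
  have "\<exists>A B. P = A * [:p:] + B * q" if P: "P \<in> M" for P
  proof -
    obtain d r where dr: "pseudo_divmod P q = (d, r)" by (cases "pseudo_divmod P q")
    have "q \<noteq> 0" using q(2) by auto
    from pseudo_divmod[OF this dr] have 1: "P = q * d + r" "r = 0 \<or> degree r < k"
      using q(2,3) by simp_all
    have "r = P - d * q" using 1(1) by (simp add: algebra_simps)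
    then have "r \<in> M" using MI(6)[OF P MI(3)[OF q(1)]] by metis
    then obtain A where "r = A * [:p:]" using small 1(2) by blast
    then have "P = A * [:p:] + d * q" using 1(1) by (simp add: algebra_simps)
    then show ?thesis by blast
  qed
  with p q k0 show ?thesis by blast
qed

lemma is_ring_hom_to_ac: "is_ring_hom to_ac"
  by (simp add: is_ring_hom_def)

lemma eval2_eq: "eval2 P u v = eval_hom to_ac u v P"
  by (simp add: eval2_def eval_hom_def)

lemma map_poly_pderiv_add: "map_poly pderiv (P + Q) = map_poly pderiv P + map_poly pderiv Q"
  for P Q :: "'a::field poly poly"
  by (rule poly_eqI) (simp add: coeff_map_poly pderiv_add)

lemma map_poly_pderiv_mult:
  "map_poly pderiv (P * Q) = map_poly pderiv P * Q + P * map_poly pderiv Q"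
  for P Q :: "'a::field poly poly"
proof -
  have smult: "map_poly pderiv (smult a Q) = smult (pderiv a) Q + smult a (map_poly pderiv Q)" for a and Q :: "'a poly poly"
    by (rule poly_eqI) (simp add: coeff_map_poly pderiv_mult)
  show ?thesis
    by (induction P) (simp_all add: map_poly_pCons map_poly_pderiv_add smult mult_pCons_left algebra_simps)
qed

text \<open>
  Jacobian criterion. Write the curve equation as \<open>A p + B q\<close> in the two generators of \<open>M\<close>. If \<open>A\<close> is not
  in \<open>M\<close>, it is invertible at \<open>M\<close> and \<open>p\<close> becomes a multiple of \<open>q\<close>; similarly for \<open>B\<close>. If both are in
  \<open>M\<close>, then the equation and its partial derivatives vanish at the geometric points over \<open>M\<close>, against
  smoothness.
\<close>
lemma maximal_ideal_locally_principal:
  assumes C: "c34_curve C" and M: "M \<in> maximal_ideals C"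
  shows "\<exists>u\<in>M. \<forall>a\<in>M. locally_divisible (curve_poly C) M u a"
proof -
  note MI = is_idealD[OF maximal_idealsD(1)[OF M]]
  obtain p q where pq: "[:p:] \<in> M" "q \<in> M" "degree p > 0" "lead_coeff q = 1" "degree q > 0"
    and gen: "\<And>P. P \<in> M \<Longrightarrow> \<exists>A B. P = A * [:p:] + B * q"
    using maximal_ideal_generators[OF M] by blast
  obtain A B where E: "curve_poly C = A * [:p:] + B * q" using gen maximal_idealsD(7)[OF M] by blast
  have "A \<notin> M \<or> B \<notin> M"
  proof (rule ccontr)
    assume "\<not> (A \<notin> M \<or> B \<notin> M)"
    then have AB: "A \<in> M" "B \<in> M" by auto
    \<comment> \<open>A geometric point over \<open>M\<close>: a root of \<open>p\<close>, then a root of \<open>q\<close> at that abscissa.\<close>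
    have "degree (map_poly to_ac p) > 0" using pq(3) by (simp add: degree_map_poly)
    then obtain u where u: "poly (map_poly to_ac p) u = 0" using alg_closed_imp_poly_has_root by blast
    define q' where "q' = map_poly (\<lambda>a. poly (map_poly to_ac a) u) q"
    have "coeff q' (degree q) = 1" using pq(4) by (simp add: q'_def coeff_map_poly)
    then have "degree q' > 0" using le_degree[of q' "degree q"] pq(5) by simp
    then obtain v where v: "poly q' v = 0" using alg_closed_imp_poly_has_root by blast
    note ev = is_ring_homD[OF is_ring_hom_eval_hom[OF is_ring_hom_to_ac]]
    have "eval_hom to_ac u v [:p:] = 0" using u by (simp add: eval_hom_def map_poly_pCons)
    moreover have "eval_hom to_ac u v q = 0" using v by (simp add: eval_hom_def q'_def)
    ultimately have zero: "eval_hom to_ac u v P = 0" if "P \<in> M" for P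
    proof -
      from gen[OF that] obtain A' B' where "P = A' * [:p:] + B' * q" by blast
      then have "eval_hom to_ac u v P = eval_hom to_ac u v A' * eval_hom to_ac u v [:p:]
          + eval_hom to_ac u v B' * eval_hom to_ac u v q" by (simp only: ev(3,4))
      then show ?thesis using \<open>eval_hom to_ac u v [:p:] = 0\<close> \<open>eval_hom to_ac u v q = 0\<close> by simp
    qed
    have "eval2 (curve_poly C) u v = 0" using zero maximal_idealsD(7)[OF M] by (simp add: eval2_eq)
    moreover have "eval2 (map_poly pderiv (curve_poly C)) u v = 0"
      unfolding eval2_eq E map_poly_pderiv_add map_poly_pderiv_mult ev(3,4) using zero AB pq(1,2) by simp
    moreover have "eval2 (pderiv (curve_poly C)) u v = 0"
      unfolding eval2_eq E pderiv_add pderiv_mult ev(3,4) using zero AB pq(1,2) by simp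
    ultimately show False using C unfolding c34_curve_def smooth_plane_curve_def by blast
  qed
  then show ?thesis
  proof
    assume A: "A \<notin> M"
    have "locally_divisible (curve_poly C) M q a" if a: "a \<in> M" for a
    proof -
      obtain A' B' where "a = A' * [:p:] + B' * q" using gen a by blast
      then have "A * a - q * (A * B' - A' * B) = A' * curve_poly C"
        unfolding E by (simp only: ring_distribs mult_ac) (simp add: algebra_simps)
      then have "curve_poly C dvd A * a - q * (A * B' - A' * B)" by (metis dvd_triv_right)
      then show ?thesis using A unfolding locally_divisible_def by blast
    qed
    then show ?thesis using pq(2) by blast
  next
    assume B: "B \<notin> M"
    have "locally_divisible (curve_poly C) M [:p:] a" if a: "a \<in> M" for a
    proof -
      obtain A' B' where "a = A' * [:p:] + B' * q" using gen a by blast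
      then have "B * a - [:p:] * (B * A' - B' * A) = B' * curve_poly C"
        unfolding E by (simp only: ring_distribs mult_ac) (simp add: algebra_simps)
      then have "curve_poly C dvd B * a - [:p:] * (B * A' - B' * A)" by (metis dvd_triv_right)
      then show ?thesis using B unfolding locally_divisible_def by blast
    qed
    then show ?thesis using pq(1) by blast
  qed
qed

section \<open>Valuations at the affine points\<close>

locale smooth_c34 =
  fixes C :: "'a::field c34"
  assumes smooth: "c34_curve C"
begin

abbreviation "E \<equiv> curve_poly C"
abbreviation "\<M> \<equiv> maximal_ideals C"

definition uniformizer :: "'a poly poly set \<Rightarrow> 'a poly poly" where
  "uniformizer M = (SOME u. u \<in> M \<and> (\<forall>a\<in>M. locally_divisible E M u a))"

definition val :: "'a poly poly set \<Rightarrow> 'a poly poly \<Rightarrow> nat" where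
  "val M P = vanishing_order (R C) (cls C ` M) (cls C P)"

lemma locally_divisible_iff:
  "locally_divisible E M Q P \<longleftrightarrow> (\<exists>b c. b \<notin> M \<and> laurent C b * laurent C P = laurent C Q * laurent C c)"
proof -
  have "E dvd b * P - Q * c \<longleftrightarrow> laurent C b * laurent C P = laurent C Q * laurent C c" for b c
    using laurent_eq_iff[of C "b * P" "Q * c"] by (simp add: laurent_hom)
  then show ?thesis by (simp add: locally_divisible_def)
qed

lemma uniformizer:
  assumes "M \<in> \<M>"
  shows "uniformizer M \<in> M" "a \<in> M \<Longrightarrow> locally_divisible E M (uniformizer M) a"
    "laurent C (uniformizer M) \<noteq> 0"
proof -
  have "\<exists>u. u \<in> M \<and> (\<forall>a\<in>M. locally_divisible E M u a)"
    using maximal_ideal_locally_principal[OF smooth assms] by blast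
  from someI_ex[OF this, folded uniformizer_def]
  show *: "uniformizer M \<in> M" "a \<in> M \<Longrightarrow> locally_divisible E M (uniformizer M) a" for a by auto
  obtain f where f: "f \<in> M" "laurent C f \<noteq> 0" using maximal_ideal_nonzero[OF assms] by blast
  obtain b c where "b \<notin> M" "laurent C b * laurent C f = laurent C (uniformizer M) * laurent C c"
    using *(2)[OF f(1)] by (auto simp: locally_divisible_iff)
  moreover have "laurent C b \<noteq> 0" if "b \<notin> M" for b
    using that is_spaceD(1)[OF maximal_idealsD(3)[OF assms]] by blast
  ultimately show "laurent C (uniformizer M) \<noteq> 0" using f(2) by auto
qed

lemma mem_M_cong:
  assumes "M \<in> \<M>" "laurent C P = laurent C Q"
  shows "P \<in> M \<longleftrightarrow> Q \<in> M"
  using laurent_cong_mem[OF maximal_idealsD(3)[OF assms(1)]] assms(2) by metis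

lemma mult_mem_M_iff:
  assumes "M \<in> \<M>"
  shows "a * b \<in> M \<longleftrightarrow> a \<in> M \<or> b \<in> M"
  using maximal_idealsD(1,6)[OF assms] by (auto intro: is_idealD)

lemma notin_M_nonzero:
  assumes "M \<in> \<M>" "b \<notin> M"
  shows "laurent C b \<noteq> 0"
  using assms is_spaceD(1)[OF maximal_idealsD(3)[OF assms(1)]] by blast

text \<open>
  Up to units of the local ring, \<open>P\<close> is the \<open>k\<close>-th power of the uniformizer.
\<close>
definition local_form :: "'a poly poly set \<Rightarrow> 'a poly poly \<Rightarrow> nat \<Rightarrow> bool" where
  "local_form M P k \<longleftrightarrow>
     (\<exists>b c. b \<notin> M \<and> c \<notin> M \<and> laurent C b * laurent C P = laurent C (uniformizer M) ^ k * laurent C c)"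

lemma locally_divisible_power_iff:
  assumes M: "M \<in> \<M>" and P: "local_form M P k"
  shows "locally_divisible E M (uniformizer M ^ n) P \<longleftrightarrow> n \<le> k"
proof
  obtain b c where bc: "b \<notin> M" "c \<notin> M" "laurent C b * laurent C P = laurent C (uniformizer M) ^ k * laurent C c"
    using P by (auto simp: local_form_def)
  define u where "u = laurent C (uniformizer M)"
  have u: "u \<noteq> 0" unfolding u_def using uniformizer(3)[OF M] .
  {
    assume "locally_divisible E M (uniformizer M ^ n) P"
    then obtain b' c' where bc': "b' \<notin> M" "laurent C b' * laurent C P = u ^ n * laurent C c'"
      by (auto simp: locally_divisible_iff laurent_hom u_def)
    show "n \<le> k"
    proof (rule ccontr)
      assume "\<not> n \<le> k"
      then obtain j where j: "n = k + Suc j" by (metis add_Suc_right less_imp_Suc_add not_le)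
      have "u ^ k * (laurent C b' * laurent C c) = laurent C b' * (laurent C b * laurent C P)"
        using bc(3) by (simp add: u_def)
      also have "\<dots> = laurent C b * (laurent C b' * laurent C P)" by simp
      also have "\<dots> = u ^ k * (u * (u ^ j * laurent C b * laurent C c'))"
        unfolding bc'(2) j by (simp add: power_add)
      finally have "laurent C b' * laurent C c = u * (u ^ j * laurent C b * laurent C c')" using u by simp
      then have "laurent C (b' * c) = laurent C (uniformizer M * (uniformizer M ^ j * b * c'))"
        by (simp add: laurent_hom u_def)
      then have "b' * c \<in> M"
        using mem_M_cong[OF M] mult_mem_M_iff[OF M] uniformizer(1)[OF M] by metis
      then show False using bc(2) bc'(1) mult_mem_M_iff[OF M] by blast
    qed
  next
    assume "n \<le> k"
    then have "u ^ k = u ^ n * u ^ (k - n)" by (simp flip: power_add)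
    then have "laurent C b * laurent C P = laurent C (uniformizer M ^ n) * laurent C (uniformizer M ^ (k - n) * c)"
      using bc(3) by (simp add: laurent_hom u_def mult.assoc)
    then show "locally_divisible E M (uniformizer M ^ n) P"
      using bc(1) unfolding locally_divisible_iff by blast
  }
qed

lemma locally_divisible_ideal:
  assumes M: "M \<in> \<M>"
  shows "is_ideal_on C {P. locally_divisible E M Q P}"
  unfolding is_ideal_on_def is_ideal_def
proof (intro conjI allI ballI impI)
  have one: "1 \<notin> M" using maximal_idealsD(4)[OF M] .
  fix P assume "laurent C P = 0"
  then have "laurent C 1 * laurent C P = laurent C Q * laurent C 0" by (simp add: laurent_hom)
  then show "P \<in> {P. locally_divisible E M Q P}" using one unfolding locally_divisible_iff by blast
next
  have one: "1 \<notin> M" using maximal_idealsD(4)[OF M] .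
  have "laurent C 1 * laurent C 0 = laurent C Q * laurent C 0" by (simp add: laurent_hom)
  then show "0 \<in> {P. locally_divisible E M Q P}" using one unfolding locally_divisible_iff by blast
next
  fix P P' A assume "P \<in> {P. locally_divisible E M Q P}"
  then obtain b c where bc: "b \<notin> M" "laurent C b * laurent C P = laurent C Q * laurent C c"
    by (auto simp: locally_divisible_iff)
  have "laurent C b * laurent C (A * P) = laurent C Q * laurent C (A * c)"
    using bc(2) by (simp add: laurent_hom)
  then show "A * P \<in> {P. locally_divisible E M Q P}" using bc(1) unfolding locally_divisible_iff by blast
  assume "P' \<in> {P. locally_divisible E M Q P}"
  then obtain b' c' where bc': "b' \<notin> M" "laurent C b' * laurent C P' = laurent C Q * laurent C c'"
    by (auto simp: locally_divisible_iff)
  have "laurent C (b * b') * laurent C (P + P')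
     = laurent C b' * (laurent C b * laurent C P) + laurent C b * (laurent C b' * laurent C P')"
    by (simp add: laurent_hom algebra_simps)
  also have "\<dots> = laurent C Q * laurent C (b' * c + b * c')"
    unfolding bc bc' by (simp add: laurent_hom algebra_simps)
  finally show "P + P' \<in> {P. locally_divisible E M Q P}"
    using mult_mem_M_iff[OF M] bc(1) bc'(1) unfolding locally_divisible_iff by blast
qed

lemma local_form_uniformizer_power:
  assumes M: "M \<in> \<M>"
  shows "local_form M (uniformizer M ^ k) k"
  unfolding local_form_def using maximal_idealsD(4)[OF M]
  by (intro exI[of _ 1]) (simp add: laurent_hom)

text \<open>
  Otherwise \<open>P\<close> would lie in all powers of the maximal ideal. These decrease strictly, as the powers of
  the uniformizer show, while they all contain the ideal generated by \<open>P\<close>, of finite codimension.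
\<close>
lemma local_form_exists:
  assumes M: "M \<in> \<M>" and P: "laurent C P \<noteq> 0"
  shows "\<exists>k. local_form M P k"
proof -
  define V where "V k = {P. locally_divisible E M (uniformizer M ^ k) P}" for k
  have V: "is_ideal_on C (V k)" for k unfolding V_def by (rule locally_divisible_ideal[OF M])
  define J where "J = {A. \<exists>B. laurent C A = laurent C (B * P)}"
  have J: "is_ideal_on C J"
    unfolding is_ideal_on_def is_ideal_def
  proof (intro conjI allI ballI impI)
    have 0: "laurent C A = 0 \<Longrightarrow> A \<in> J" for A
      unfolding J_def by (intro CollectI exI[of _ 0]) (simp add: laurent_hom)
    then show "laurent C A = 0 \<Longrightarrow> A \<in> J" for A .
    show "0 \<in> J" using 0 by (simp add: laurent_hom)
    fix A A' D assume "A \<in> J"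
    then obtain B where B: "laurent C A = laurent C (B * P)" by (auto simp: J_def)
    then have "laurent C (D * A) = laurent C ((D * B) * P)" by (simp add: laurent_hom)
    then show "D * A \<in> J" unfolding J_def by blast
    assume "A' \<in> J"
    then obtain B' where "laurent C A' = laurent C (B' * P)" by (auto simp: J_def)
    with B have "laurent C (A + A') = laurent C ((B + B') * P)" by (simp add: laurent_hom algebra_simps)
    then show "A + A' \<in> J" unfolding J_def by blast
  qed
  have "laurent C P = laurent C (1 * P)" by simp
  then have PJ: "P \<in> J" unfolding J_def by blast
  have "\<exists>k. P \<notin> V k"
  proof (rule ccontr)
    assume all: "\<not> (\<exists>k. P \<notin> V k)"
    show False
    proof (rule no_infinite_descent[OF cofinite_ideal[OF J PJ P], of V])
      fix k
      show "is_space C (V k)" by (rule is_space_ideal[OF V])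
      show "J \<subseteq> V k"
      proof
        fix A assume "A \<in> J"
        then obtain B where B: "laurent C A = laurent C (B * P)" by (auto simp: J_def)
        have "B * P \<in> V k" using V[of k] all by (auto simp: is_ideal_on_def intro: is_idealD)
        then show "A \<in> V k" using laurent_cong_mem[OF is_space_ideal[OF V] B] by blast
      qed
      have "V (Suc k) \<subseteq> V k"
      proof
        fix Q assume "Q \<in> V (Suc k)"
        then obtain b c where bc: "b \<notin> M" "laurent C b * laurent C Q = laurent C (uniformizer M ^ Suc k) * laurent C c"
          by (auto simp: V_def locally_divisible_iff)
        then have "laurent C b * laurent C Q = laurent C (uniformizer M ^ k) * laurent C (uniformizer M * c)"
          by (simp add: laurent_hom algebra_simps)
        then show "Q \<in> V k" using bc(1) unfolding V_def locally_divisible_iff by blast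
      qed
      moreover have "uniformizer M ^ k \<in> V k" "uniformizer M ^ k \<notin> V (Suc k)"
        unfolding V_def mem_Collect_eq locally_divisible_power_iff[OF M local_form_uniformizer_power[OF M]]
        by simp_all
      ultimately show "V (Suc k) \<subset> V k" by blast
    qed
  qed
  then obtain k where k: "P \<notin> V k" "\<And>j. j < k \<Longrightarrow> P \<in> V j" using exists_least_iff[of "\<lambda>k. P \<notin> V k"] by blast
  have "P \<in> V 0"
    unfolding V_def locally_divisible_iff using maximal_idealsD(4)[OF M]
    by (intro CollectI exI[of _ 1] exI[of _ P]) (simp add: laurent_hom)
  then obtain j where j: "k = Suc j" using k(1) by (cases k) auto
  obtain b c where bc: "b \<notin> M" "laurent C b * laurent C P = laurent C (uniformizer M) ^ j * laurent C c"
    using k(2)[of j] j by (auto simp: V_def locally_divisible_iff laurent_hom)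
  have "c \<notin> M"
  proof
    assume "c \<in> M"
    then obtain b' c' where bc': "b' \<notin> M" "laurent C b' * laurent C c = laurent C (uniformizer M) * laurent C c'"
      using uniformizer(2)[OF M \<open>c \<in> M\<close>] by (auto simp: locally_divisible_iff)
    have "laurent C (b' * b) * laurent C P = laurent C (uniformizer M) ^ j * (laurent C b' * laurent C c)"
      using bc(2) by (simp add: laurent_hom algebra_simps)
    also have "\<dots> = laurent C (uniformizer M ^ k) * laurent C c'"
      unfolding bc' j by (simp add: laurent_hom algebra_simps)
    finally have "P \<in> V k"
      unfolding V_def locally_divisible_iff using mult_mem_M_iff[OF M] bc(1) bc'(1) by blast
    then show False using k(1) by simp
  qed
  then show ?thesis using bc by (auto simp: local_form_def)
qed

lemma val_eqI:
  assumes M: "M \<in> \<M>" and P: "local_form M P k"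
  shows "val M P = k"
  unfolding val_def
proof (rule vanishing_order_eqI)
  fix n
  note MD = maximal_idealsD[OF M]
  have pre: "preimage E (cls C ` M) = M" by (rule preimage_image[OF MD(1,7)])
  show "cls C P \<in> (cls C ` M) [^]\<^bsub>ideals_set (R C)\<^esub> n \<longleftrightarrow> n \<le> k"
    using ideal_pow_iff[OF ideal_image_residue_class[OF MD(1), of E], unfolded pre, of "uniformizer M" P n]
      uniformizer[OF M] M locally_divisible_power_iff[OF M P, of n] by (simp add: maximal_ideals_def)
qed

lemma local_form_val:
  assumes "M \<in> \<M>" "laurent C P \<noteq> 0"
  shows "local_form M P (val M P)"
  using local_form_exists[OF assms] val_eqI[OF assms(1)] by auto

lemma locally_divisible_val:
  assumes "M \<in> \<M>" "laurent C P \<noteq> 0"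
  shows "locally_divisible E M (uniformizer M ^ n) P \<longleftrightarrow> n \<le> val M P"
  using locally_divisible_power_iff[OF assms(1) local_form_val[OF assms]] .

lemma val_mult:
  assumes M: "M \<in> \<M>" and P: "laurent C P \<noteq> 0" and Q: "laurent C Q \<noteq> 0"
  shows "val M (P * Q) = val M P + val M Q"
proof (rule val_eqI[OF M])
  obtain b c where bc: "b \<notin> M" "c \<notin> M" "laurent C b * laurent C P = laurent C (uniformizer M) ^ val M P * laurent C c"
    using local_form_val[OF M P] by (auto simp: local_form_def)
  obtain b' c' where bc': "b' \<notin> M" "c' \<notin> M" "laurent C b' * laurent C Q = laurent C (uniformizer M) ^ val M Q * laurent C c'"
    using local_form_val[OF M Q] by (auto simp: local_form_def)
  have "laurent C (b * b') * laurent C (P * Q) = (laurent C b * laurent C P) * (laurent C b' * laurent C Q)"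
    by (simp add: laurent_hom)
  also have "\<dots> = laurent C (uniformizer M) ^ (val M P + val M Q) * laurent C (c * c')"
    unfolding bc(3) bc'(3) by (simp add: laurent_hom power_add)
  finally show "local_form M (P * Q) (val M P + val M Q)"
    unfolding local_form_def using mult_mem_M_iff[OF M] bc(1,2) bc'(1,2) by blast
qed

lemma val_pos_iff:
  assumes M: "M \<in> \<M>" and P: "laurent C P \<noteq> 0"
  shows "0 < val M P \<longleftrightarrow> P \<in> M"
proof -
  have "0 < val M P \<longleftrightarrow> locally_divisible E M (uniformizer M) P"
    using locally_divisible_val[OF M P, of 1] by auto
  also have "\<dots> \<longleftrightarrow> P \<in> M"
  proof
    assume "locally_divisible E M (uniformizer M) P"
    then obtain b c where bc: "b \<notin> M" "laurent C (b * P) = laurent C (uniformizer M * c)"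
      by (auto simp: locally_divisible_iff laurent_hom)
    have "uniformizer M * c \<in> M" using mult_mem_M_iff[OF M] uniformizer(1)[OF M] by blast
    then show "P \<in> M" using mem_M_cong[OF M bc(2)] mult_mem_M_iff[OF M] bc(1) by blast
  qed (rule uniformizer(2)[OF M])
  finally show ?thesis .
qed

lemma val_cong: "laurent C P = laurent C Q \<Longrightarrow> val M P = val M Q"
  using cls_eq_iff[of C P Q] by (simp add: val_def)

lemma val_power:
  assumes "M \<in> \<M>" "laurent C P \<noteq> 0"
  shows "val M (P ^ n) = n * val M P"
proof (induction n)
  case 0
  have "local_form M 1 0"
    unfolding local_form_def using maximal_idealsD(4)[OF assms(1)]
    by (intro exI[of _ 1]) (simp add: laurent_hom)
  then show ?case using val_eqI[OF assms(1)] by simp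
next
  case (Suc n)
  then show ?case using val_mult[OF assms(1), of P "P ^ n"] assms(2) by (simp add: laurent_hom)
qed

definition order_ideal :: "('a poly poly set \<Rightarrow> nat) \<Rightarrow> 'a poly poly set" where
  "order_ideal e = {P. laurent C P = 0 \<or> (\<forall>M\<in>\<M>. e M \<le> val M P)}"

lemma order_ideal_eq: "order_ideal e = {P. \<forall>M\<in>\<M>. locally_divisible E M (uniformizer M ^ e M) P}"
proof -
  have "P \<in> order_ideal e \<longleftrightarrow> (\<forall>M\<in>\<M>. locally_divisible E M (uniformizer M ^ e M) P)" for P
  proof (cases "laurent C P = 0")
    case True
    then show ?thesis using locally_divisible_ideal by (auto simp: order_ideal_def is_ideal_on_def)
  next
    case False
    then show ?thesis by (simp add: order_ideal_def locally_divisible_val)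
  qed
  then show ?thesis by blast
qed

lemma is_ideal_on_order_ideal: "is_ideal_on C (order_ideal e)"
  using locally_divisible_ideal unfolding order_ideal_eq is_ideal_on_def is_ideal_def by blast

lemma not_subset_maximal:
  assumes M: "M \<in> \<M>" and M': "M' \<in> \<M>" and ne: "M \<noteq> M'"
  shows "\<exists>a. a \<in> M' \<and> a \<notin> M"
proof (rule ccontr)
  assume "\<not> ?thesis"
  then have sub: "M' \<subseteq> M" by blast
  then obtain b where b: "b \<in> M" "b \<notin> M'" using ne by blast
  then obtain r where "1 - r * b \<in> M'" using maximal_idealsD(5)[OF M'] by blast
  then have "(1 - r * b) + r * b \<in> M" using sub b(1) is_idealD(2,3)[OF maximal_idealsD(1)[OF M]] by blast
  then show False using maximal_idealsD(4)[OF M] by simp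
qed

lemma prod_notin_maximal:
  assumes M: "M \<in> \<M>" and S: "finite S" "\<And>x. x \<in> S \<Longrightarrow> f x \<notin> M"
  shows "prod f S \<notin> M"
  using S
proof (induction S rule: finite_induct)
  case empty
  then show ?case using maximal_idealsD(4)[OF M] by simp
next
  case (insert x S)
  then show ?case using mult_mem_M_iff[OF M] by simp
qed

lemma prod_in_maximal:
  assumes M: "M \<in> \<M>" and S: "finite S" "x \<in> S" "f x \<in> M"
  shows "prod f S \<in> M"
  using S mult_mem_M_iff[OF M] by (simp add: prod.remove)

text \<open>
  Infinitely many zeros \<open>m\<^sub>0, m\<^sub>1, \<dots>\<close> would give the descending chain of the \<open>m\<^sub>0 \<inter> \<dots> \<inter> m\<^sub>k\<close> above the
  ideal generated by \<open>P\<close>; it is strict, because distinct maximal ideals do not contain each other.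
\<close>
lemma finite_zeros:
  assumes P: "laurent C P \<noteq> 0"
  shows "finite {M \<in> \<M>. P \<in> M}"
proof (rule ccontr)
  assume "infinite {M \<in> \<M>. P \<in> M}"
  then obtain m :: "nat \<Rightarrow> 'a poly poly set" where m: "inj m" "range m \<subseteq> {M \<in> \<M>. P \<in> M}"
    using infinite_countable_subset by blast
  define V where "V k = {Q. \<forall>i<k. Q \<in> m i}" for k
  have mM: "m i \<in> \<M>" "P \<in> m i" for i using m(2) by auto
  have V: "is_ideal_on C (V k)" for k
    using maximal_idealsD(2)[OF mM(1)] unfolding V_def is_ideal_on_def is_ideal_def by blast
  define J where "J = {Q. \<forall>i. Q \<in> m i}"
  have J: "is_ideal_on C J"
    using maximal_idealsD(2)[OF mM(1)] unfolding J_def is_ideal_on_def is_ideal_def by blast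
  have PJ: "P \<in> J" using mM(2) by (simp add: J_def)
  show False
  proof (rule no_infinite_descent[OF cofinite_ideal[OF J PJ P], of V])
    fix k
    show "is_space C (V k)" by (rule is_space_ideal[OF V])
    show "J \<subseteq> V k" by (auto simp: J_def V_def)
    have "\<exists>a. a \<in> m i \<and> a \<notin> m k" if "i < k" for i
      using not_subset_maximal[OF mM(1) mM(1), of k i] that m(1) by (metis injD less_irrefl)
    then obtain a where a: "\<And>i. i < k \<Longrightarrow> a i \<in> m i \<and> a i \<notin> m k" by metis
    have "prod a {..<k} \<in> V k" using prod_in_maximal[OF mM(1), of "{..<k}"] a by (auto simp: V_def)
    moreover have "prod a {..<k} \<notin> V (Suc k)" using prod_notin_maximal[OF mM(1), of "{..<k}" a k] a by (auto simp: V_def)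
    moreover have "V (Suc k) \<subseteq> V k" by (auto simp: V_def)
    ultimately show "V (Suc k) \<subset> V k" by blast
  qed
qed

text \<open>
  A power of the uniformizer at \<open>M\<close>, times powers of functions that vanish at the other points of
  \<open>e\<close> but not at \<open>M\<close>.
\<close>
lemma exact_order:
  assumes M: "M \<in> \<M>" and fin: "finite {M \<in> \<M>. e M \<noteq> 0}"
  shows "\<exists>f \<in> order_ideal e. laurent C f \<noteq> 0 \<and> val M f = e M"
proof -
  define S where "S = {M \<in> \<M>. e M \<noteq> 0} - {M}"
  have S: "finite S" "\<And>M'. M' \<in> S \<Longrightarrow> M' \<in> \<M> \<and> M \<noteq> M'" using fin by (auto simp: S_def)
  have "\<exists>a. a \<in> M' \<and> a \<notin> M" if "M' \<in> S" for M' using not_subset_maximal[OF M] S(2)[OF that] by blast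
  then obtain a where a: "\<And>M'. M' \<in> S \<Longrightarrow> a M' \<in> M' \<and> a M' \<notin> M" by metis
  define h where "h = (\<Prod>M'\<in>S. a M' ^ e M')"
  have powM: "a M' ^ e M' \<notin> M" if "M' \<in> S" for M'
    using a[OF that] maximal_over_power[of E M] M by (simp add: maximal_ideals_def)
  have hM: "h \<notin> M" unfolding h_def using powM by (intro prod_notin_maximal[OF M S(1)])
  note h0 = notin_M_nonzero[OF M hM]
  define f where "f = uniformizer M ^ e M * h"
  have u0: "laurent C (uniformizer M ^ e M) \<noteq> 0" using uniformizer(3)[OF M] by (simp add: laurent_hom)
  have f0: "laurent C f \<noteq> 0" using h0 u0 by (simp add: f_def laurent_hom(4))
  have "val M h = 0" using val_pos_iff[OF M h0] hM by simp
  moreover have "val M (uniformizer M ^ e M) = e M" by (rule val_eqI[OF M local_form_uniformizer_power[OF M]])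
  ultimately have valM: "val M f = e M" unfolding f_def using val_mult[OF M u0 h0] by simp
  have "e M' \<le> val M' f" if M': "M' \<in> \<M>" for M'
  proof (cases "M' \<in> S")
    case True
    have a0: "laurent C (a M') \<noteq> 0" using notin_M_nonzero[OF M] a[OF True] by blast
    have "h = a M' ^ e M' * (\<Prod>M''\<in>S - {M'}. a M'' ^ e M'')"
      unfolding h_def by (rule prod.remove[OF S(1) True])
    moreover from this have "laurent C (\<Prod>M''\<in>S - {M'}. a M'' ^ e M'') \<noteq> 0" using h0 by (auto simp: laurent_hom(4))
    ultimately have "e M' * val M' (a M') \<le> val M' h"
      using val_mult[OF M'] val_power[OF M' a0] a0 by (simp add: laurent_hom)
    moreover have "1 \<le> val M' (a M')" using val_pos_iff[OF M' a0] a[OF True] by simp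
    moreover have "val M' h \<le> val M' f" unfolding f_def using val_mult[OF M' u0 h0] by simp
    ultimately show ?thesis by (metis le_trans mult_le_mono2 mult.right_neutral)
  next
    case False
    then show ?thesis using valM M' by (auto simp: S_def)
  qed
  then have "f \<in> order_ideal e" by (simp add: order_ideal_def)
  then show ?thesis using f0 valM by blast
qed

lemma extends_scale:
  assumes "extends n U V" "is_space C U" and T: "is_space C T" and kernel: "\<And>a. a * f \<in> T \<Longrightarrow> a \<in> U"
  shows "extends n {a * f + w | a w. a \<in> U \<and> w \<in> T} {a * f + w | a w. a \<in> V \<and> w \<in> T}"
  using assms(1,2) kernel
proof (induction n U V rule: extends.induct)
  case (refl U)
  show ?case by (rule extends.refl)
next
  case (adjoin n U V e)
  note V = extends_pole_ords[OF adjoin.hyps(1) adjoin.prems(1)]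
  have notin: "e * f \<notin> {a * f + w | a w. a \<in> V \<and> w \<in> T}"
  proof
    assume "e * f \<in> {a * f + w | a w. a \<in> V \<and> w \<in> T}"
    then obtain a w where aw: "e * f = a * f + w" "a \<in> V" "w \<in> T" by blast
    then have "(e - a) * f \<in> T" by (simp add: algebra_simps)
    then have "e - a \<in> V" using adjoin.prems(2) V(2) by blast
    then have "e - a + a \<in> V" using is_spaceD(2)[OF V(1) _ aw(2)] by blast
    then show False using adjoin.hyps(2) by simp
  qed
  have eq: "adjoin {a * f + w | a w. a \<in> V \<and> w \<in> T} (e * f) = {a * f + w | a w. a \<in> adjoin V e \<and> w \<in> T}"
  proof (intro equalityI subsetI)
    fix x assume "x \<in> adjoin {a * f + w | a w. a \<in> V \<and> w \<in> T} (e * f)"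
    then obtain a w c where "a \<in> V" "w \<in> T" "x = (a * f + w) + Cst c * (e * f)" unfolding adjoin_def by blast
    moreover from this have "x = (a + Cst c * e) * f + w" by (simp add: algebra_simps)
    ultimately show "x \<in> {a * f + w | a w. a \<in> adjoin V e \<and> w \<in> T}" unfolding adjoin_def by blast
  next
    fix x assume "x \<in> {a * f + w | a w. a \<in> adjoin V e \<and> w \<in> T}"
    then obtain a w c where "a \<in> V" "w \<in> T" "x = (a + Cst c * e) * f + w" unfolding adjoin_def by blast
    moreover from this have "x = (a * f + w) + Cst c * (e * f)" by (simp add: algebra_simps)
    ultimately show "x \<in> adjoin {a * f + w | a w. a \<in> V \<and> w \<in> T} (e * f)" unfolding adjoin_def by blast
  qed
  have "extends n {a * f + w | a w. a \<in> U \<and> w \<in> T} {a * f + w | a w. a \<in> V \<and> w \<in> T}"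
    by (rule adjoin.IH[OF adjoin.prems(1)]) (rule adjoin.prems(2))
  from extends.adjoin[OF this notin] show ?case unfolding eq .
qed

text \<open>
  With \<open>f\<close> of exact order \<open>e M\<close> at \<open>M\<close>, multiplication by \<open>f\<close> induces an isomorphism of \<open>R / M\<close> with the
  quotient of the two ideals, which therefore has the dimension of the residue field.
\<close>
lemma extends_order_ideal_step:
  assumes M: "M \<in> \<M>" and fin: "finite {M \<in> \<M>. e M \<noteq> 0}" and n: "extends n M UNIV"
  shows "extends n (order_ideal (e(M := Suc (e M)))) (order_ideal e)"
proof -
  define T where "T = order_ideal (e(M := Suc (e M)))"
  define u where "u = laurent C (uniformizer M)"
  note T = is_ideal_on_order_ideal[of "e(M := Suc (e M))", folded T_def]
  note Ts = is_spaceD[OF is_space_ideal[OF T]]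
  note Es = is_spaceD[OF is_space_ideal[OF is_ideal_on_order_ideal[of e]]]
  obtain f where f: "f \<in> order_ideal e" "laurent C f \<noteq> 0" "val M f = e M" using exact_order[OF M fin] by blast
  have T_iff: "h \<in> T \<longleftrightarrow> h \<in> order_ideal e \<and> locally_divisible E M (uniformizer M ^ Suc (e M)) h" for h
  proof -
    have "locally_divisible E M (uniformizer M ^ e M) h" if "locally_divisible E M (uniformizer M ^ Suc (e M)) h"
    proof -
      from that obtain b c where bc: "b \<notin> M" "laurent C b * laurent C h = laurent C (uniformizer M ^ Suc (e M)) * laurent C c"
        by (auto simp: locally_divisible_iff)
      then have "laurent C b * laurent C h = laurent C (uniformizer M ^ e M) * laurent C (uniformizer M * c)"
        by (simp add: laurent_hom algebra_simps)
      then show ?thesis using bc(1) unfolding locally_divisible_iff by blast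
    qed
    then show ?thesis unfolding T_def order_ideal_eq using M by auto
  qed
  have TE: "T \<subseteq> order_ideal e" using T_iff by blast
  have idealE: "is_ideal (order_ideal e)" using is_ideal_on_order_ideal by (simp add: is_ideal_on_def)
  have af: "a * f \<in> T \<longleftrightarrow> a \<in> M" for a
  proof (cases "laurent C a = 0")
    case True
    then have "a \<in> M" using is_spaceD(1)[OF maximal_idealsD(3)[OF M]] by blast
    moreover have "a * f \<in> T" using True Ts(1) by (simp add: laurent_hom)
    ultimately show ?thesis by simp
  next
    case False
    have "a * f \<in> T \<longleftrightarrow> locally_divisible E M (uniformizer M ^ Suc (e M)) (a * f)"
      using T_iff is_idealD(3)[OF idealE f(1)] by blast
    also have "\<dots> \<longleftrightarrow> Suc (e M) \<le> val M (a * f)"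
      by (rule locally_divisible_val[OF M]) (simp add: False f(2) laurent_hom)
    also have "\<dots> \<longleftrightarrow> 0 < val M a" using val_mult[OF M False f(2)] f(3) by auto
    finally show ?thesis using val_pos_iff[OF M False] by simp
  qed
  obtain b c where bc: "b \<notin> M" "c \<notin> M" "laurent C b * laurent C f = u ^ e M * laurent C c"
    using local_form_val[OF M f(2)] f(3) by (auto simp: local_form_def u_def)
  have surj: "\<exists>a. h - a * f \<in> T" if h: "h \<in> order_ideal e" for h
  proof -
    have "locally_divisible E M (uniformizer M ^ e M) h" using h M unfolding order_ideal_eq by blast
    then obtain b' c' where bc': "b' \<notin> M" "laurent C b' * laurent C h = u ^ e M * laurent C c'"
      by (auto simp: locally_divisible_iff laurent_hom u_def)
    have "b' * c \<notin> M" using mult_mem_M_iff[OF M] bc' bc by blast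
    then obtain s where s: "1 - s * (b' * c) \<in> M" using maximal_idealsD(5)[OF M] by blast
    \<comment> \<open>The quotient of \<open>h\<close> by \<open>f\<close> in the residue field is \<open>b c' / (b' c)\<close>, and \<open>s\<close> inverts \<open>b' c\<close>.\<close>
    define a where "a = b * c' * s"
    define d where "d = b * c' - a * b' * c"
    have "d = (b * c') * (1 - s * (b' * c))" by (simp add: d_def a_def algebra_simps)
    then have "d \<in> M" using s is_idealD(3)[OF maximal_idealsD(1)[OF M]] by simp
    then obtain b'' c'' where bc'': "b'' \<notin> M" "laurent C b'' * laurent C d = u * laurent C c''"
      using uniformizer(2)[OF M \<open>d \<in> M\<close>] by (auto simp: locally_divisible_iff u_def)
    have "laurent C (b'' * (b * b')) * laurent C (h - a * f)
       = laurent C b'' * (laurent C b * (laurent C b' * laurent C h) - laurent C a * laurent C b' * (laurent C b * laurent C f))"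
      by (simp add: laurent_hom algebra_simps)
    also have "\<dots> = u ^ e M * (laurent C b'' * laurent C d)"
      unfolding bc(3) bc'(2) by (simp add: d_def laurent_hom algebra_simps)
    also have "\<dots> = laurent C (uniformizer M ^ Suc (e M)) * laurent C c''"
      unfolding bc''(2) by (simp add: laurent_hom u_def algebra_simps)
    finally have "locally_divisible E M (uniformizer M ^ Suc (e M)) (h - a * f)"
      unfolding locally_divisible_iff using mult_mem_M_iff[OF M] bc(1) bc'(1) bc''(1) by blast
    moreover have "h - a * f \<in> order_ideal e" using Es(4)[OF h is_idealD(3)[OF idealE f(1)]] .
    ultimately show ?thesis using T_iff by blast
  qed
  have "extends n {a * f + w | a w. a \<in> M \<and> w \<in> T} {a * f + w | a w. a \<in> UNIV \<and> w \<in> T}"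
    using extends_scale[OF n maximal_idealsD(3)[OF M] is_space_ideal[OF T], of f] af by blast
  moreover have "{a * f + w | a w. a \<in> M \<and> w \<in> T} = T"
  proof (intro equalityI subsetI)
    fix x assume "x \<in> {a * f + w | a w. a \<in> M \<and> w \<in> T}"
    then show "x \<in> T" using af Ts(2) by blast
  next
    fix x assume "x \<in> T"
    moreover have "0 \<in> M" "x = 0 * f + x" using is_idealD(1)[OF maximal_idealsD(1)[OF M]] by simp_all
    ultimately show "x \<in> {a * f + w | a w. a \<in> M \<and> w \<in> T}" by blast
  qed
  moreover have "{a * f + w | a w. a \<in> UNIV \<and> w \<in> T} = order_ideal e"
  proof (intro equalityI subsetI)
    fix x assume "x \<in> {a * f + w | a w. a \<in> UNIV \<and> w \<in> T}"
    then show "x \<in> order_ideal e" using TE Es(2) is_idealD(3)[OF idealE f(1)] by blast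
  next
    fix x assume "x \<in> order_ideal e"
    then obtain a where "x - a * f \<in> T" using surj by blast
    moreover have "x = a * f + (x - a * f)" by simp
    ultimately show "x \<in> {a * f + w | a w. a \<in> UNIV \<and> w \<in> T}" by blast
  qed
  ultimately show ?thesis by (simp add: T_def)
qed

text \<open>
  Removing one point at a time from \<open>e\<close> shows that the codimension of its ideal is its degree.
\<close>
lemma extends_order_ideal:
  assumes \<delta>: "\<And>M. M \<in> \<M> \<Longrightarrow> extends (\<delta> M) M UNIV" and fin: "finite {M \<in> \<M>. e M \<noteq> 0}"
  shows "extends (\<Sum>M | M \<in> \<M> \<and> e M \<noteq> 0. e M * \<delta> M) (order_ideal e) UNIV"
  using fin
proof (induction "\<Sum>M | M \<in> \<M> \<and> e M \<noteq> 0. e M" arbitrary: e)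
  case 0
  then have none: "{M \<in> \<M>. e M \<noteq> 0} = {}" by auto
  then have "order_ideal e = UNIV" by (auto simp: order_ideal_def)
  then show ?case unfolding none using extends.refl by simp
next
  case (Suc k)
  have "{M \<in> \<M>. e M \<noteq> 0} \<noteq> {}"
  proof
    assume "{M \<in> \<M>. e M \<noteq> 0} = {}"
    then show False using Suc.hyps(2) by (metis (no_types, lifting) Zero_not_Suc sum.empty)
  qed
  then obtain M where M: "M \<in> \<M>" "e M \<noteq> 0" by blast
  define e' where "e' = e(M := e M - 1)"
  have e: "e = e'(M := Suc (e' M))" using M(2) by (auto simp: e'_def)
  have sub: "{M \<in> \<M>. e' M \<noteq> 0} \<subseteq> {M \<in> \<M>. e M \<noteq> 0}" by (auto simp: e'_def)
  have fin': "finite {M \<in> \<M>. e' M \<noteq> 0}" using finite_subset[OF sub Suc.prems] .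
  have sums: "(\<Sum>M | M \<in> \<M> \<and> e M \<noteq> 0. e M * w M) = (\<Sum>M | M \<in> \<M> \<and> e' M \<noteq> 0. e' M * w M) + w M" for w :: "'a poly poly set \<Rightarrow> nat"
  proof -
    have "(\<Sum>M | M \<in> \<M> \<and> e' M \<noteq> 0. e' M * w M) = (\<Sum>M | M \<in> \<M> \<and> e M \<noteq> 0. e' M * w M)"
      using sub Suc.prems by (intro sum.mono_neutral_left) auto
    moreover have "(\<Sum>M | M \<in> \<M> \<and> e M \<noteq> 0. e M * w M) = e M * w M + (\<Sum>M\<in>{M \<in> \<M>. e M \<noteq> 0} - {M}. e M * w M)"
      using M Suc.prems by (intro sum.remove) auto
    moreover have "(\<Sum>M | M \<in> \<M> \<and> e M \<noteq> 0. e' M * w M) = e' M * w M + (\<Sum>M\<in>{M \<in> \<M>. e M \<noteq> 0} - {M}. e' M * w M)"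
      using M Suc.prems by (intro sum.remove) auto
    moreover have "(\<Sum>M\<in>{M \<in> \<M>. e M \<noteq> 0} - {M}. e M * w M) = (\<Sum>M\<in>{M \<in> \<M>. e M \<noteq> 0} - {M}. e' M * w M)"
      by (intro sum.cong) (auto simp: e'_def)
    moreover have "e M * w M = e' M * w M + w M" using M(2) by (cases "e M") (auto simp: e'_def)
    ultimately show ?thesis by simp
  qed
  have "k = (\<Sum>M | M \<in> \<M> \<and> e' M \<noteq> 0. e' M)" using sums[of "\<lambda>_. 1"] Suc.hyps(2) by simp
  note IH = Suc.hyps(1)[OF this fin']
  have "extends (\<delta> M) (order_ideal e) (order_ideal e')"
    using extends_order_ideal_step[OF M(1) fin' \<delta>[OF M(1)]] e by simp
  from extends_trans[OF IH this] show ?case unfolding sums[of \<delta>] by (simp add: add.commute)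
qed

text \<open>
  A proper ideal of least codimension above \<open>J\<close> is maximal.
\<close>
lemma exists_maximal:
  assumes J: "is_ideal_on C J" and f: "f \<in> J" "laurent C f \<noteq> 0" and proper: "1 \<notin> J"
  shows "\<exists>M\<in>\<M>. J \<subseteq> M"
proof -
  define Q where "Q k = (\<exists>I. is_ideal_on C I \<and> J \<subseteq> I \<and> 1 \<notin> I \<and> codim C I = k)" for k
  have "\<exists>k. Q k" unfolding Q_def using J proper by blast
  then obtain k where k: "Q k" "\<And>j. j < k \<Longrightarrow> \<not> Q j" using exists_least_iff[of Q] by blast
  then obtain M where M: "is_ideal_on C M" "J \<subseteq> M" "1 \<notin> M" "codim C M = k" by (auto simp: Q_def)
  have cof: "cofinite_space C M" using cofinite_ideal[OF M(1)] f M(2) by blast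
  have "\<exists>r. 1 - r * b \<in> M" if b: "b \<notin> M" for b
  proof -
    define I where "I = {P + r * b | P r. P \<in> M}"
    note I_ideal = is_ideal_adjoin(1)[OF M(1)[unfolded is_ideal_on_def, THEN conjunct1], of b, folded I_def]
      and MI' = is_ideal_adjoin(2)[OF M(1)[unfolded is_ideal_on_def, THEN conjunct1], of b, folded I_def]
      and bI = is_ideal_adjoin(3)[OF M(1)[unfolded is_ideal_on_def, THEN conjunct1], of b, folded I_def]
    have I: "is_ideal_on C I" using I_ideal MI' M(1) unfolding is_ideal_on_def by blast
    have "codim C I < k" using codim_strict[OF cof is_space_ideal[OF I]] MI' bI b M(4) by blast
    then have "\<not> Q (codim C I)" using k(2) by blast
    then have "1 \<in> I" unfolding Q_def using I M(2) MI' by blast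
    then obtain P r where "1 = P + r * b" "P \<in> M" unfolding I_def by blast
    then have "1 - r * b \<in> M" by (metis add_diff_cancel_right')
    then show ?thesis by blast
  qed
  moreover have "E \<in> M" using M(1) laurent_curve_poly unfolding is_ideal_on_def by blast
  ultimately have "M \<in> \<M>" using M by (simp add: maximal_ideals_def maximal_over_def is_ideal_on_def)
  then show ?thesis using M(2) by blast
qed

text \<open>
  Divisibility is local: the denominators \<open>a\<close> with \<open>F\<close> dividing \<open>a h\<close> form an ideal, which no maximal
  ideal contains.
\<close>
lemma divides_if_val_le:
  assumes F: "laurent C F \<noteq> 0" and h: "laurent C h \<noteq> 0" and le: "\<And>M. M \<in> \<M> \<Longrightarrow> val M F \<le> val M h"
  shows "\<exists>q. laurent C h = laurent C q * laurent C F"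
proof -
  define J where "J = {a. \<exists>q. laurent C a * laurent C h = laurent C q * laurent C F}"
  have J: "is_ideal_on C J"
    unfolding is_ideal_on_def is_ideal_def
  proof (intro conjI allI ballI impI)
    have 0: "laurent C A = 0 \<Longrightarrow> A \<in> J" for A
      unfolding J_def by (intro CollectI exI[of _ 0]) (simp add: laurent_hom)
    then show "laurent C A = 0 \<Longrightarrow> A \<in> J" for A .
    show "0 \<in> J" using 0 by (simp add: laurent_hom)
    fix P Q A assume "P \<in> J"
    then obtain q where q: "laurent C P * laurent C h = laurent C q * laurent C F" by (auto simp: J_def)
    then have "laurent C (A * P) * laurent C h = laurent C (A * q) * laurent C F" by (simp add: laurent_hom)
    then show "A * P \<in> J" unfolding J_def by blast
    assume "Q \<in> J"
    then obtain q' where "laurent C Q * laurent C h = laurent C q' * laurent C F" by (auto simp: J_def)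
    with q have "laurent C (P + Q) * laurent C h = laurent C (q + q') * laurent C F"
      by (simp add: laurent_hom algebra_simps)
    then show "P + Q \<in> J" unfolding J_def by blast
  qed
  have FJ: "F \<in> J" unfolding J_def by (intro CollectI exI[of _ h]) simp
  have "1 \<in> J"
  proof (rule ccontr)
    assume "1 \<notin> J"
    then obtain M where M: "M \<in> \<M>" "J \<subseteq> M" using exists_maximal[OF J FJ F] by blast
    define u where "u = laurent C (uniformizer M)"
    obtain b c where bc: "b \<notin> M" "c \<notin> M" "laurent C b * laurent C F = u ^ val M F * laurent C c"
      using local_form_val[OF M(1) F] by (auto simp: local_form_def u_def)
    obtain b' c' where bc': "b' \<notin> M" "laurent C b' * laurent C h = u ^ val M F * laurent C c'"
      using le[OF M(1)] locally_divisible_val[OF M(1) h, of "val M F"]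
      by (auto simp: locally_divisible_iff laurent_hom u_def)
    have "laurent C (c * b') * laurent C h = laurent C c' * (u ^ val M F * laurent C c)"
      using bc'(2) by (simp add: laurent_hom algebra_simps)
    also have "\<dots> = laurent C (c' * b) * laurent C F" unfolding bc(3)[symmetric] by (simp add: laurent_hom)
    finally have "c * b' \<in> J" unfolding J_def by blast
    then show False using M mult_mem_M_iff[OF M(1)] bc(2) bc'(1) by blast
  qed
  then show ?thesis by (simp add: J_def laurent_hom)
qed

end

section \<open>Degrees of points\<close>

context smooth_c34
begin

definition residue_map :: "'a poly poly set \<Rightarrow> 'a poly poly \<Rightarrow> 'a poly poly set set" where
  "residue_map M P = (cls C ` M) +>\<^bsub>R C\<^esub> cls C P"

lemma maximalideal_of:
  assumes "M \<in> \<M>"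
  shows "maximalideal (cls C ` M) (R C)"
  using assms maximalideal_image by (simp add: maximal_ideals_def)

lemma ring_hom_residue_map:
  assumes M: "M \<in> \<M>"
  shows "ring_hom_ring bivariate (R C Quot (cls C ` M)) (residue_map M)"
proof -
  interpret maximalideal "cls C ` M" "R C" by (rule maximalideal_of[OF M])
  have "residue_map M = (\<lambda>x. cls C ` M +>\<^bsub>R C\<^esub> x) \<circ> cls C" by (auto simp: residue_map_def)
  then show ?thesis
    using ring_hom_trans[OF ring_hom_ring.homh[OF ring_hom_residue_class[of E]] rcos_ring_hom]
    by (intro ring_hom_ringI2 cring.axioms(1)[OF cring_bivariate] quotient_is_ring) (simp add: comp_def)
qed

lemma residue_map_hom:
  assumes "M \<in> \<M>"
  shows "residue_map M (P + Q) = residue_map M P \<oplus>\<^bsub>R C Quot (cls C ` M)\<^esub> residue_map M Q"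
    "residue_map M (P * Q) = residue_map M P \<otimes>\<^bsub>R C Quot (cls C ` M)\<^esub> residue_map M Q"
    "residue_map M 1 = \<one>\<^bsub>R C Quot (cls C ` M)\<^esub>"
    "residue_map M P \<in> carrier (R C Quot (cls C ` M))"
  using ring_hom_ring.homh[OF ring_hom_residue_map[OF assms]] by (auto simp: ring_hom_def)

lemma residue_map_zero_iff:
  assumes M: "M \<in> \<M>"
  shows "residue_map M P = \<zero>\<^bsub>R C Quot (cls C ` M)\<^esub> \<longleftrightarrow> P \<in> M"
proof -
  interpret maximalideal "cls C ` M" "R C" by (rule maximalideal_of[OF M])
  have "residue_map M P = \<zero>\<^bsub>R C Quot (cls C ` M)\<^esub> \<longleftrightarrow> cls C P \<in> cls C ` M"
    using a_rcos_const a_rcos_self[of "cls C P"]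
    by (auto simp: residue_map_def FactRing_def)
  also have "\<dots> \<longleftrightarrow> P \<in> M"
    using preimage_image[OF maximal_idealsD(1,7)[OF M]] by (auto simp: preimage_def)
  finally show ?thesis .
qed

text \<open>
  A chain of line extensions from \<open>M\<close> to \<open>R\<close> maps to such a chain from 0 to the residue field,
  of the same length.
\<close>
lemma extends_point_degree:
  assumes M: "M \<in> \<M>"
  shows "extends (point_degree C (Affine (cls C ` M))) M UNIV"
proof -
  define Q where "Q = R C Quot (cls C ` M)"
  define K where "K = range (\<lambda>c. residue_map M (Cst c))"
  interpret m: maximalideal "cls C ` M" "R C" by (rule maximalideal_of[OF M])
  interpret Q: field Q
    unfolding Q_def by (rule m.quotient_is_field[OF cring_coordinate_ring])
  note hom = residue_map_hom[OF M, folded Q_def] and zero = residue_map_zero_iff[OF M, folded Q_def]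
  note MI = is_idealD[OF maximal_idealsD(1)[OF M]]
  have inj: "P - P' \<in> M" if "residue_map M P = residue_map M P'" for P P'
  proof -
    have "residue_map M (P - P') \<oplus>\<^bsub>Q\<^esub> residue_map M P' = \<zero>\<^bsub>Q\<^esub> \<oplus>\<^bsub>Q\<^esub> residue_map M P'"
      using that hom(4) by (simp flip: hom(1))
    then show ?thesis using hom(4) zero by simp
  qed
  have K: "subfield K Q"
  proof -
    have "ring_hom_ring (ring_of_type_algebra :: 'a ring) Q (\<lambda>c. residue_map M (Cst c))"
      by (intro ring_hom_ringI field.is_ring field_from_type_algebra Q.is_ring)
        (simp_all add: ring_of_type_algebra_def hom Cst_add Cst_mult)
    from ring_hom_ring.img_is_subfield(2)[OF this field.carrier_is_subfield[OF field_from_type_algebra]]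
    show ?thesis using Q.one_not_zero by (simp add: K_def ring_of_type_algebra_def)
  qed
  have dim: "is_space C U \<Longrightarrow> U = M \<Longrightarrow> Q.dimension n K (residue_map M ` V)" if "extends n U V" for n U V
    using that
  proof (induction n U V rule: extends.induct)
    case (refl U)
    have "residue_map M ` M = {\<zero>\<^bsub>Q\<^esub>}" using zero MI(1) by auto
    then show ?case using refl by auto
  next
    case (adjoin n U V e)
    note V = extends_pole_ords[OF adjoin.hyps(1) adjoin.prems(1)]
    have "residue_map M e \<notin> residue_map M ` V"
    proof
      assume "residue_map M e \<in> residue_map M ` V"
      then obtain v where v: "v \<in> V" "e - v \<in> M" using inj by blast
      then have "(e - v) + v \<in> V" using V(2) adjoin.prems(2) is_spaceD(2)[OF V(1)] by blast
      then show False using adjoin.hyps(2) by simp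
    qed
    moreover have "Q.line_extension K (residue_map M e) (residue_map M ` V) = residue_map M ` adjoin V e"
    proof (intro equalityI subsetI)
      fix x assume "x \<in> Q.line_extension K (residue_map M e) (residue_map M ` V)"
      then obtain c v where "v \<in> V" "x = residue_map M (Cst c) \<otimes>\<^bsub>Q\<^esub> residue_map M e \<oplus>\<^bsub>Q\<^esub> residue_map M v"
        unfolding Q.line_extension_mem_iff K_def by blast
      moreover from this have "x = residue_map M (v + Cst c * e)"
        by (simp add: hom) (simp add: Q.add.m_comm hom(4) flip: hom(2))
      ultimately show "x \<in> residue_map M ` adjoin V e" unfolding adjoin_def by blast
    next
      fix x assume "x \<in> residue_map M ` adjoin V e"
      then obtain v c where "v \<in> V" "x = residue_map M (v + Cst c * e)" unfolding adjoin_def by blast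
      moreover from this have "x = residue_map M (Cst c) \<otimes>\<^bsub>Q\<^esub> residue_map M e \<oplus>\<^bsub>Q\<^esub> residue_map M v"
        by (simp add: add.commute[of v] flip: hom)
      ultimately show "x \<in> Q.line_extension K (residue_map M e) (residue_map M ` V)"
        unfolding Q.line_extension_mem_iff K_def by blast
    qed
    ultimately show ?case using Q.Suc_dim[OF hom(4)] adjoin.IH adjoin.prems by metis
  qed
  obtain n where n: "extends n M UNIV"
    using extends_exists[OF maximal_idealsD(3)[OF M] is_space_UNIV] cofinite_maximal_ideal[OF M]
    by (auto simp: cofinite_space_def)
  have "carrier Q = range (residue_map M)"
    by (auto simp: Q_def residue_map_def FactRing_def A_RCOSETS_def' carrier_coordinate_ring)
  then have "Q.dimension n K (carrier Q)" using dim[OF n maximal_idealsD(3)[OF M]] by simp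
  then have "Q.dim K (carrier Q) = n" using Q.dimI[OF K] by (simp add: over_def)
  then show ?thesis using n by (simp add: Q_def K_def residue_map_def)
qed

section \<open>Divisors and their ideals\<close>

definition point_of :: "'a poly poly set \<Rightarrow> 'a point" where
  "point_of M = Affine (cls C ` M)"

definition mult_at :: "'a divisor \<Rightarrow> 'a poly poly set \<Rightarrow> nat" where
  "mult_at D M = nat (D (point_of M))"

lemma points_eq: "points C = insert At_Infinity (point_of ` \<M>)"
proof -
  have "{m. maximalideal m (R C)} = (\<lambda>M. cls C ` M) ` \<M>"
  proof (intro equalityI subsetI)
    fix m assume "m \<in> {m. maximalideal m (R C)}"
    then have m: "maximalideal m (R C)" by simp
    then have "preimage E m \<in> \<M>" using maximal_over_preimage by (simp add: maximal_ideals_def)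
    moreover have "cls C ` preimage E m = m"
      by (rule image_preimage)
        (rule additive_subgroup.a_subset[OF ideal.axioms(1)[OF maximalideal.axioms(1)[OF m]]])
    ultimately show "m \<in> (\<lambda>M. cls C ` M) ` \<M>" by (metis imageI)
  qed (use maximalideal_of in auto)
  then show ?thesis by (auto simp: points_def point_of_def)
qed

lemma inj_point_of: "inj_on point_of \<M>"
proof (rule inj_onI)
  fix M M' assume M: "M \<in> \<M>" "M' \<in> \<M>" "point_of M = point_of M'"
  then have "preimage E (cls C ` M) = preimage E (cls C ` M')" by (simp add: point_of_def)
  then show "M = M'" using preimage_image[OF maximal_idealsD(1,7)] M by metis
qed

lemma point_of_ne [simp]: "point_of M \<noteq> At_Infinity"
  by (simp add: point_of_def)

lemma affine_div_point_of:
  assumes "M \<in> \<M>"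
  shows "affine_div C (cls C P) (point_of M) = int (val M P)"
  using assms by (simp add: affine_div_def points_eq) (simp add: point_of_def val_def)

lemma affine_div_outside:
  assumes "p \<notin> point_of ` \<M>"
  shows "affine_div C (cls C P) p = 0"
  using assms by (simp add: affine_div_def points_eq)

lemma goodI:
  assumes "\<And>p. p \<notin> point_of ` \<M> \<Longrightarrow> D p = 0" "\<And>M. M \<in> \<M> \<Longrightarrow> 0 \<le> D (point_of M)"
    "finite {M \<in> \<M>. D (point_of M) \<noteq> 0}"
  shows "good C D"
proof -
  have supp: "{p. D p \<noteq> 0} \<subseteq> point_of ` {M \<in> \<M>. D (point_of M) \<noteq> 0}"
  proof
    fix p assume p: "p \<in> {p. D p \<noteq> 0}"
    then have "p \<in> point_of ` \<M>" using assms(1) by blast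
    then show "p \<in> point_of ` {M \<in> \<M>. D (point_of M) \<noteq> 0}" using p by blast
  qed
  have "finite {p. D p \<noteq> 0}" using finite_subset[OF supp] assms(3) by simp
  moreover have "{p. D p \<noteq> 0} \<subseteq> points C" using supp unfolding points_eq by blast
  moreover have "0 \<le> D"
  proof (rule le_funI)
    fix p show "0 p \<le> D p" using assms(1)[of p] assms(2) by (cases "p \<in> point_of ` \<M>") auto
  qed
  moreover have "D At_Infinity = 0" by (rule assms(1)) (auto simp: point_of_def)
  ultimately show ?thesis unfolding good_def is_divisor_def by blast
qed

lemma goodD:
  assumes "good C D"
  shows "p \<notin> point_of ` \<M> \<Longrightarrow> D p = 0" "0 \<le> D p" "finite {M \<in> \<M>. mult_at D M \<noteq> 0}"
    "D (point_of M) = int (mult_at D M)" "is_divisor C D"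
proof -
  have D: "finite {p. D p \<noteq> 0}" "{p. D p \<noteq> 0} \<subseteq> points C" "D At_Infinity = 0"
    using assms by (auto simp: good_def is_divisor_def)
  show nonneg: "0 \<le> D p" for p using assms by (auto simp: good_def le_fun_def)
  show "p \<notin> point_of ` \<M> \<Longrightarrow> D p = 0" using D by (auto simp: points_eq)
  show *: "D (point_of M) = int (mult_at D M)" for M using nonneg by (simp add: mult_at_def)
  show "is_divisor C D" using assms by (simp add: good_def)
  have "point_of ` {M \<in> \<M>. mult_at D M \<noteq> 0} \<subseteq> {p. D p \<noteq> 0}" using * by auto
  then have "finite (point_of ` {M \<in> \<M>. mult_at D M \<noteq> 0})" using D(1) finite_subset by blast
  then show "finite {M \<in> \<M>. mult_at D M \<noteq> 0}"
    by (rule finite_imageD) (rule inj_on_subset[OF inj_point_of], auto)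
qed

lemma cls_mem_I_div_iff:
  assumes "good C D"
  shows "cls C P \<in> I_div C D \<longleftrightarrow> P \<in> order_ideal (mult_at D)"
proof -
  have "D \<le> affine_div C (cls C P) \<longleftrightarrow> (\<forall>M\<in>\<M>. mult_at D M \<le> val M P)"
  proof
    assume "D \<le> affine_div C (cls C P)"
    then have "D (point_of M) \<le> affine_div C (cls C P) (point_of M)" for M by (simp add: le_fun_def)
    then have "int (mult_at D M) \<le> int (val M P)" if "M \<in> \<M>" for M
      using affine_div_point_of[OF that, of P] goodD(4)[OF assms, of M] by metis
    then show "\<forall>M\<in>\<M>. mult_at D M \<le> val M P" by simp
  next
    assume le: "\<forall>M\<in>\<M>. mult_at D M \<le> val M P"
    have "D p \<le> affine_div C (cls C P) p" for p
    proof (cases "p \<in> point_of ` \<M>")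
      case True
      then show ?thesis using le by (auto simp: goodD(4)[OF assms] affine_div_point_of)
    next
      case False
      then show ?thesis using goodD(1)[OF assms] by (simp add: affine_div_outside)
    qed
    then show "D \<le> affine_div C (cls C P)" by (simp add: le_fun_def)
  qed
  then show ?thesis by (simp add: I_div_def order_ideal_def cls_eq_0_iff)
qed

lemma divisor_degree_good:
  assumes "good C D"
  shows "divisor_degree C D = int (\<Sum>M | M \<in> \<M> \<and> mult_at D M \<noteq> 0. mult_at D M * point_degree C (point_of M))"
proof -
  have supp: "{p. D p \<noteq> 0} = point_of ` {M \<in> \<M>. mult_at D M \<noteq> 0}"
  proof (intro equalityI subsetI)
    fix p assume p: "p \<in> {p. D p \<noteq> 0}"
    then obtain M where M: "M \<in> \<M>" "p = point_of M" using goodD(1)[OF assms] by blast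
    then show "p \<in> point_of ` {M \<in> \<M>. mult_at D M \<noteq> 0}" using p goodD(4)[OF assms, of M] by auto
  next
    fix p assume "p \<in> point_of ` {M \<in> \<M>. mult_at D M \<noteq> 0}"
    then show "p \<in> {p. D p \<noteq> 0}" using goodD(4)[OF assms] by auto
  qed
  have "inj_on point_of {M \<in> \<M>. mult_at D M \<noteq> 0}" by (rule inj_on_subset[OF inj_point_of]) auto
  then have "divisor_degree C D = (\<Sum>M | M \<in> \<M> \<and> mult_at D M \<noteq> 0. D (point_of M) * int (point_degree C (point_of M)))"
    unfolding divisor_degree_def supp by (simp add: sum.reindex)
  then show ?thesis by (simp add: goodD(4)[OF assms])
qed

lemma extends_divisor_degree:
  assumes "good C D"
  shows "extends (nat (divisor_degree C D)) (order_ideal (mult_at D)) UNIV"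
  unfolding divisor_degree_good[OF assms] nat_int
  by (rule extends_order_ideal[OF extends_point_degree[folded point_of_def] goodD(3)[OF assms]])

lemma divisor_degree_add:
  assumes "is_divisor C D" "is_divisor C D'"
  shows "divisor_degree C (D + D') = divisor_degree C D + divisor_degree C D'"
proof -
  define S where "S = {p. D p \<noteq> 0} \<union> {p. D' p \<noteq> 0}"
  have S: "finite S" using assms by (auto simp: S_def is_divisor_def)
  have "divisor_degree C X0 = (\<Sum>p\<in>S. X0 p * int (point_degree C p))" if "{p. X0 p \<noteq> 0} \<subseteq> S" for X0
    unfolding divisor_degree_def using S that by (intro sum.mono_neutral_left) auto
  moreover have "{p. (D + D') p \<noteq> 0} \<subseteq> S" "{p. D p \<noteq> 0} \<subseteq> S" "{p. D' p \<noteq> 0} \<subseteq> S" by (auto simp: S_def)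
  ultimately show ?thesis by (simp add: distrib_right sum.distrib)
qed

end

section \<open>Spaces of bounded pole order\<close>

definition W_poly :: "'a::field c34 \<Rightarrow> int \<Rightarrow> 'a poly poly set" where
  "W_poly C N = {P. laurent C P = 0 \<or> pole_ord C P \<le> N}"

lemma W_poly_add:
  assumes "P \<in> W_poly C N" "Q \<in> W_poly C N"
  shows "P + Q \<in> W_poly C N"
proof (cases "laurent C P + laurent C Q = 0")
  case True
  then show ?thesis by (simp add: W_poly_def laurent_hom)
next
  case False
  then show ?thesis
    using assms fls_plus_subdegree[OF False] by (auto simp: W_poly_def laurent_hom pole_ord_def)
qed

lemma W_poly_mult:
  assumes "P \<in> W_poly C N" "Q \<in> W_poly C N'"
  shows "P * Q \<in> W_poly C (N + N')"
  using assms pole_ord_mult[of C P Q]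
  by (cases "laurent C P = 0 \<or> laurent C Q = 0") (auto simp: W_poly_def laurent_hom)

lemma W_poly_Cst_mult: "P \<in> W_poly C N \<Longrightarrow> Cst c * P \<in> W_poly C N"
  using W_poly_mult[of "Cst c" C 0 P N] by (simp add: W_poly_def laurent_generators pole_ord_def)

lemma is_space_W_poly: "is_space C (W_poly C N)"
  by (simp add: is_space_def W_poly_add W_poly_Cst_mult) (simp add: W_poly_def)

lemma W_poly_mono: "P \<in> W_poly C N \<Longrightarrow> N \<le> N' \<Longrightarrow> P \<in> W_poly C N'"
  by (auto simp: W_poly_def)

lemma W_poly_monomial: "3 * int i + 4 * int j \<le> N \<Longrightarrow> vx ^ i * vy ^ j \<in> W_poly C N"
  by (simp add: W_poly_def pole_ord_monomial)

lemma W_poly_monomials: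
  "0 \<le> N \<Longrightarrow> Cst c \<in> W_poly C N" "3 \<le> N \<Longrightarrow> vx \<in> W_poly C N" "4 \<le> N \<Longrightarrow> vy \<in> W_poly C N"
  "6 \<le> N \<Longrightarrow> vx ^ 2 \<in> W_poly C N" "7 \<le> N \<Longrightarrow> vx * vy \<in> W_poly C N" "8 \<le> N \<Longrightarrow> vy ^ 2 \<in> W_poly C N"
  "9 \<le> N \<Longrightarrow> vx ^ 3 \<in> W_poly C N" "10 \<le> N \<Longrightarrow> vx ^ 2 * vy \<in> W_poly C N"
  using W_poly_monomial[of 0 0 N C] W_poly_Cst_mult[of 1 C N c] W_poly_monomial[of 1 0 N C]
    W_poly_monomial[of 0 1 N C] W_poly_monomial[of 2 0 N C] W_poly_monomial[of 1 1 N C]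
    W_poly_monomial[of 0 2 N C] W_poly_monomial[of 3 0 N C] W_poly_monomial[of 2 1 N C]
  by simp_all

lemma W_poly_diff: "P \<in> W_poly C N \<Longrightarrow> Q \<in> W_poly C N \<Longrightarrow> P - Q \<in> W_poly C N"
  using is_spaceD(4)[OF is_space_W_poly] .

lemma W_poly_minus: "P \<in> W_poly C N \<Longrightarrow> - P \<in> W_poly C N"
  using W_poly_diff[of 0 C N P] by (simp add: W_poly_def laurent_hom)

lemmas W_poly_intros = W_poly_add W_poly_diff W_poly_minus W_poly_Cst_mult W_poly_monomials

lemma leading_term:
  assumes "c \<noteq> 0" "Q \<in> W_poly C N" "N < 3 * int i + 4 * int j"
  shows "laurent C (Cst c * (vx ^ i * vy ^ j) + Q) \<noteq> 0"
    "pole_ord C (Cst c * (vx ^ i * vy ^ j) + Q) = 3 * int i + 4 * int j"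
proof -
  have c: "laurent C (Cst c) \<noteq> 0" "pole_ord C (Cst c) = 0" using assms(1) by (simp_all add: laurent_generators pole_ord_def)
  have P: "laurent C (Cst c * (vx ^ i * vy ^ j)) \<noteq> 0" "pole_ord C (Cst c * (vx ^ i * vy ^ j)) = 3 * int i + 4 * int j"
    using c pole_ord_monomial[of C i j] pole_ord_mult[OF c(1) pole_ord_monomial(1)] by (simp_all only: laurent_hom(4)) auto
  have "laurent C (Cst c * (vx ^ i * vy ^ j) + Q) \<noteq> 0
      \<and> pole_ord C (Cst c * (vx ^ i * vy ^ j) + Q) = 3 * int i + 4 * int j"
  proof (cases "laurent C Q = 0")
    case True
    then have "laurent C (Cst c * (vx ^ i * vy ^ j) + Q) = laurent C (Cst c * (vx ^ i * vy ^ j))" by (simp add: laurent_hom(3))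
    then show ?thesis using P by (simp add: pole_ord_def)
  next
    case False
    then have "pole_ord C Q < pole_ord C (Cst c * (vx ^ i * vy ^ j))" using assms(2,3) P(2) by (auto simp: W_poly_def)
    from pole_ord_add_neq[OF False P(1) this] P(2) show ?thesis by (simp add: add.commute)
  qed
  then show "laurent C (Cst c * (vx ^ i * vy ^ j) + Q) \<noteq> 0"
    "pole_ord C (Cst c * (vx ^ i * vy ^ j) + Q) = 3 * int i + 4 * int j" by auto
qed

lemma pole_ords_UNIV: "n \<in> pole_ords C UNIV \<Longrightarrow> n \<in> {0, 3, 4} \<or> 6 \<le> n"
proof -
  assume "n \<in> pole_ords C UNIV"
  then obtain P where "laurent C P \<noteq> 0" "pole_ord C P = int n" by (auto simp: pole_ords_def)
  then obtain i j where "int n = 3 * int i + 4 * int j" using pole_ord_cases by metis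
  then have "n = 0 \<or> n = 3 \<or> n = 4 \<or> 6 \<le> n" by presburger
  then show ?thesis by auto
qed

section \<open>Typical divisors of degree 3\<close>

lemmas Cst_hom = is_ring_homD[OF is_ring_hom_Cst]

lemma W_eq: "W C N = cls C ` W_poly C N"
proof (intro equalityI subsetI)
  fix f assume f: "f \<in> W C N"
  then have "f \<in> carrier (R C)" by (simp add: W_def)
  then obtain P where "f = cls C P" by (auto simp: carrier_coordinate_ring)
  then show "f \<in> cls C ` W_poly C N" using f cls_mem_W_iff[of C P N] by (auto simp: W_poly_def)
qed (auto simp: cls_mem_W_iff W_poly_def)

lemma pole_ords_W_poly: "n \<in> pole_ords C (W_poly C N) \<longleftrightarrow> n \<in> pole_ords C UNIV \<and> int n \<le> N"
proof
  assume "n \<in> pole_ords C UNIV \<and> int n \<le> N"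
  then obtain P where "laurent C P \<noteq> 0" "pole_ord C P = int n" "int n \<le> N" by (auto simp: pole_ords_def)
  then show "n \<in> pole_ords C (W_poly C N)"
    unfolding pole_ords_def W_poly_def by (intro CollectI bexI[of _ P]) auto
qed (auto simp: pole_ords_def W_poly_def)

lemma pole_ords_ideal_monomial:
  assumes J: "is_ideal J" and P: "P \<in> J" "laurent C P \<noteq> 0" "pole_ord C P = int k"
  shows "k + 3 * i + 4 * j \<in> pole_ords C J"
proof -
  have "P * (vx ^ i * vy ^ j) \<in> J" using is_idealD(4)[OF J P(1)] .
  moreover have "laurent C (P * (vx ^ i * vy ^ j)) \<noteq> 0" using P(2) pole_ord_monomial(1) by (simp add: laurent_hom(4))
  moreover have "pole_ord C (P * (vx ^ i * vy ^ j)) = int (k + 3 * i + 4 * j)"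
    using pole_ord_mult[OF P(2) pole_ord_monomial(1)] P(3) by (simp add: pole_ord_monomial)
  ultimately show ?thesis unfolding pole_ords_def by blast
qed

text \<open>
  Multiplication by \<open>x\<close> adds 3 to the pole order.
\<close>
lemma pole_ords_ideal_ge:
  assumes J: "is_ideal J" and n: "k \<le> n"
    and P: "\<And>i. i < 3 \<Longrightarrow> P i \<in> J \<and> laurent C (P i) \<noteq> 0 \<and> pole_ord C (P i) = int (k + i)"
  shows "n \<in> pole_ords C J"
proof -
  define i where "i = (n - k) mod 3"
  have "n = (k + i) + 3 * ((n - k) div 3) + 4 * 0" using n by (simp add: i_def)
  moreover have "i < 3" by (simp add: i_def)
  ultimately show ?thesis using pole_ords_ideal_monomial[OF J, of "P i" C "k + i" "(n - k) div 3" 0] P[of i] by metis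
qed

lemma F_leading: "laurent C (F_poly a b c) \<noteq> 0" "pole_ord C (F_poly a b c) = 6"
proof -
  have eq: "F_poly a b c = Cst 1 * (vx ^ 2 * vy ^ 0) + (Cst a * vy + Cst b * vx + Cst c)"
    by (simp add: F_poly_def)
  have low: "Cst a * vy + Cst b * vx + Cst c \<in> W_poly C 4" by (intro W_poly_intros) simp_all
  show "laurent C (F_poly a b c) \<noteq> 0" "pole_ord C (F_poly a b c) = 6"
    unfolding eq using leading_term[OF _ low, of 1 2 0] by simp_all
qed

lemma G_leading: "laurent C (G_poly d e f) \<noteq> 0" "pole_ord C (G_poly d e f) = 7"
proof -
  have eq: "G_poly d e f = Cst 1 * (vx ^ 1 * vy ^ 1) + (Cst d * vy + Cst e * vx + Cst f)"
    by (simp add: G_poly_def)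
  have low: "Cst d * vy + Cst e * vx + Cst f \<in> W_poly C 4" by (intro W_poly_intros) simp_all
  show "laurent C (G_poly d e f) \<noteq> 0" "pole_ord C (G_poly d e f) = 7"
    unfolding eq using leading_term[OF _ low, of 1 1 1] by simp_all
qed

text \<open>
  The terms in \<open>x\<^sup>2 y\<close> cancel, and \<open>a y\<^sup>2\<close> becomes the leading one. This is where \<open>a \<noteq> 0\<close> matters.
\<close>
lemma FG_leading:
  assumes "a \<noteq> 0"
  shows "laurent C (vy * F_poly a b c - vx * G_poly d e f) \<noteq> 0"
    "pole_ord C (vy * F_poly a b c - vx * G_poly d e f) = 8"
proof -
  have eq: "vy * F_poly a b c - vx * G_poly d e f = Cst a * (vx ^ 0 * vy ^ 2)
      + (Cst (b - d) * (vx * vy) + Cst c * vy - Cst e * vx ^ 2 - Cst f * vx)"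
    by (simp add: F_poly_def G_poly_def Cst_hom algebra_simps power2_eq_square)
  have low: "Cst (b - d) * (vx * vy) + Cst c * vy - Cst e * vx ^ 2 - Cst f * vx \<in> W_poly C 7"
    by (intro W_poly_intros) simp_all
  show "laurent C (vy * F_poly a b c - vx * G_poly d e f) \<noteq> 0"
    "pole_ord C (vy * F_poly a b c - vx * G_poly d e f) = 8"
    unfolding eq using leading_term[OF assms low, of 0 2] by simp_all
qed

lemma s_leading:
  "laurent C (s_poly s1 s2 s3 s4 s5 s6) \<noteq> 0" "pole_ord C (s_poly s1 s2 s3 s4 s5 s6) = 9"
proof -
  have eq: "s_poly s1 s2 s3 s4 s5 s6 = Cst 1 * (vx ^ 3 * vy ^ 0) + (Cst s1 * vy ^ 2 + Cst s2 * (vx * vy)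
      + Cst s3 * vx ^ 2 + Cst s4 * vy + Cst s5 * vx + Cst s6)"
    by (simp add: s_poly_def algebra_simps)
  have low: "Cst s1 * vy ^ 2 + Cst s2 * (vx * vy) + Cst s3 * vx ^ 2 + Cst s4 * vy + Cst s5 * vx + Cst s6 \<in> W_poly C 8"
    by (intro W_poly_intros) simp_all
  show "laurent C (s_poly s1 s2 s3 s4 s5 s6) \<noteq> 0" "pole_ord C (s_poly s1 s2 s3 s4 s5 s6) = 9"
    unfolding eq using leading_term[OF _ low, of 1 3 0] by simp_all
qed

lemma t_leading:
  "laurent C (t_poly t1 t2 t3 t4 t5 t6) \<noteq> 0" "pole_ord C (t_poly t1 t2 t3 t4 t5 t6) = 10"
proof -
  have eq: "t_poly t1 t2 t3 t4 t5 t6 = Cst 1 * (vx ^ 2 * vy ^ 1) + (Cst t1 * vy ^ 2 + Cst t2 * (vx * vy)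
      + Cst t3 * vx ^ 2 + Cst t4 * vy + Cst t5 * vx + Cst t6)"
    by (simp add: t_poly_def algebra_simps)
  have low: "Cst t1 * vy ^ 2 + Cst t2 * (vx * vy) + Cst t3 * vx ^ 2 + Cst t4 * vy + Cst t5 * vx + Cst t6 \<in> W_poly C 8"
    by (intro W_poly_intros) simp_all
  show "laurent C (t_poly t1 t2 t3 t4 t5 t6) \<noteq> 0" "pole_ord C (t_poly t1 t2 t3 t4 t5 t6) = 10"
    unfolding eq using leading_term[OF _ low, of 1 2 1] by simp_all
qed

text \<open>
  In \<open>(y - s1 x) s - x t\<close> the terms of orders 13 and 12 cancel, the latter with the help of the
  curve equation. The coefficient of \<open>x y\<^sup>2\<close>, of order 11, is minus the number that the second stage
  has to invert.
\<close>
lemma st_leading: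
  assumes l1: "t1 - s2 + s1 ^ 2 \<noteq> 0"
  shows "\<exists>Z. laurent C Z \<noteq> 0 \<and> pole_ord C Z = 11 \<and>
    (\<exists>a b. Z = a * s_poly s1 s2 s3 s4 s5 s6 + b * t_poly t1 t2 t3 t4 t5 t6 - Cst s1 * curve_poly C)"
proof -
  define Z where "Z = (vy - Cst s1 * vx) * s_poly s1 s2 s3 s4 s5 s6 + (- vx) * t_poly t1 t2 t3 t4 t5 t6
    - Cst s1 * curve_poly C"
  have eq: "Z = Cst (- (t1 - s2 + s1 ^ 2)) * (vx ^ 1 * vy ^ 2)
     + (Cst (s3 - t2 - s1 * s2 - s1 * p2 C) * (vx ^ 2 * vy) + Cst (- t3 - s1 * s3) * vx ^ 3 + Cst s4 * vy ^ 2
       + Cst (s5 - t4 - s1 * s4 - s1 * p1 C) * (vx * vy) + Cst (- t5 - s1 * s5 - s1 * q2 C) * vx ^ 2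
       + Cst (s6 - s1 * p0 C) * vy + Cst (- t6 - s1 * s6 - s1 * q1 C) * vx + Cst (- s1 * q0 C))"
    by (simp add: Z_def s_poly_def t_poly_def curve_poly_def Cst_hom)
      (simp add: algebra_simps power2_eq_square power3_eq_cube power4_eq_xxxx)
  have low: "Cst (s3 - t2 - s1 * s2 - s1 * p2 C) * (vx ^ 2 * vy) + Cst (- t3 - s1 * s3) * vx ^ 3 + Cst s4 * vy ^ 2
       + Cst (s5 - t4 - s1 * s4 - s1 * p1 C) * (vx * vy) + Cst (- t5 - s1 * s5 - s1 * q2 C) * vx ^ 2
       + Cst (s6 - s1 * p0 C) * vy + Cst (- t6 - s1 * s6 - s1 * q1 C) * vx + Cst (- s1 * q0 C) \<in> W_poly C 10"
    by (intro W_poly_intros) simp_all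
  have ne: "- (t1 - s2 + s1 ^ 2) \<noteq> 0" using l1 by (simp only: neg_equal_0_iff_equal not_False_eq_True)
  have "laurent C Z \<noteq> 0" "pole_ord C Z = 11"
    unfolding eq using leading_term[OF ne low, of 1 2] by simp_all
  then show ?thesis unfolding Z_def by blast
qed

text \<open>
  The product terms of \<open>F t + G\<^sub>0 s\<close> sorted by monomials, after subtraction of a multiple of the curve
  equation. The seven coefficients in front of the last group are the conditions that determine \<open>F\<close>
  and \<open>G\<^sub>0\<close>; the parameter \<open>k\<close> is left open to make one of them trivial.
\<close>
lemma relation_expansion:
  fixes x y :: "'r::comm_ring_1"
  shows "(x ^ 2 - l1 * y + f1 * x + f0) * (x ^ 2 * y + t1 * y ^ 2 + t2 * (x * y) + t3 * x ^ 2 + t4 * y + t5 * x + t6)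
   + (- (x * y) + s1 * x ^ 2 + u * y + g1 * x + g0) * (x ^ 3 + s1 * y ^ 2 + s2 * (x * y) + s3 * x ^ 2 + s4 * y + s5 * x + s6)
   = (k - s1 * x) * (y ^ 3 + (a2 * x ^ 2 + a1 * x + a0) * y + b2 * x ^ 2 + b1 * x + b0 - x ^ 4)
    + (t1 - s2 + s1 ^ 2 - l1) * (x ^ 2 * y ^ 2)
    + (t2 + f1 - s3 + s1 * s2 + u + s1 * a2) * (x ^ 3 * y)
    + (t3 + g1 + s1 * s3 + k) * x ^ 4
    + (u * s1 - l1 * t1 - k) * y ^ 3
    + (f1 * t3 + t5 + g0 + g1 * s3 + s1 * s5 + s1 * b2) * x ^ 3
    + (f0 + f1 * t2 - l1 * t3 + t4 + u * s3 + g1 * s2 + s1 * s4 - s5 - k * a2 + s1 * a1) * (x ^ 2 * y)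
    + (f1 * t1 - l1 * t2 - s4 + u * s2 + g1 * s1) * (x * y ^ 2)
    + ((f0 * t1 - l1 * t4 + u * s4 + g0 * s1) * y ^ 2
      + (f0 * t2 + f1 * t4 - l1 * t5 - s6 + u * s5 + g1 * s4 + g0 * s2 - k * a1 + s1 * a0) * (x * y)
      + (t6 + f1 * t5 + f0 * t3 + s1 * s6 + g1 * s5 + g0 * s3 - k * b2 + s1 * b1) * x ^ 2
      + (f0 * t4 - l1 * t6 + u * s6 + g0 * s4 - k * a0) * y
      + (f1 * t6 + f0 * t5 + g1 * s6 + g0 * s5 - k * b1 + s1 * b0) * x
      + (f0 * t6 + g0 * s6 - k * b0))"
  by (simp add: algebra_simps power2_eq_square power3_eq_cube power4_eq_xxxx)

context smooth_c34
begin

text \<open>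
  The functions \<open>F\<close>, \<open>G\<close> and \<open>y F - x G\<close> have pole orders 6, 7 and 8, so together with their multiples by
  powers of \<open>x\<close> they reach all orders from 6 on. Hence \<open>I\<^sub>A\<close> and \<open>W\<^sup>5\<close> are complementary, which makes
  the degree of \<open>A\<close> equal to the dimension 3 of \<open>W\<^sup>5\<close>. Restricted to orders up to 12, the same
  count is the condition for \<open>A\<close> to be typical.
\<close>
lemma represents_if_generators:
  assumes A: "good C A" and a: "a \<noteq> 0"
    and F: "F_poly a b c \<in> order_ideal (mult_at A)" and G: "G_poly d e f \<in> order_ideal (mult_at A)"
    and small: "\<And>h. h \<in> order_ideal (mult_at A) \<Longrightarrow> h \<in> W_poly C 5 \<Longrightarrow> laurent C h = 0"
  shows "represents C A [a, b, c, d, e, f, inverse a]"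
proof -
  define I where "I = order_ideal (mult_at A)"
  define F where "F = F_poly a b c"
  define G where "G = G_poly d e f"
  define Z where "Z = vy * F - vx * G"
  note lead = F_leading[of C a b c, folded F_def] G_leading[of C d e f, folded G_def]
    FG_leading[OF a, of C b c d e f, folded F_def G_def, folded Z_def]
  have I_on: "is_ideal_on C I" unfolding I_def by (rule is_ideal_on_order_ideal)
  note I = I_on I_on[unfolded is_ideal_on_def, THEN conjunct1] is_space_ideal[OF I_on]
  have FI: "F \<in> I" and GI: "G \<in> I" using F G by (simp_all add: I_def F_def G_def)
  have ZI: "Z \<in> I" unfolding Z_def by (intro is_idealD(6)[OF I(2)] is_idealD(3)[OF I(2)] FI GI)
  have ge6: "n \<in> pole_ords C I" if "6 \<le> n" for n
  proof (rule pole_ords_ideal_ge[OF I(2) that])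
    fix i :: nat assume "i < 3"
    then have "i = 0 \<or> i = 1 \<or> i = 2" by auto
    then show "[F, G, Z] ! i \<in> I \<and> laurent C ([F, G, Z] ! i) \<noteq> 0 \<and> pole_ord C ([F, G, Z] ! i) = int (6 + i)"
      using FI GI ZI lead by auto
  qed
  have not5: "n \<notin> pole_ords C I" if "n \<in> {0, 3, 4}" for n
  proof
    assume "n \<in> pole_ords C I"
    then obtain P where P: "P \<in> I" "laurent C P \<noteq> 0" "pole_ord C P = int n" by (auto simp: pole_ords_def)
    then have "P \<in> W_poly C 5" using that by (auto simp: W_poly_def)
    then show False using small P(1,2) by (simp add: I_def)
  qed
  have all: "n \<in> pole_ords C UNIV" if "n \<in> {0, 3, 4}" for n
    using that pole_ord_monomial[of C 0 0] pole_ord_monomial[of C 1 0] pole_ord_monomial[of C 0 1]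
    unfolding pole_ords_def by fastforce
  have "pole_ords C UNIV - pole_ords C I = {0, 3, 4}"
    using pole_ords_UNIV ge6 not5 all by blast
  then have "nat (divisor_degree C A) = 3"
    using extends_pole_ords(4)[OF extends_divisor_degree[OF A], of C] I(3) by (simp add: I_def)
  then have deg: "divisor_degree C A = 3" by simp
  have W_F: "cls C F \<in> W_div C A 6" and W_G: "cls C G \<in> W_div C A 7"
    using lead FI GI cls_mem_I_div_iff[OF A] by (simp_all add: W_div_def cls_mem_W_iff I_def)
  define U where "U = {F * u + G * v + w | u v w. u \<in> W_poly C 6 \<and> v \<in> W_poly C 5 \<and> w \<in> W_poly C 5}"
  have U_I: "F * u + G * v + w \<in> U" if "u \<in> W_poly C 6" "v \<in> W_poly C 5" "w \<in> W_poly C 5" for u v w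
    using that unfolding U_def by blast
  have zero: "0 \<in> W_poly C N" for N by (simp add: W_poly_def laurent_hom)
  have U_space: "is_space C U"
    unfolding is_space_def
  proof (intro conjI allI ballI impI)
    fix P assume "laurent C P = 0"
    then show "P \<in> U" using U_I[OF zero zero, of P] by (simp add: W_poly_def)
  next
    fix P Q assume "P \<in> U" "Q \<in> U"
    then obtain u v w u' v' w' where *: "P = F * u + G * v + w" "Q = F * u' + G * v' + w'"
      "u \<in> W_poly C 6" "v \<in> W_poly C 5" "w \<in> W_poly C 5" "u' \<in> W_poly C 6" "v' \<in> W_poly C 5" "w' \<in> W_poly C 5"
      unfolding U_def by blast
    have "P + Q = F * (u + u') + G * (v + v') + (w + w')" by (simp add: * algebra_simps)
    then show "P + Q \<in> U" using U_I W_poly_add * by metis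
  next
    fix k P assume "P \<in> U"
    then obtain u v w where *: "P = F * u + G * v + w"
      "u \<in> W_poly C 6" "v \<in> W_poly C 5" "w \<in> W_poly C 5" unfolding U_def by blast
    have "Cst k * P = F * (Cst k * u) + G * (Cst k * v) + Cst k * w" by (simp add: * algebra_simps)
    then show "Cst k * P \<in> U" using U_I W_poly_Cst_mult *(2-4) by metis
  qed
  have U_sub: "U \<subseteq> W_poly C 12"
  proof
    fix P assume "P \<in> U"
    then obtain u v w where *: "P = F * u + G * v + w"
      "u \<in> W_poly C 6" "v \<in> W_poly C 5" "w \<in> W_poly C 5" unfolding U_def by blast
    have "F \<in> W_poly C 6" "G \<in> W_poly C 7" using lead by (auto simp: W_poly_def)
    from W_poly_mult[OF this(1) *(2)] W_poly_mult[OF this(2) *(3)]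
    have "F * u \<in> W_poly C 12" "G * v \<in> W_poly C 12" by simp_all
    then show "P \<in> W_poly C 12" unfolding *(1) using W_poly_mono[OF *(4)] by (intro W_poly_add) auto
  qed
  have U_eq: "U = W_poly C 12"
  proof (rule space_eqI[OF U_space is_space_W_poly U_sub], rule subsetI)
    fix n assume "n \<in> pole_ords C (W_poly C 12)"
    then have n: "n \<in> pole_ords C UNIV" "n \<le> 12" by (auto simp: pole_ords_W_poly)
    show "n \<in> pole_ords C U"
    proof (cases "n \<le> 5")
      case True
      then have "n \<in> pole_ords C (W_poly C 5)" using n by (simp add: pole_ords_W_poly)
      moreover have "W_poly C 5 \<subseteq> U" using U_I[OF zero zero] by auto
      ultimately show ?thesis by (auto simp: pole_ords_def)
    next
      case False
      have FU: "F * u \<in> U" if "u \<in> W_poly C 6" for u using U_I[OF that zero zero] by simp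
      have GU: "G * v \<in> U" if "v \<in> W_poly C 5" for v using U_I[OF zero that zero] by simp
      have ZU: "Z \<in> U" using U_I[of vy "- vx" 0] zero
        by (simp add: Z_def W_poly_minus W_poly_monomials algebra_simps)
      have mem: "n \<in> pole_ords C U" if "P \<in> U" "laurent C P \<noteq> 0" "pole_ord C P = int n" for P
        using that unfolding pole_ords_def by blast
      have multF: "laurent C (F * (vx ^ i * vy ^ j)) \<noteq> 0 \<and> pole_ord C (F * (vx ^ i * vy ^ j)) = 6 + 3 * int i + 4 * int j" for i j
        using pole_ord_mult[OF lead(1) pole_ord_monomial(1), of i j] lead(1,2) pole_ord_monomial[of C i j]
        by (simp add: laurent_hom(4))
      have multG: "laurent C (G * (vx ^ i * vy ^ j)) \<noteq> 0 \<and> pole_ord C (G * (vx ^ i * vy ^ j)) = 7 + 3 * int i + 4 * int j" for i j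
        using pole_ord_mult[OF lead(3) pole_ord_monomial(1), of i j] lead(3,4) pole_ord_monomial[of C i j]
        by (simp add: laurent_hom(4))
      have "n = 6 + 3 * 0 + 4 * 0 \<or> n = 7 + 3 * 0 + 4 * 0 \<or> n = 8 \<or> n = 6 + 3 * 1 + 4 * 0 \<or> n = 6 + 3 * 0 + 4 * 1
        \<or> n = 7 + 3 * 0 + 4 * 1 \<or> n = 6 + 3 * 2 + 4 * 0"
        using n(2) False by presburger
      moreover have "n \<in> pole_ords C U" if "n = 6 + 3 * i + 4 * j" "3 * i + 4 * j \<le> 6" for i j
        using that multF[of i j] by (intro mem[of "F * (vx ^ i * vy ^ j)"] FU W_poly_monomial) auto
      moreover have "n \<in> pole_ords C U" if "n = 7 + 3 * i + 4 * j" "3 * i + 4 * j \<le> 5" for i j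
        using that multG[of i j] by (intro mem[of "G * (vx ^ i * vy ^ j)"] GU W_poly_monomial) auto
      moreover have "n \<in> pole_ords C U" if "n = 8"
        using mem[OF ZU] lead(5,6) that by simp
      ultimately show ?thesis by fastforce
    qed
  qed
  have "{cls C F \<otimes>\<^bsub>R C\<^esub> u \<oplus>\<^bsub>R C\<^esub> cls C G \<otimes>\<^bsub>R C\<^esub> v \<oplus>\<^bsub>R C\<^esub> w | u v w.
      u \<in> W C 6 \<and> v \<in> W C 5 \<and> w \<in> W C 5} = cls C ` U"
  proof (intro equalityI subsetI)
    fix z assume "z \<in> {cls C F \<otimes>\<^bsub>R C\<^esub> u \<oplus>\<^bsub>R C\<^esub> cls C G \<otimes>\<^bsub>R C\<^esub> v \<oplus>\<^bsub>R C\<^esub> w | u v w.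
      u \<in> W C 6 \<and> v \<in> W C 5 \<and> w \<in> W C 5}"
    then obtain u v w where "u \<in> W_poly C 6" "v \<in> W_poly C 5" "w \<in> W_poly C 5"
      "z = cls C F \<otimes>\<^bsub>R C\<^esub> cls C u \<oplus>\<^bsub>R C\<^esub> cls C G \<otimes>\<^bsub>R C\<^esub> cls C v \<oplus>\<^bsub>R C\<^esub> cls C w"
      unfolding W_eq by blast
    then show "z \<in> cls C ` U" using U_I by (simp flip: residue_class_hom)
  next
    fix z assume "z \<in> cls C ` U"
    then obtain u v w where "u \<in> W_poly C 6" "v \<in> W_poly C 5" "w \<in> W_poly C 5" "z = cls C (F * u + G * v + w)"
      unfolding U_def by blast
    then show "z \<in> {cls C F \<otimes>\<^bsub>R C\<^esub> u \<oplus>\<^bsub>R C\<^esub> cls C G \<otimes>\<^bsub>R C\<^esub> v \<oplus>\<^bsub>R C\<^esub> w | u v w.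
      u \<in> W C 6 \<and> v \<in> W C 5 \<and> w \<in> W C 5}" unfolding W_eq residue_class_hom by blast
  qed
  then have span: "{cls C F \<otimes>\<^bsub>R C\<^esub> u \<oplus>\<^bsub>R C\<^esub> cls C G \<otimes>\<^bsub>R C\<^esub> v \<oplus>\<^bsub>R C\<^esub> w | u v w.
      u \<in> W C 6 \<and> v \<in> W C 5 \<and> w \<in> W C 5} = W C 12"
    by (simp add: U_eq W_eq)
  have "typical C A"
    unfolding typical_def Let_def deg genus_def
    using A W_F W_G span by (intro conjI bexI[of _ "cls C F"] bexI[of _ "cls C G"]) simp_all
  then show ?thesis
    unfolding represents_def using deg a W_F W_G by (auto simp: F_def G_def)
qed

end

section \<open>The second stage\<close>

text \<open>
  The formulas of the second stage solve the linear system that puts \<open>F t + G\<^sub>0 s\<close> into \<open>W\<^sup>8\<close>, where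
  \<open>G\<^sub>0 = s1 F - G\<close>. The equations are triangular, so no determinant appears, and \<open>l1\<close> is the only
  quantity that is inverted.
\<close>
lemma second_stage_relation:
  fixes C :: "'a::field c34"
  assumes l1: "l1 = t1 - s2 + s1 ^ 2"
    and l2: "l2 = t2 - s3 + s1 * (s2 + p2 C)"
    and l3: "l3 = t3 + s1 * s3"
    and m0: "m0 = l3 - l1 * t1"
    and m1: "m1 = - s4 - (l1 * t2 + l2 * t1) - m0 * s1"
    and m2: "m2 = t4 - s5 + s1 * (s4 + p1 C) + p2 C * l3 - (l1 * t3 + l2 * t2) - m0 * (s2 + p2 C)"
    and m3: "m3 = t5 + s1 * (s5 + q2 C) - l2 * t3 - m0 * s3"
    and \<mu>: "\<mu> * l1 = m1"
    and F: "F = F_poly (- l1) (- (\<mu> + l2)) (\<mu> * l2 - m2)"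
    and G: "G = G_poly (- \<mu> - s1 * l1) (m0 - s1 * l2) (m3 - \<mu> * l3 + s1 * (\<mu> * l2 - m2))"
  shows "\<exists>Q. F * t_poly t1 t2 t3 t4 t5 t6 + (Cst s1 * F - G) * s_poly s1 s2 s3 s4 s5 s6 - Q * curve_poly C \<in> W_poly C 8"
proof -
  define f1 f0 g1 g0 k where "f1 = - (\<mu> + l2)" and "f0 = \<mu> * l2 - m2" and "g1 = - (m0 + \<mu> * s1)"
    and "g0 = \<mu> * l3 - m3" and "k = \<mu> * s1 - l1 * t1"
  note fg = f1_def f0_def g1_def g0_def k_def
  have vanish:
    "t1 - s2 + s1 ^ 2 - l1 = 0"
    "t2 + f1 - s3 + s1 * s2 + \<mu> + s1 * p2 C = 0"
    "t3 + g1 + s1 * s3 + k = 0"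
    "\<mu> * s1 - l1 * t1 - k = 0"
    "f1 * t3 + t5 + g0 + g1 * s3 + s1 * s5 + s1 * q2 C = 0"
    "f0 + f1 * t2 - l1 * t3 + t4 + \<mu> * s3 + g1 * s2 + s1 * s4 - s5 - k * p2 C + s1 * p1 C = 0"
    "f1 * t1 - l1 * t2 - s4 + \<mu> * s2 + g1 * s1 = 0"
  proof -
    show "t1 - s2 + s1 ^ 2 - l1 = 0" by (simp add: l1)
    show "t2 + f1 - s3 + s1 * s2 + \<mu> + s1 * p2 C = 0" by (simp add: fg l2 algebra_simps)
    show "t3 + g1 + s1 * s3 + k = 0" by (simp add: fg l3 m0 algebra_simps)
    show "\<mu> * s1 - l1 * t1 - k = 0" by (simp add: fg)
    show "f1 * t3 + t5 + g0 + g1 * s3 + s1 * s5 + s1 * q2 C = 0"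
      unfolding fg m3 by (simp add: l3 algebra_simps)
    have "f0 + f1 * t2 - l1 * t3 + t4 + \<mu> * s3 + g1 * s2 + s1 * s4 - s5 - k * p2 C + s1 * p1 C
       = \<mu> * (l2 - t2 + s3 - s1 * (s2 + p2 C)) + p2 C * (m0 - l3 + l1 * t1)"
      unfolding fg m2 by (simp add: algebra_simps)
    also have "\<dots> = 0" by (simp add: l2 m0)
    finally show "f0 + f1 * t2 - l1 * t3 + t4 + \<mu> * s3 + g1 * s2 + s1 * s4 - s5 - k * p2 C + s1 * p1 C = 0" .
    have "f1 * t1 - l1 * t2 - s4 + \<mu> * s2 + g1 * s1 = m1 - \<mu> * (t1 - s2 + s1 ^ 2)"
      unfolding fg m1 by (simp add: algebra_simps power2_eq_square)
    then show "f1 * t1 - l1 * t2 - s4 + \<mu> * s2 + g1 * s1 = 0" using \<mu> by (simp flip: l1)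
  qed
  define low where "low = Cst (f0 * t1 - l1 * t4 + \<mu> * s4 + g0 * s1) * vy ^ 2
      + Cst (f0 * t2 + f1 * t4 - l1 * t5 - s6 + \<mu> * s5 + g1 * s4 + g0 * s2 - k * p1 C + s1 * p0 C) * (vx * vy)
      + Cst (t6 + f1 * t5 + f0 * t3 + s1 * s6 + g1 * s5 + g0 * s3 - k * q2 C + s1 * q1 C) * vx ^ 2
      + Cst (f0 * t4 - l1 * t6 + \<mu> * s6 + g0 * s4 - k * p0 C) * vy
      + Cst (f1 * t6 + f0 * t5 + g1 * s6 + g0 * s5 - k * q1 C + s1 * q0 C) * vx
      + Cst (f0 * t6 + g0 * s6 - k * q0 C)"
  have F': "F = vx ^ 2 - Cst l1 * vy + Cst f1 * vx + Cst f0"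
    by (simp add: F F_poly_def fg Cst_hom)
  have G': "Cst s1 * F - G = - (vx * vy) + Cst s1 * vx ^ 2 + Cst \<mu> * vy + Cst g1 * vx + Cst g0"
    by (simp add: F G F_poly_def G_poly_def fg Cst_hom algebra_simps)
  have s': "s_poly s1 s2 s3 s4 s5 s6 = vx ^ 3 + Cst s1 * vy ^ 2 + Cst s2 * (vx * vy) + Cst s3 * vx ^ 2
      + Cst s4 * vy + Cst s5 * vx + Cst s6"
    by (simp add: s_poly_def mult.assoc)
  have t': "t_poly t1 t2 t3 t4 t5 t6 = vx ^ 2 * vy + Cst t1 * vy ^ 2 + Cst t2 * (vx * vy) + Cst t3 * vx ^ 2
      + Cst t4 * vy + Cst t5 * vx + Cst t6"
    by (simp add: t_poly_def mult.assoc)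
  have E': "curve_poly C = vy ^ 3 + (Cst (p2 C) * vx ^ 2 + Cst (p1 C) * vx + Cst (p0 C)) * vy
      + Cst (q2 C) * vx ^ 2 + Cst (q1 C) * vx + Cst (q0 C) - vx ^ 4"
    by (simp add: curve_poly_def)
  have "F * t_poly t1 t2 t3 t4 t5 t6 + (Cst s1 * F - G) * s_poly s1 s2 s3 s4 s5 s6
     = (Cst k - Cst s1 * vx) * curve_poly C
      + Cst (t1 - s2 + s1 ^ 2 - l1) * (vx ^ 2 * vy ^ 2)
      + Cst (t2 + f1 - s3 + s1 * s2 + \<mu> + s1 * p2 C) * (vx ^ 3 * vy)
      + Cst (t3 + g1 + s1 * s3 + k) * vx ^ 4
      + Cst (\<mu> * s1 - l1 * t1 - k) * vy ^ 3
      + Cst (f1 * t3 + t5 + g0 + g1 * s3 + s1 * s5 + s1 * q2 C) * vx ^ 3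
      + Cst (f0 + f1 * t2 - l1 * t3 + t4 + \<mu> * s3 + g1 * s2 + s1 * s4 - s5 - k * p2 C + s1 * p1 C) * (vx ^ 2 * vy)
      + Cst (f1 * t1 - l1 * t2 - s4 + \<mu> * s2 + g1 * s1) * (vx * vy ^ 2)
      + low"
    unfolding G' s' t' E' low_def Cst_hom
    unfolding F'
    by (rule relation_expansion)
  also have "\<dots> = (Cst k - Cst s1 * vx) * curve_poly C + low" unfolding vanish by simp
  finally have "F * t_poly t1 t2 t3 t4 t5 t6 + (Cst s1 * F - G) * s_poly s1 s2 s3 s4 s5 s6
     - (Cst k - Cst s1 * vx) * curve_poly C = low" by simp
  moreover have "low \<in> W_poly C 8" unfolding low_def by (intro W_poly_intros) simp_all
  ultimately show ?thesis by metis
qed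

context smooth_c34
begin

text \<open>
  The ideal generated by \<open>s\<close> and \<open>t\<close> has elements of pole orders 9, 10 and 11, hence of all orders from
  9 on, and therefore is a complement of \<open>W\<^sup>8\<close>. As it lies in \<open>I\<^sub>D\<close>, which meets \<open>W\<^sup>8\<close> only in 0, the
  two ideals are equal.
\<close>
lemma order_ideal_generated:
  assumes S: "s_poly s1 s2 s3 s4 s5 s6 \<in> order_ideal e" and T: "t_poly t1 t2 t3 t4 t5 t6 \<in> order_ideal e"
    and l1: "t1 - s2 + s1 ^ 2 \<noteq> 0"
    and small: "\<And>h. h \<in> order_ideal e \<Longrightarrow> h \<in> W_poly C 8 \<Longrightarrow> laurent C h = 0"
    and P: "P \<in> order_ideal e"
  shows "\<exists>a b. laurent C P = laurent C (a * s_poly s1 s2 s3 s4 s5 s6 + b * t_poly t1 t2 t3 t4 t5 t6)"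
proof -
  define S where "S = s_poly s1 s2 s3 s4 s5 s6"
  define T where "T = t_poly t1 t2 t3 t4 t5 t6"
  define J where "J = {Q. \<exists>a b. laurent C Q = laurent C (a * S + b * T)}"
  have J_I: "Q \<in> J" if "laurent C Q = laurent C (a * S + b * T)" for Q a b using that unfolding J_def by blast
  have J_on: "is_ideal_on C J"
    unfolding is_ideal_on_def is_ideal_def
  proof (intro conjI allI ballI impI)
    show "0 \<in> J" by (rule J_I[of _ 0 0]) simp
    show "laurent C Q = 0 \<Longrightarrow> Q \<in> J" for Q by (rule J_I[of _ 0 0]) (simp add: laurent_hom)
    fix Q Q' A assume "Q \<in> J"
    then obtain a b where ab: "laurent C Q = laurent C (a * S + b * T)" by (auto simp: J_def)
    then show "A * Q \<in> J" by (intro J_I[of _ "A * a" "A * b"]) (simp add: laurent_hom algebra_simps)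
    assume "Q' \<in> J"
    then obtain a' b' where "laurent C Q' = laurent C (a' * S + b' * T)" by (auto simp: J_def)
    with ab show "Q + Q' \<in> J" by (intro J_I[of _ "a + a'" "b + b'"]) (simp add: laurent_hom algebra_simps)
  qed
  have J: "is_ideal J" "is_space C J" using J_on is_space_ideal by (auto simp: is_ideal_on_def)
  obtain Z a b where Z: "laurent C Z \<noteq> 0" "pole_ord C Z = 11" "Z = a * S + b * T - Cst s1 * E"
    using st_leading[OF l1, of C s3 s4 s5 s6 t2 t3 t4 t5 t6] unfolding S_def T_def by blast
  have "S \<in> J" by (rule J_I[of _ 1 0]) simp
  moreover have "T \<in> J" by (rule J_I[of _ 0 1]) simp
  moreover have "Z \<in> J" by (rule J_I[of _ a b]) (simp add: Z(3) laurent_hom laurent_curve_poly)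
  ultimately have ge9: "n \<in> pole_ords C J" if "9 \<le> n" for n
  proof (intro pole_ords_ideal_ge[OF J(1) that, of "\<lambda>i. [S, T, Z] ! i"])
    fix i :: nat assume "i < 3" and JJ: "S \<in> J" "T \<in> J" "Z \<in> J"
    then have "i = 0 \<or> i = 1 \<or> i = 2" by auto
    then show "[S, T, Z] ! i \<in> J \<and> laurent C ([S, T, Z] ! i) \<noteq> 0 \<and> pole_ord C ([S, T, Z] ! i) = int (9 + i)"
      using JJ Z(1,2) s_leading[of C s1 s2 s3 s4 s5 s6] t_leading[of C t1 t2 t3 t4 t5 t6]
      by (auto simp: S_def T_def)
  qed
  define U where "U = {Q + w | Q w. Q \<in> J \<and> w \<in> W_poly C 8}"
  have J0: "0 \<in> J" using is_idealD(1)[OF J(1)] .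
  have W0: "0 \<in> W_poly C 8" by (simp add: W_poly_def laurent_hom)
  have U_I: "Q + w \<in> U" if "Q \<in> J" "w \<in> W_poly C 8" for Q w using that unfolding U_def by blast
  have U: "is_space C U"
    unfolding is_space_def
  proof (intro conjI allI ballI impI)
    fix Q assume "laurent C Q = 0"
    then show "Q \<in> U" using U_I[OF _ W0, of Q] J(2) by (auto simp: is_space_def)
  next
    fix Q Q' assume "Q \<in> U" "Q' \<in> U"
    then obtain A w A' w' where *: "Q = A + w" "Q' = A' + w'" "A \<in> J" "A' \<in> J" "w \<in> W_poly C 8" "w' \<in> W_poly C 8"
      unfolding U_def by blast
    have "Q + Q' = (A + A') + (w + w')" by (simp add: *)
    then show "Q + Q' \<in> U" using U_I is_spaceD(2)[OF J(2) *(3,4)] W_poly_add[OF *(5,6)] by metis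
  next
    fix c Q assume "Q \<in> U"
    then obtain A w where *: "Q = A + w" "A \<in> J" "w \<in> W_poly C 8" unfolding U_def by blast
    have "Cst c * Q = Cst c * A + Cst c * w" by (simp add: * algebra_simps)
    then show "Cst c * Q \<in> U" using U_I is_spaceD(3)[OF J(2) *(2)] W_poly_Cst_mult[OF *(3)] by metis
  qed
  have "U = UNIV"
  proof (rule space_eqI[OF U is_space_UNIV], simp, rule subsetI)
    fix n assume n: "n \<in> pole_ords C UNIV"
    have "J \<subseteq> U" "W_poly C 8 \<subseteq> U" using U_I[OF _ W0] U_I[OF J0] by auto
    then have "pole_ords C J \<subseteq> pole_ords C U" "pole_ords C (W_poly C 8) \<subseteq> pole_ords C U"
      by (auto simp: pole_ords_def)
    moreover have "n \<in> pole_ords C J \<or> n \<in> pole_ords C (W_poly C 8)"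
      using ge9[of n] n by (cases "9 \<le> n") (auto simp: pole_ords_W_poly)
    ultimately show "n \<in> pole_ords C U" by blast
  qed
  then obtain Q w where Q: "P = Q + w" "Q \<in> J" "w \<in> W_poly C 8" unfolding U_def by blast
  obtain a b where ab: "laurent C Q = laurent C (a * S + b * T)" using Q(2) by (auto simp: J_def)
  have oi: "is_ideal (order_ideal e)" "is_space C (order_ideal e)"
    using is_ideal_on_order_ideal[of e] is_space_ideal[OF is_ideal_on_order_ideal] by (simp_all add: is_ideal_on_def)
  have "a * S + b * T \<in> order_ideal e"
    by (intro is_idealD(2,3)[OF oi(1)]) (use assms(1,2) in \<open>simp_all add: S_def T_def\<close>)
  then have "Q \<in> order_ideal e" using laurent_cong_mem[OF oi(2) ab] by blast
  then have "P - Q \<in> order_ideal e" using is_spaceD(4)[OF oi(2) P] by blast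
  then have "laurent C w = 0" using small Q(1,3) by simp
  then show ?thesis using ab Q(1) by (auto simp: S_def T_def laurent_hom)
qed

text \<open>
  Since \<open>s\<close> and \<open>t\<close> generate the ideal of \<open>Dt\<close>, the smaller of their orders at a point is the
  multiplicity in \<open>Dt\<close>. With this, the relation \<open>F t = - G\<^sub>0 s\<close> translates into \<open>div F \<ge> D\<close> and, once
  \<open>A\<close> is defined by \<open>div F = D + A\<close>, into \<open>div G\<^sub>0 \<ge> A\<close>.
\<close>
lemma second_stage:
  assumes Dt: "good C Dt" and small: "\<And>h. h \<in> order_ideal (mult_at Dt) \<Longrightarrow> h \<in> W_poly C 8 \<Longrightarrow> laurent C h = 0"
    and SI: "S \<in> order_ideal (mult_at Dt)" and TI: "T \<in> order_ideal (mult_at Dt)"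
    and S: "S = s_poly s1 s2 s3 s4 s5 s6" and T: "T = t_poly t1 t2 t3 t4 t5 t6"
    and l1: "t1 - s2 + s1 ^ 2 \<noteq> 0" and F: "F = F_poly a b c" and G: "G = G_poly d e f" and a: "a \<noteq> 0"
    and rel: "laurent C (F * T + (Cst s1 * F - G) * S) = 0"
  shows "\<exists>D A. good C D \<and> good C A \<and> affine_div C (cls C S) = Dt + D \<and> cls C F \<in> W_div C D 6 \<and>
    affine_div C (cls C F) = D + A \<and> represents C A [a, b, c, d, e, f, inverse a]"
proof -
  define \<epsilon> where "\<epsilon> = mult_at Dt"
  define H where "H = Cst s1 * F - G"
  have S0: "laurent C S \<noteq> 0" "pole_ord C S = 9" and T0: "laurent C T \<noteq> 0"
    unfolding S T by (rule s_leading t_leading)+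
  have F0: "laurent C F \<noteq> 0" "pole_ord C F = 6" using F_leading by (simp_all add: F)
  have G0: "laurent C G \<noteq> 0" using G_leading by (simp add: G)
  have rel': "laurent C (F * T) = laurent C (- (H * S))"
    using rel by (simp add: H_def laurent_hom eq_neg_iff_add_eq_0)
  have H0: "laurent C H \<noteq> 0"
  proof
    assume "laurent C H = 0"
    then have "laurent C F * laurent C T = 0" using rel' by (simp add: laurent_hom)
    then show False using F0 T0 by simp
  qed
  have vals: "val M F + val M T = val M H + val M S" if M: "M \<in> \<M>" for M
  proof -
    have "val M (F * T) = val M (- H * S)" using val_cong[OF rel'] by simp
    moreover have "laurent C (- H) \<noteq> 0" using H0 by (simp add: laurent_hom)
    moreover have "val M (- H) = val M H"
      using val_mult[OF M, of "- 1" H] val_pos_iff[OF M, of "- 1"] H0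
        is_idealD(5)[OF maximal_idealsD(1)[OF M], of "- 1"] maximal_idealsD(4)[OF M]
      by (auto simp: laurent_hom)
    ultimately show ?thesis using val_mult[OF M] F0 T0 S0 by metis
  qed
  have \<epsilon>_le: "\<epsilon> M \<le> val M S" "\<epsilon> M \<le> val M T" if "M \<in> \<M>" for M
    using SI TI S0 T0 that by (auto simp: order_ideal_def \<epsilon>_def)
  have \<epsilon>_min: "val M S = \<epsilon> M \<or> val M T = \<epsilon> M" if M: "M \<in> \<M>" for M
  proof (rule ccontr)
    assume "\<not> (val M S = \<epsilon> M \<or> val M T = \<epsilon> M)"
    then have gt: "Suc (\<epsilon> M) \<le> val M S" "Suc (\<epsilon> M) \<le> val M T" using \<epsilon>_le[OF M] by auto
    obtain P where P: "P \<in> order_ideal \<epsilon>" "laurent C P \<noteq> 0" "val M P = \<epsilon> M"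
      using exact_order[OF M goodD(3)[OF Dt]] by (auto simp: \<epsilon>_def)
    obtain u v where uv: "laurent C P = laurent C (u * S + v * T)"
      using order_ideal_generated[of s1 s2 s3 s4 s5 s6 "mult_at Dt" t1 t2 t3 t4 t5 t6 P] SI TI l1 small P(1)
      unfolding S T \<epsilon>_def by blast
    define V where "V = {Q. locally_divisible E M (uniformizer M ^ Suc (\<epsilon> M)) Q}"
    have V: "is_ideal_on C V" unfolding V_def by (rule locally_divisible_ideal[OF M])
    have "S \<in> V" "T \<in> V"
      unfolding V_def mem_Collect_eq using gt locally_divisible_val[OF M S0(1)] locally_divisible_val[OF M T0] by blast+
    then have "u * S + v * T \<in> V"
      using V unfolding is_ideal_on_def by (intro is_idealD(2,3)) auto
    then have "P \<in> V" using laurent_cong_mem[OF is_space_ideal[OF V] uv] by blast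
    then have "Suc (\<epsilon> M) \<le> val M P"
      unfolding V_def mem_Collect_eq using locally_divisible_val[OF M P(2)] by blast
    then show False using P(3) by simp
  qed
  have FD: "val M S - \<epsilon> M \<le> val M F" if M: "M \<in> \<M>" for M
    using vals[OF M] \<epsilon>_le[OF M] \<epsilon>_min[OF M] by linarith
  define D where "D = affine_div C (cls C S) - Dt"
  define A where "A = affine_div C (cls C F) - D"
  have D_out: "D p = 0" and A_out: "A p = 0" if "p \<notin> point_of ` \<M>" for p
    using that goodD(1)[OF Dt that] by (simp_all add: D_def A_def affine_div_outside)
  have D_at: "D (point_of M) = int (val M S - \<epsilon> M)" if M: "M \<in> \<M>" for M
    using \<epsilon>_le[OF M] by (simp add: D_def affine_div_point_of[OF M] goodD(4)[OF Dt] \<epsilon>_def)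
  have A_at: "A (point_of M) = int (val M F - (val M S - \<epsilon> M))" if M: "M \<in> \<M>" for M
    using FD[OF M] by (simp add: A_def affine_div_point_of[OF M] D_at[OF M])
  have D: "good C D"
  proof (rule goodI)
    have "{M \<in> \<M>. D (point_of M) \<noteq> 0} \<subseteq> {M \<in> \<M>. S \<in> M}"
    proof
      fix M assume "M \<in> {M \<in> \<M>. D (point_of M) \<noteq> 0}"
      then have M: "M \<in> \<M>" "D (point_of M) \<noteq> 0" by auto
      then have "0 < val M S" using D_at[OF M(1)] by auto
      then show "M \<in> {M \<in> \<M>. S \<in> M}" using val_pos_iff[OF M(1) S0(1)] M(1) by blast
    qed
    then show "finite {M \<in> \<M>. D (point_of M) \<noteq> 0}" using finite_zeros[OF S0(1)] finite_subset by blast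
  qed (simp_all add: D_out D_at)
  have A: "good C A"
  proof (rule goodI)
    have "{M \<in> \<M>. A (point_of M) \<noteq> 0} \<subseteq> {M \<in> \<M>. F \<in> M}"
    proof
      fix M assume "M \<in> {M \<in> \<M>. A (point_of M) \<noteq> 0}"
      then have M: "M \<in> \<M>" "A (point_of M) \<noteq> 0" by auto
      then have "0 < val M F" using A_at[OF M(1)] by auto
      then show "M \<in> {M \<in> \<M>. F \<in> M}" using val_pos_iff[OF M(1) F0(1)] M(1) by blast
    qed
    then show "finite {M \<in> \<M>. A (point_of M) \<noteq> 0}" using finite_zeros[OF F0(1)] finite_subset by blast
  qed (simp_all add: A_out A_at)
  have mult_D: "mult_at D M = val M S - \<epsilon> M" and mult_A: "mult_at A M = val M F - (val M S - \<epsilon> M)"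
    if "M \<in> \<M>" for M using D_at[OF that] A_at[OF that] by (simp_all add: mult_at_def)
  have F_D: "F \<in> order_ideal (mult_at D)" using FD by (simp add: order_ideal_def mult_D)
  have F_A: "F \<in> order_ideal (mult_at A)" by (simp add: order_ideal_def mult_A)
  have "mult_at A M \<le> val M H" if M: "M \<in> \<M>" for M
    using vals[OF M] \<epsilon>_le[OF M] by (simp add: mult_A[OF M])
  then have H_A: "H \<in> order_ideal (mult_at A)" by (simp add: order_ideal_def)
  have idA: "is_ideal (order_ideal (mult_at A))" using is_ideal_on_order_ideal by (simp add: is_ideal_on_def)
  have "G = Cst s1 * F - H" by (simp add: H_def)
  then have G_A: "G \<in> order_ideal (mult_at A)"
    using is_idealD(6)[OF idA is_idealD(3)[OF idA F_A] H_A] by metis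
  have "laurent C h = 0" if h: "h \<in> order_ideal (mult_at A)" "h \<in> W_poly C 5" for h
  proof (rule ccontr)
    assume h0: "laurent C h \<noteq> 0"
    have hS0: "laurent C (h * S) \<noteq> 0" using h0 S0 by (simp add: laurent_hom)
    have hS: "val M F + \<epsilon> M \<le> val M (h * S)" if M: "M \<in> \<M>" for M
    proof -
      have "mult_at A M \<le> val M h" using h(1) h0 M by (simp add: order_ideal_def)
      then show ?thesis using val_mult[OF M h0 S0(1)] mult_A[OF M] FD[OF M] \<epsilon>_le[OF M] by linarith
    qed
    \<comment> \<open>The quotient \<open>h s / F\<close> vanishes on \<open>Dt\<close> and has pole order at most \<open>5 + 9 - 6 = 8\<close>.\<close>
    obtain q where q: "laurent C (h * S) = laurent C q * laurent C F"
      using divides_if_val_le[OF F0(1) hS0] hS by (meson add_leD1)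
    have q0: "laurent C q \<noteq> 0" using q hS0 by auto
    have q': "laurent C (h * S) = laurent C (q * F)" using q by (simp add: laurent_hom)
    have "\<epsilon> M \<le> val M q" if M: "M \<in> \<M>" for M
      using hS[OF M] val_cong[OF q', of M] val_mult[OF M q0 F0(1)] by simp
    then have "q \<in> order_ideal \<epsilon>" by (simp add: order_ideal_def)
    moreover have "pole_ord C q + 6 = pole_ord C h + 9"
      using pole_ord_mult[OF h0 S0(1)] pole_ord_mult[OF q0 F0(1)] q' S0(2) F0(2) by (simp add: pole_ord_def)
    then have "q \<in> W_poly C 8" using h(2) h0 by (simp add: W_poly_def)
    ultimately show False using small q0 by (simp add: \<epsilon>_def)
  qed
  then have rep: "represents C A [a, b, c, d, e, f, inverse a]"
    using represents_if_generators[OF A a] F_A G_A by (simp add: F G)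
  have "cls C F \<in> W_div C D 6"
    using F_D F0 by (simp add: W_div_def cls_mem_W_iff cls_mem_I_div_iff[OF D])
  moreover have "affine_div C (cls C S) = Dt + D" "affine_div C (cls C F) = D + A" by (simp_all add: D_def A_def)
  ultimately show ?thesis using D A rep by blast
qed

lemma is_divisor_minus_P_inf:
  assumes "good C D"
  shows "is_divisor C (D - 3 * P_inf)"
proof -
  have D: "finite {p. D p \<noteq> 0}" "{p. D p \<noteq> 0} \<subseteq> points C"
    using goodD(5)[OF assms] by (auto simp: is_divisor_def)
  have sub: "{p. (D - 3 * P_inf) p \<noteq> 0} \<subseteq> insert At_Infinity {p. D p \<noteq> 0}" by (auto simp: P_inf_def)
  then have "finite {p. (D - 3 * P_inf) p \<noteq> 0}" using D(1) finite_subset by blast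
  moreover have "insert At_Infinity {p. D p \<noteq> 0} \<subseteq> points C" using D(2) by (auto simp: points_def)
  ultimately show ?thesis using sub unfolding is_divisor_def by blast
qed

lemma is_divisor_add:
  assumes "is_divisor C D" "is_divisor C D'"
  shows "is_divisor C (D + D')"
proof -
  have "{p. (D + D') p \<noteq> 0} \<subseteq> {p. D p \<noteq> 0} \<union> {p. D' p \<noteq> 0}" by auto
  then show ?thesis using assms unfolding is_divisor_def by (meson finite_UnI finite_subset le_sup_iff subset_trans)
qed

text \<open>
  The equivalence is given by the function \<open>F / s\<close>, whose order at infinity is \<open>9 - 6 = 3\<close>.
\<close>
lemma sum_class_if:
  assumes D1: "good C D1" and D2: "good C D2" and A: "good C A"
    and S: "laurent C S \<noteq> 0" "pole_ord C S = 9" and F: "laurent C F \<noteq> 0" "pole_ord C F = 6"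
    and divS: "affine_div C (cls C S) = (D1 + D2) + D" and divF: "affine_div C (cls C F) = D + A"
  shows "sum_class C D1 D2 A"
proof -
  have "(A - 3 * P_inf) p - ((D1 - 3 * P_inf) + (D2 - 3 * P_inf)) p = ord_at C p (cls C F) - ord_at C p (cls C S)"
    if p: "p \<in> points C" for p
  proof (cases "p = At_Infinity")
    case True
    then show ?thesis
      using D1 D2 A S F by (simp add: good_def P_inf_def pole_order_eq)
  next
    case False
    then have "ord_at C p (cls C F) = D p + A p" "ord_at C p (cls C S) = D1 p + D2 p + D p"
      using fun_cong[OF divF, of p] fun_cong[OF divS, of p] p by (simp_all add: affine_div_def)
    then show ?thesis using False by (simp add: P_inf_def)
  qed
  moreover have "cls C F \<in> carrier (R C) - {\<zero>\<^bsub>R C\<^esub>}" "cls C S \<in> carrier (R C) - {\<zero>\<^bsub>R C\<^esub>}"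
    using S F by (simp_all add: cls_eq_0_iff)
  ultimately show ?thesis
    unfolding sum_class_def lin_equiv_def
    using is_divisor_minus_P_inf[OF A] is_divisor_add[OF is_divisor_minus_P_inf[OF D1] is_divisor_minus_P_inf[OF D2]]
    by blast
qed

lemma new_procedure_correct:
  assumes D: "typical C D1" "divisor_degree C D1 = 3" "typical C D2" "divisor_degree C D2 = 3"
    and semi: "semi_typical C (D1 + D2)"
    and s: "cls C (s_poly s1 s2 s3 s4 s5 s6) \<in> W_div C (D1 + D2) 9"
    and t: "cls C (t_poly t1 t2 t3 t4 t5 t6) \<in> W_div C (D1 + D2) 10"
    and out: "new_procedure C s1 s2 s3 s4 s5 s6 t1 t2 t3 t4 t5 t6 = Some out"
  shows "\<exists>D A a b c d e f. good C D \<and> good C A \<and> out = [a, b, c, d, e, f, inverse a] \<and>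
     affine_div C (cls C (s_poly s1 s2 s3 s4 s5 s6)) = (D1 + D2) + D \<and>
     cls C (F_poly a b c) \<in> W_div C D 6 \<and> affine_div C (cls C (F_poly a b c)) = D + A \<and>
     represents C A out \<and> sum_class C D1 D2 A"
proof -
  define l1 where "l1 = t1 - s2 + s1 ^ 2"
  define l2 where "l2 = t2 - s3 + s1 * (s2 + p2 C)"
  define l3 where "l3 = t3 + s1 * s3"
  define m0 where "m0 = l3 - l1 * t1"
  define m1 where "m1 = - s4 - (l1 * t2 + l2 * t1) - m0 * s1"
  define m2 where "m2 = t4 - s5 + s1 * (s4 + p1 C) + p2 C * l3 - (l1 * t3 + l2 * t2) - m0 * (s2 + p2 C)"
  define m3 where "m3 = t5 + s1 * (s5 + q2 C) - l2 * t3 - m0 * s3"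
  define \<mu> where "\<mu> = m1 / l1"
  note proc = new_procedure_eq[OF l1_def l2_def l3_def m0_def m1_def m2_def m3_def \<mu>_def]
  have l1: "l1 \<noteq> 0" using out unfolding proc by (auto split: if_splits)
  define a b c d e f where "a = - l1" and "b = - (\<mu> + l2)" and "c = \<mu> * l2 - m2"
    and "d = - \<mu> - s1 * l1" and "e = m0 - s1 * l2" and "f = m3 - \<mu> * l3 + s1 * (\<mu> * l2 - m2)"
  have out_eq: "out = [a, b, c, d, e, f, inverse a]"
    using out l1 unfolding proc a_def b_def c_def d_def e_def f_def by simp
  define S T F G where "S = s_poly s1 s2 s3 s4 s5 s6" and "T = t_poly t1 t2 t3 t4 t5 t6"
    and "F = F_poly a b c" and "G = G_poly d e f"
  have good: "good C D1" "good C D2" "good C (D1 + D2)" using D semi by (auto simp: typical_def semi_typical_def)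
  have deg: "divisor_degree C (D1 + D2) = 6"
    using divisor_degree_add[OF goodD(5)[OF good(1)] goodD(5)[OF good(2)]] D by simp
  have small: "laurent C h = 0" if "h \<in> order_ideal (mult_at (D1 + D2))" "h \<in> W_poly C 8" for h
  proof -
    have "cls C h \<in> W_div C (D1 + D2) 8"
      using that by (simp add: W_div_def cls_mem_I_div_iff[OF good(3)] W_eq)
    moreover have "W_div C (D1 + D2) 8 = {\<zero>\<^bsub>R C\<^esub>}"
      using semi unfolding semi_typical_def deg genus_def by simp
    ultimately show ?thesis by (simp add: cls_eq_0_iff)
  qed
  have SI: "S \<in> order_ideal (mult_at (D1 + D2))" and TI: "T \<in> order_ideal (mult_at (D1 + D2))"
    using s t by (simp_all add: W_div_def cls_mem_I_div_iff[OF good(3)] S_def T_def)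
  obtain Q where Q: "F * T + (Cst s1 * F - G) * S - Q * E \<in> W_poly C 8"
    using second_stage_relation[OF l1_def l2_def l3_def m0_def m1_def m2_def m3_def _ F_def[unfolded a_def b_def c_def]
        G_def[unfolded d_def e_def f_def], of t6 s6] l1
    unfolding S_def T_def \<mu>_def by auto
  have oi: "is_ideal (order_ideal (mult_at (D1 + D2)))" "is_space C (order_ideal (mult_at (D1 + D2)))"
    using is_ideal_on_order_ideal[of "mult_at (D1 + D2)"] is_space_ideal[OF is_ideal_on_order_ideal]
    by (simp_all add: is_ideal_on_def)
  have kernel: "laurent C (Q * E) = 0" by (simp add: laurent_hom laurent_curve_poly)
  have "F * T + (Cst s1 * F - G) * S - Q * E \<in> order_ideal (mult_at (D1 + D2))"
    by (intro is_spaceD(4)[OF oi(2)] is_spaceD(1)[OF oi(2) kernel] is_idealD(2,3)[OF oi(1)] SI TI)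
  then have "laurent C (F * T + (Cst s1 * F - G) * S - Q * E) = 0" using small Q by blast
  then have rel: "laurent C (F * T + (Cst s1 * F - G) * S) = 0" using kernel by (simp add: laurent_hom(6))
  have "a \<noteq> 0" using l1 by (simp add: a_def)
  from second_stage[OF good(3) small SI TI S_def T_def l1[unfolded l1_def] F_def G_def this rel]
  obtain D A where DA: "good C D" "good C A" "affine_div C (cls C S) = (D1 + D2) + D" "cls C F \<in> W_div C D 6"
    "affine_div C (cls C F) = D + A" "represents C A [a, b, c, d, e, f, inverse a]"
    by blast
  have "sum_class C D1 D2 A"
    by (rule sum_class_if[OF good(1,2) DA(2) _ _ _ _ DA(3,5)]) (simp_all add: S_def F_def s_leading F_leading)
  then show ?thesis using DA out_eq unfolding S_def F_def by blast
qed

end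

theorem theoremA4:
  fixes add1 dbl1 old2 :: slp
  assumes char2: "CHAR('a::field) \<noteq> 2" and char3: "CHAR('a) \<noteq> 3"
    and add1: "\<And>C :: 'a c34. c34_curve C \<Longrightarrow> addition_first_stage C add1"
    and dbl1: "\<And>C :: 'a c34. c34_curve C \<Longrightarrow> doubling_first_stage C dbl1"
    and old2: "\<And>C :: 'a c34. c34_curve C \<Longrightarrow> correct_second_stage C old2"
    and old_second_cost: "cost_M old2 = 38" "cost_I old2 = 1"
    and old_add_cost: "two_stage_cost_M add1 old2 = 117" "two_stage_cost_I add1 old2 = 2"
    and old_dbl_cost: "two_stage_cost_M dbl1 old2 = 129" "two_stage_cost_I dbl1 old2 = 2"
  shows "\<exists>new2.
    cost_M new2 = 19 \<and> cost_I new2 = 1 \<and>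
    two_stage_cost_M add1 new2 = 98 \<and> two_stage_cost_I add1 new2 = 2 \<and>
    two_stage_cost_M dbl1 new2 = 110 \<and> two_stage_cost_I dbl1 new2 = 2 \<and>
    (\<forall>C :: 'a c34. c34_curve C \<longrightarrow>
       (\<forall>s1 s2 s3 s4 s5 s6 t1 t2 t3 t4 t5 t6.
          run new2 (curve_coeffs C @ [s1, s2, s3, s4, s5, s6, t1, t2, t3, t4, t5, t6])
            = new_procedure C s1 s2 s3 s4 s5 s6 t1 t2 t3 t4 t5 t6) \<and>
       correct_second_stage C new2 \<and>
       correct_addition C add1 new2 \<and>
       correct_doubling C dbl1 new2)"
proof (rule exI[of _ second_stage_code], intro conjI allI impI)
  show "cost_M second_stage_code = 19" "cost_I second_stage_code = 1"
    by (rule cost_second_stage_code)+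
  show "two_stage_cost_M add1 second_stage_code = 98" "two_stage_cost_I add1 second_stage_code = 2"
    "two_stage_cost_M dbl1 second_stage_code = 110" "two_stage_cost_I dbl1 second_stage_code = 2"
    using old_second_cost old_add_cost old_dbl_cost cost_second_stage_code
    by (simp_all add: two_stage_cost_M_def two_stage_cost_I_def)
next
  fix C :: "'a c34" assume C: "c34_curve C"
  interpret smooth_c34 C by unfold_locales (rule C)
  have run: "run second_stage_code (curve_coeffs C @ [s1, s2, s3, s4, s5, s6, t1, t2, t3, t4, t5, t6])
      = new_procedure C s1 s2 s3 s4 s5 s6 t1 t2 t3 t4 t5 t6" for s1 s2 s3 s4 s5 s6 t1 t2 t3 t4 t5 t6
    by (rule run_second_stage_code[OF two_neq_0[OF char2]])
  then show "run second_stage_code (curve_coeffs C @ [s1, s2, s3, s4, s5, s6, t1, t2, t3, t4, t5, t6])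
      = new_procedure C s1 s2 s3 s4 s5 s6 t1 t2 t3 t4 t5 t6" for s1 s2 s3 s4 s5 s6 t1 t2 t3 t4 t5 t6 .
  have second: "\<exists>A. represents C A out \<and> sum_class C D1 D2 A"
    if D: "represents C D1 r1" "represents C D2 r2" and semi: "semi_typical C (D1 + D2)"
      and st: "first_stage_result C (D1 + D2) st" and out: "run second_stage_code (curve_coeffs C @ st) = Some out"
    for D1 D2 r1 r2 st out
  proof -
    obtain s1 s2 s3 s4 s5 s6 t1 t2 t3 t4 t5 t6 where st': "st = [s1, s2, s3, s4, s5, s6, t1, t2, t3, t4, t5, t6]"
      "cls C (s_poly s1 s2 s3 s4 s5 s6) \<in> W_div C (D1 + D2) 9"
      "cls C (t_poly t1 t2 t3 t4 t5 t6) \<in> W_div C (D1 + D2) 10"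
      using st unfolding first_stage_result_def by blast
    have typical: "typical C D1" "divisor_degree C D1 = 3" "typical C D2" "divisor_degree C D2 = 3"
      using D by (auto simp: represents_def)
    show ?thesis
      using new_procedure_correct[OF typical semi st'(2,3)] out unfolding st'(1) run by blast
  qed
  show "correct_second_stage C second_stage_code"
    unfolding correct_second_stage_def run
  proof (intro allI impI, elim conjE)
    fix D1 D2 s1 s2 s3 s4 s5 s6 t1 t2 t3 t4 t5 t6 out
    assume *: "typical C D1" "divisor_degree C D1 = 3" "typical C D2" "divisor_degree C D2 = 3"
      "semi_typical C (D1 + D2)" "cls C (s_poly s1 s2 s3 s4 s5 s6) \<in> W_div C (D1 + D2) 9"
      "cls C (t_poly t1 t2 t3 t4 t5 t6) \<in> W_div C (D1 + D2) 10"
      "new_procedure C s1 s2 s3 s4 s5 s6 t1 t2 t3 t4 t5 t6 = Some out"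
    show "\<exists>D A a b c d e f.
           good C D \<and> good C A \<and> out = [a, b, c, d, e, f, inverse a] \<and>
           affine_div C (cls C (s_poly s1 s2 s3 s4 s5 s6)) = (D1 + D2) + D \<and>
           cls C (F_poly a b c) \<in> W_div C D 6 \<and>
           affine_div C (cls C (F_poly a b c)) = D + A \<and>
           represents C A out \<and> sum_class C D1 D2 A"
      by (rule new_procedure_correct[OF *])
  qed
  show "correct_addition C add1 second_stage_code"
    unfolding correct_addition_def
  proof (intro allI impI, elim conjE)
    fix D1 D2 r1 r2 out
    assume D: "represents C D1 r1" "represents C D2 r2" "D1 \<noteq> D2"
      and "run_two_stage C add1 second_stage_code (r1 @ r2) = Some out"
    then obtain st where st: "run add1 (curve_coeffs C @ r1 @ r2) = Some st"
      "run second_stage_code (curve_coeffs C @ st) = Some out"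
      by (auto simp: run_two_stage_def bind_eq_Some_conv)
    have "semi_typical C (D1 + D2) \<and> first_stage_result C (D1 + D2) st"
      using add1[OF C] D st(1) unfolding addition_first_stage_def by blast
    then show "\<exists>A. represents C A out \<and> sum_class C D1 D2 A" using second D st(2) by blast
  qed
  show "correct_doubling C dbl1 second_stage_code"
    unfolding correct_doubling_def
  proof (intro allI impI, elim conjE)
    fix D1 r1 out
    assume D: "represents C D1 r1" and "run_two_stage C dbl1 second_stage_code r1 = Some out"
    then obtain st where st: "run dbl1 (curve_coeffs C @ r1) = Some st"
      "run second_stage_code (curve_coeffs C @ st) = Some out"
      by (auto simp: run_two_stage_def bind_eq_Some_conv)
    have "semi_typical C (D1 + D1) \<and> first_stage_result C (D1 + D1) st"
      using dbl1[OF C] D st(1) unfolding doubling_first_stage_def by blast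
    then show "\<exists>A. represents C A out \<and> sum_class C D1 D1 A" using second D st(2) by blast
  qed
qed

end
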